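(* Let $X$ be a Hausdorff, second countable, locally compact space and let $(X,T)$, $T=(T_1,\ldots,T_r)$, be a multiply generated dynamical system satisfying (DC). Let $\pi:G(X,T)\to\mathrm{Germ}(X,T)$ be the canonical homomorphism. Then there is a $*$-homomorphism $$\tilde\pi:C^*_r(G(X,T))\to C^*_r(\mathrm{Germ}(X,T))$$ induced by $\pi$, that is, given on $f\in C_c(G(X,T))$ by $\tilde\pi(f)(g)=\sum_{g':\ \pi(g')=g}f(g')$.
   Context: Partial maps on a set are composed on the natural domain: $\mathrm{dom}(LR)=\{x\in \mathrm{dom}(R): R(x)\in \mathrm{dom}(L)\}$. Two partial maps $L,R$ commute if $\mathrm{dom}(LR)=\mathrm{dom}(RL)$ and $LR=RL$ on this set. A multiply generated dynamical system (MGDS) is a pair $(X,T)$ where $X$ is a topological space and $T=(T_1,\ldots,T_r)$ is a system of $r$ pairwise commuting partial maps of $X$, each $T_j$ being a local homeomorphism from an open set $\mathrm{dom}(T_j)\subset X$ onto an open set $\mathrm{ran}(T_j)\subset X$. For $n\in\mathbb{N}^r$ put $T^n=T_1^{n_1}\cdots T_r^{n_r}$ (with $T^0=\mathrm{id}$). The domain condition (DC) is: $\mathrm{dom}(T^n)\cap\mathrm{dom}(T^m)\subset\mathrm{dom}(T^{n\vee m})$ for all $m,n\in\mathbb{N}^r$, where $n\vee m$ is the componentwise maximum. Under (DC) the semidirect product groupoid is $$G(X,T)=\{(x,m-n,y): m,n\in\mathbb{N}^r,\ x\in\mathrm{dom}(T^m),\ y\in\mathrm{dom}(T^n),\ T^mx=T^ny\},$$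 with $(x,z,y)(y,z',y')=(x,z+z',y')$, $(x,z,y)^{-1}=(y,-z,x)$, and topology with basis the sets $\mathcal{U}(U;m,n;V)=\{(x,m-n,y):(x,y)\in U\times V,\ T^mx=T^ny\}$, where $U$ (resp. $V$) is an open subset of $\mathrm{dom}(T^m)$ (resp. $\mathrm{dom}(T^n)$) on which $T^m$ (resp. $T^n$) is injective. A pseudogroup on $X$ is a set of homeomorphisms between open subsets of $X$ that contains the identity and is closed under composition and inversion; it is full if every homeomorphism between open subsets of $X$ that locally coincides with elements of it belongs to it. $\mathcal{G}(X,T)$ is the full pseudogroup generated by the restrictions $T_j|_U$, where $U$ is an open set on which $T_j$ is (defined and) injective. $\mathrm{Germ}(X,T)$ is its groupoid of germs: elements are classes $[x,S,y]$ with $S\in\mathcal{G}(X,T)$, $y\in\mathrm{dom}(S)$, $x=S(y)$, where $[x_1,S_1,y_1]=[x_2,S_2,y_2]$ iff $y_1=y_2$ and $S_1=S_2$ near $y_1$; operations $[x,S,y][y,S',z]=[x,SS',z]$, $[x,S,y]^{-1}=[y,S^{-1},x]$; basic open sets $\{[S(y),S,y]:y\in W\}$, $W\subset\mathrm{dom}(S)$ open. The map $\pi$ is $\pi(x,m-n,y)=[x,(T^m|_U)^{-1}T^n|_V,y]$ for $T^mx=T^ny$, where $U\ni x$, $V\ni y$ are open sets on which $T^m$, respectively $T^n$, is injective. $C_r^*$ denotes the reduced groupoid $C^*$-algebra; for an étale groupoid that is not Hausdorff, $C_c$ denotes the span of the functions that vanish outside an open Hausdorff subset and are continuous with compact support on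 it. *)

theory Defs
  imports "HOL-Analysis.Analysis"
begin

section \<open>Partial maps\<close>

text \<open>
  A partial map of the set underlying a topology \<open>X\<close> is a \<open>'x \<rightharpoonup> 'x\<close>.  The library
  operator \<open>\<circ>\<^sub>m\<close> is composition on the natural domain, so that an equation
  \<open>L \<circ>\<^sub>m R = R \<circ>\<^sub>m L\<close> says both that the domains agree and that the values agree.
\<close>

definition pid :: "'x topology \<Rightarrow> 'x \<rightharpoonup> 'x" where
  "pid X = Some |` topspace X"

definition pinv :: "('x \<rightharpoonup> 'x) \<Rightarrow> 'x \<rightharpoonup> 'x" where
  "pinv S y = (if y \<in> ran S then Some (THE x. S x = Some y) else None)"

definition partial_homeo :: "'x topology \<Rightarrow> ('x \<rightharpoonup> 'x) \<Rightarrow> bool" where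
  "partial_homeo X S \<longleftrightarrow> openin X (dom S) \<and> openin X (ran S) \<and>
     homeomorphic_map (subtopology X (dom S)) (subtopology X (ran S)) (the \<circ> S)"

definition partial_local_homeo :: "'x topology \<Rightarrow> ('x \<rightharpoonup> 'x) \<Rightarrow> bool" where
  "partial_local_homeo X f \<longleftrightarrow> openin X (dom f) \<and> openin X (ran f) \<and>
     (\<forall>x\<in>dom f. \<exists>U. openin X U \<and> x \<in> U \<and> U \<subseteq> dom f \<and> partial_homeo X (f |` U))"


section \<open>Multiply generated dynamical systems\<close>

text \<open>
  The generators are indexed by \<open>0, \<dots>, r - 1\<close>; a multi-index in \<open>\<nat>\<^sup>r\<close> is a function on
  \<open>nat\<close> vanishing from \<open>r\<close> on, and likewise for \<open>\<int>\<^sup>r\<close>.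
\<close>

definition mgds :: "'x topology \<Rightarrow> nat \<Rightarrow> (nat \<Rightarrow> 'x \<rightharpoonup> 'x) \<Rightarrow> bool" where
  "mgds X r T \<longleftrightarrow> (\<forall>j<r. partial_local_homeo X (T j)) \<and>
     (\<forall>i<r. \<forall>j<r. T i \<circ>\<^sub>m T j = T j \<circ>\<^sub>m T i)"

definition multi_indices :: "nat \<Rightarrow> (nat \<Rightarrow> nat) set" where
  "multi_indices r = {n. \<forall>j\<ge>r. n j = 0}"

primrec ppow :: "'x topology \<Rightarrow> ('x \<rightharpoonup> 'x) \<Rightarrow> nat \<Rightarrow> 'x \<rightharpoonup> 'x" where
  "ppow X f 0 = pid X"
| "ppow X f (Suc k) = f \<circ>\<^sub>m ppow X f k"

definition mpow :: "'x topology \<Rightarrow> nat \<Rightarrow> (nat \<Rightarrow> 'x \<rightharpoonup> 'x) \<Rightarrow> (nat \<Rightarrow> nat) \<Rightarrow> 'x \<rightharpoonup> 'x" where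
  "mpow X r T n = foldr (\<lambda>j g. ppow X (T j) (n j) \<circ>\<^sub>m g) [0..<r] (pid X)"

definition domain_condition :: "'x topology \<Rightarrow> nat \<Rightarrow> (nat \<Rightarrow> 'x \<rightharpoonup> 'x) \<Rightarrow> bool" where
  "domain_condition X r T \<longleftrightarrow> (\<forall>m\<in>multi_indices r. \<forall>n\<in>multi_indices r.
     dom (mpow X r T n) \<inter> dom (mpow X r T m) \<subseteq> dom (mpow X r T (\<lambda>j. max (n j) (m j))))"

definition mdiff :: "(nat \<Rightarrow> nat) \<Rightarrow> (nat \<Rightarrow> nat) \<Rightarrow> nat \<Rightarrow> int" where
  "mdiff m n = (\<lambda>j. int (m j) - int (n j))"

definition inj_open :: "'x topology \<Rightarrow> ('x \<rightharpoonup> 'x) \<Rightarrow> 'x set \<Rightarrow> bool" where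
  "inj_open X f U \<longleftrightarrow> openin X U \<and> U \<subseteq> dom f \<and> inj_on f U"


section \<open>Groupoids with a topology on the arrows\<close>

text \<open>
  The product \<open>gmult\<close> is a total function; only its values on composable pairs matter.
\<close>

record 'g top_groupoid =
  arrows :: "'g set"
  gtop :: "'g topology"
  gmult :: "'g \<Rightarrow> 'g \<Rightarrow> 'g"
  ginv :: "'g \<Rightarrow> 'g"

definition gsrc :: "'g top_groupoid \<Rightarrow> 'g \<Rightarrow> 'g" where
  "gsrc G g = gmult G (ginv G g) g"

definition grng :: "'g top_groupoid \<Rightarrow> 'g \<Rightarrow> 'g" where
  "grng G g = gmult G g (ginv G g)"

definition units :: "'g top_groupoid \<Rightarrow> 'g set" where
  "units G = gsrc G ` arrows G"

definition src_fibre :: "'g top_groupoid \<Rightarrow> 'g \<Rightarrow> 'g set" where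
  "src_fibre G u = {g \<in> arrows G. gsrc G g = u}"


section \<open>The semidirect product groupoid\<close>

definition sdp_arrows ::
    "'x topology \<Rightarrow> nat \<Rightarrow> (nat \<Rightarrow> 'x \<rightharpoonup> 'x) \<Rightarrow> ('x \<times> (nat \<Rightarrow> int) \<times> 'x) set" where
  "sdp_arrows X r T = {(x, mdiff m n, y) | x m n y.
     m \<in> multi_indices r \<and> n \<in> multi_indices r \<and>
     x \<in> dom (mpow X r T m) \<and> y \<in> dom (mpow X r T n) \<and> mpow X r T m x = mpow X r T n y}"

definition sdp_basic ::
    "'x topology \<Rightarrow> nat \<Rightarrow> (nat \<Rightarrow> 'x \<rightharpoonup> 'x) \<Rightarrow> 'x set \<Rightarrow> (nat \<Rightarrow> nat) \<Rightarrow> (nat \<Rightarrow> nat) \<Rightarrow> 'x set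
      \<Rightarrow> ('x \<times> (nat \<Rightarrow> int) \<times> 'x) set" where
  "sdp_basic X r T U m n V =
     {(x, mdiff m n, y) | x y. x \<in> U \<and> y \<in> V \<and> mpow X r T m x = mpow X r T n y}"

definition sdp_topology ::
    "'x topology \<Rightarrow> nat \<Rightarrow> (nat \<Rightarrow> 'x \<rightharpoonup> 'x) \<Rightarrow> ('x \<times> (nat \<Rightarrow> int) \<times> 'x) topology" where
  "sdp_topology X r T = topology_generated_by {sdp_basic X r T U m n V | U m n V.
     m \<in> multi_indices r \<and> n \<in> multi_indices r \<and>
     inj_open X (mpow X r T m) U \<and> inj_open X (mpow X r T n) V}"

definition sdp_groupoid ::
    "'x topology \<Rightarrow> nat \<Rightarrow> (nat \<Rightarrow> 'x \<rightharpoonup> 'x) \<Rightarrow> ('x \<times> (nat \<Rightarrow> int) \<times> 'x) top_groupoid" where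
  "sdp_groupoid X r T =
     \<lparr>arrows = sdp_arrows X r T,
      gtop = sdp_topology X r T,
      gmult = (\<lambda>(x, z, y) (y', z', w). (x, (\<lambda>j. z j + z' j), w)),
      ginv = (\<lambda>(x, z, y). (y, (\<lambda>j. - z j), x))\<rparr>"


section \<open>Pseudogroups and groupoids of germs\<close>

definition pseudogroup :: "'x topology \<Rightarrow> ('x \<rightharpoonup> 'x) set \<Rightarrow> bool" where
  "pseudogroup X P \<longleftrightarrow> (\<forall>S\<in>P. partial_homeo X S) \<and> pid X \<in> P \<and>
     (\<forall>S\<in>P. \<forall>R\<in>P. S \<circ>\<^sub>m R \<in> P) \<and> (\<forall>S\<in>P. pinv S \<in> P)"

definition agree_near :: "'x topology \<Rightarrow> 'x \<Rightarrow> ('x \<rightharpoonup> 'x) \<Rightarrow> ('x \<rightharpoonup> 'x) \<Rightarrow> bool" where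
  "agree_near X y S R \<longleftrightarrow>
     (\<exists>W. openin X W \<and> y \<in> W \<and> W \<subseteq> dom S \<inter> dom R \<and> (\<forall>w\<in>W. S w = R w))"

definition full_pseudogroup :: "'x topology \<Rightarrow> ('x \<rightharpoonup> 'x) set \<Rightarrow> bool" where
  "full_pseudogroup X P \<longleftrightarrow> pseudogroup X P \<and>
     (\<forall>S. partial_homeo X S \<longrightarrow> (\<forall>y\<in>dom S. \<exists>R\<in>P. agree_near X y S R) \<longrightarrow> S \<in> P)"

definition mgds_pseudogroup ::
    "'x topology \<Rightarrow> nat \<Rightarrow> (nat \<Rightarrow> 'x \<rightharpoonup> 'x) \<Rightarrow> ('x \<rightharpoonup> 'x) set" where
  "mgds_pseudogroup X r T = \<Inter>{P. full_pseudogroup X P \<and>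
     {T j |` U | j U. j < r \<and> inj_open X (T j) U} \<subseteq> P}"

definition germ_rel ::
    "'x topology \<Rightarrow> ('x \<rightharpoonup> 'x) set \<Rightarrow> ('x \<times> ('x \<rightharpoonup> 'x) \<times> 'x) rel" where
  "germ_rel X P = {((x\<^sub>1, S\<^sub>1, y\<^sub>1), (x\<^sub>2, S\<^sub>2, y\<^sub>2)).
     S\<^sub>1 \<in> P \<and> S\<^sub>1 y\<^sub>1 = Some x\<^sub>1 \<and> S\<^sub>2 \<in> P \<and> S\<^sub>2 y\<^sub>2 = Some x\<^sub>2 \<and>
     y\<^sub>1 = y\<^sub>2 \<and> agree_near X y\<^sub>1 S\<^sub>1 S\<^sub>2}"

definition germ ::
    "'x topology \<Rightarrow> ('x \<rightharpoonup> 'x) set \<Rightarrow> 'x \<Rightarrow> ('x \<rightharpoonup> 'x) \<Rightarrow> 'x \<Rightarrow> ('x \<times> ('x \<rightharpoonup> 'x) \<times> 'x) set" where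
  "germ X P x S y = germ_rel X P `` {(x, S, y)}"

text \<open>
  Operations on germs are lifted from representatives as a union over all representatives,
  as in \<^theory>\<open>HOL.Equiv_Relations\<close>.
\<close>

definition germ_groupoid ::
    "'x topology \<Rightarrow> ('x \<rightharpoonup> 'x) set \<Rightarrow> ('x \<times> ('x \<rightharpoonup> 'x) \<times> 'x) set top_groupoid" where
  "germ_groupoid X P =
     \<lparr>arrows = {germ X P x S y | x S y. S \<in> P \<and> S y = Some x},
      gtop = topology_generated_by
        {{germ X P (the (S y)) S y | y. y \<in> W} | S W. S \<in> P \<and> openin X W \<and> W \<subseteq> dom S},
      gmult = (\<lambda>a b. \<Union>(x, S, y)\<in>a. \<Union>(y', S', z)\<in>b. germ X P x (S \<circ>\<^sub>m S') z),
      ginv = (\<lambda>a. \<Union>(x, S, y)\<in>a. germ X P y (pinv S) x)\<rparr>"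

definition mgds_germ_groupoid ::
    "'x topology \<Rightarrow> nat \<Rightarrow> (nat \<Rightarrow> 'x \<rightharpoonup> 'x) \<Rightarrow> ('x \<times> ('x \<rightharpoonup> 'x) \<times> 'x) set top_groupoid" where
  "mgds_germ_groupoid X r T = germ_groupoid X (mgds_pseudogroup X r T)"

text \<open>
  The germ below does not depend on the choice of \<open>m, n, U, V\<close>, so again a union over all
  admissible choices picks out the common value.
\<close>

definition canonical_hom ::
    "'x topology \<Rightarrow> nat \<Rightarrow> (nat \<Rightarrow> 'x \<rightharpoonup> 'x)
      \<Rightarrow> 'x \<times> (nat \<Rightarrow> int) \<times> 'x \<Rightarrow> ('x \<times> ('x \<rightharpoonup> 'x) \<times> 'x) set" where
  "canonical_hom X r T = (\<lambda>(x, z, y). \<Union>{germ X (mgds_pseudogroup X r T) x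
       (pinv (mpow X r T m |` U) \<circ>\<^sub>m (mpow X r T n |` V)) y | m n U V.
     m \<in> multi_indices r \<and> n \<in> multi_indices r \<and> z = mdiff m n \<and>
     inj_open X (mpow X r T m) U \<and> inj_open X (mpow X r T n) V \<and> x \<in> U \<and> y \<in> V \<and>
     mpow X r T m x = mpow X r T n y})"


section \<open>Normed *-algebras and their completions\<close>

record 'a star_alg =
  acarrier :: "'a set"
  aadd :: "'a \<Rightarrow> 'a \<Rightarrow> 'a"
  ascale :: "complex \<Rightarrow> 'a \<Rightarrow> 'a"
  amult :: "'a \<Rightarrow> 'a \<Rightarrow> 'a"
  astar :: "'a \<Rightarrow> 'a"
  anorm :: "'a \<Rightarrow> real"

definition star_hom :: "'a star_alg \<Rightarrow> 'b star_alg \<Rightarrow> ('a \<Rightarrow> 'b) \<Rightarrow> bool" where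
  "star_hom A B \<Phi> \<longleftrightarrow>
     (\<forall>a\<in>acarrier A. \<Phi> a \<in> acarrier B) \<and>
     (\<forall>a\<in>acarrier A. \<forall>b\<in>acarrier A. \<Phi> (aadd A a b) = aadd B (\<Phi> a) (\<Phi> b)) \<and>
     (\<forall>c. \<forall>a\<in>acarrier A. \<Phi> (ascale A c a) = ascale B c (\<Phi> a)) \<and>
     (\<forall>a\<in>acarrier A. \<forall>b\<in>acarrier A. \<Phi> (amult A a b) = amult B (\<Phi> a) (\<Phi> b)) \<and>
     (\<forall>a\<in>acarrier A. \<Phi> (astar A a) = astar B (\<Phi> a))"

definition adist :: "'a star_alg \<Rightarrow> 'a \<Rightarrow> 'a \<Rightarrow> real" where
  "adist A a b = anorm A (aadd A a (ascale A (-1) b))"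

definition cauchy_seqs :: "'a star_alg \<Rightarrow> (nat \<Rightarrow> 'a) set" where
  "cauchy_seqs A = {s. (\<forall>n. s n \<in> acarrier A) \<and>
     (\<forall>e>0. \<exists>N. \<forall>m\<ge>N. \<forall>n\<ge>N. adist A (s m) (s n) < e)}"

definition cauchy_rel :: "'a star_alg \<Rightarrow> (nat \<Rightarrow> 'a) rel" where
  "cauchy_rel A = {(s, t). s \<in> cauchy_seqs A \<and> t \<in> cauchy_seqs A \<and>
     (\<lambda>n. adist A (s n) (t n)) \<longlonglongrightarrow> 0}"

definition cauchy_class :: "'a star_alg \<Rightarrow> (nat \<Rightarrow> 'a) \<Rightarrow> (nat \<Rightarrow> 'a) set" where
  "cauchy_class A s = cauchy_rel A `` {s}"

definition completion :: "'a star_alg \<Rightarrow> (nat \<Rightarrow> 'a) set star_alg" where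
  "completion A =
     \<lparr>acarrier = cauchy_seqs A // cauchy_rel A,
      aadd = (\<lambda>a b. \<Union>s\<in>a. \<Union>t\<in>b. cauchy_class A (\<lambda>n. aadd A (s n) (t n))),
      ascale = (\<lambda>c a. \<Union>s\<in>a. cauchy_class A (\<lambda>n. ascale A c (s n))),
      amult = (\<lambda>a b. \<Union>s\<in>a. \<Union>t\<in>b. cauchy_class A (\<lambda>n. amult A (s n) (t n))),
      astar = (\<lambda>a. \<Union>s\<in>a. cauchy_class A (\<lambda>n. astar A (s n))),
      anorm = (\<lambda>a. THE l. \<exists>s\<in>a. (\<lambda>n. anorm A (s n)) \<longlonglongrightarrow> l)\<rparr>"

definition completion_embed :: "'a star_alg \<Rightarrow> 'a \<Rightarrow> (nat \<Rightarrow> 'a) set" where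
  "completion_embed A a = cauchy_class A (\<lambda>_. a)"


section \<open>The reduced C*-algebra of an etale groupoid\<close>

text \<open>
  Functions on the groupoid are functions on the whole type that vanish off the arrows.
  The span in \<open>Cc\<close> is used for all groupoids; if the groupoid is Hausdorff, it is
  the space of continuous functions with compact support.
\<close>

definition Cc_gens :: "'g topology \<Rightarrow> ('g \<Rightarrow> complex) set" where
  "Cc_gens \<tau> = {f. \<exists>U. openin \<tau> U \<and> Hausdorff_space (subtopology \<tau> U) \<and>
     (\<forall>g. g \<notin> U \<longrightarrow> f g = 0) \<and>
     continuous_map (subtopology \<tau> U) euclidean f \<and>
     compactin (subtopology \<tau> U) (subtopology \<tau> U closure_of {g \<in> U. f g \<noteq> 0})}"

definition Cc :: "'g top_groupoid \<Rightarrow> ('g \<Rightarrow> complex) set" where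
  "Cc G = {h. \<exists>F c. finite F \<and> F \<subseteq> Cc_gens (gtop G) \<and> h = (\<lambda>g. \<Sum>f\<in>F. c f * f g)}"

text \<open>
  For \<open>f\<close> in \<open>Cc G\<close> the sum below has only finitely many nonzero terms, for any \<open>h\<close>.  With \<open>h\<close> in
  \<open>\<ell>\<^sup>2(G\<^sub>u)\<close>, where \<open>G\<^sub>u\<close> is the source fibre at the unit \<open>u\<close>, it is the value at \<open>g\<close> of
  \<open>\<lambda>\<^sub>u(f) h\<close>, for the left regular representation \<open>\<lambda>\<^sub>u\<close>.
\<close>

definition conv :: "'g top_groupoid \<Rightarrow> ('g \<Rightarrow> complex) \<Rightarrow> ('g \<Rightarrow> complex) \<Rightarrow> 'g \<Rightarrow> complex" where
  "conv G f h g = (\<Sum>\<^sub>\<infinity>(a, b)\<in>{(a, b). a \<in> arrows G \<and> b \<in> arrows G \<and>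
     gsrc G a = grng G b \<and> gmult G a b = g}. f a * h b)"

definition involution :: "'g top_groupoid \<Rightarrow> ('g \<Rightarrow> complex) \<Rightarrow> 'g \<Rightarrow> complex" where
  "involution G f g = (if g \<in> arrows G then cnj (f (ginv G g)) else 0)"

definition ell2 :: "'g set \<Rightarrow> ('g \<Rightarrow> complex) set" where
  "ell2 A = {\<xi>. (\<forall>g. g \<notin> A \<longrightarrow> \<xi> g = 0) \<and> (\<lambda>g. (cmod (\<xi> g))\<^sup>2) summable_on A}"

definition ell2_norm :: "'g set \<Rightarrow> ('g \<Rightarrow> complex) \<Rightarrow> real" where
  "ell2_norm A \<xi> = sqrt (\<Sum>\<^sub>\<infinity>g\<in>A. (cmod (\<xi> g))\<^sup>2)"

definition regular_rep_norm :: "'g top_groupoid \<Rightarrow> 'g \<Rightarrow> ('g \<Rightarrow> complex) \<Rightarrow> real" where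
  "regular_rep_norm G u f = Sup {ell2_norm (src_fibre G u) (conv G f \<xi>) | \<xi>.
     \<xi> \<in> ell2 (src_fibre G u) \<and> ell2_norm (src_fibre G u) \<xi> \<le> 1}"

text \<open>The inserted \<open>0\<close> only matters for the empty groupoid.\<close>

definition reduced_norm :: "'g top_groupoid \<Rightarrow> ('g \<Rightarrow> complex) \<Rightarrow> real" where
  "reduced_norm G f = Sup (insert 0 ((\<lambda>u. regular_rep_norm G u f) ` units G))"

definition Cc_alg :: "'g top_groupoid \<Rightarrow> ('g \<Rightarrow> complex) star_alg" where
  "Cc_alg G =
     \<lparr>acarrier = Cc G,
      aadd = (\<lambda>f h g. f g + h g),
      ascale = (\<lambda>c f g. c * f g),
      amult = conv G,
      astar = involution G,
      anorm = reduced_norm G\<rparr>"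

definition reduced_Cstar :: "'g top_groupoid \<Rightarrow> (nat \<Rightarrow> 'g \<Rightarrow> complex) set star_alg" where
  "reduced_Cstar G = completion (Cc_alg G)"

definition Cc_embed :: "'g top_groupoid \<Rightarrow> ('g \<Rightarrow> complex) \<Rightarrow> (nat \<Rightarrow> 'g \<Rightarrow> complex) set" where
  "Cc_embed G = completion_embed (Cc_alg G)"

text \<open>
  Summation over the fibres of a map of groupoids, extended by zero off the arrows of the
  target.
\<close>

definition fibre_sum ::
    "'g top_groupoid \<Rightarrow> 'h top_groupoid \<Rightarrow> ('g \<Rightarrow> 'h) \<Rightarrow> ('g \<Rightarrow> complex) \<Rightarrow> 'h \<Rightarrow> complex" where
  "fibre_sum G H p f g =
     (if g \<in> arrows H then \<Sum>\<^sub>\<infinity>g'\<in>{g' \<in> arrows G. p g' = g}. f g' else 0)"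

end

theory Submission
  imports Defs
begin

text \<open>
  Both groupoids have a base of slices, bisections that act as partial homeomorphisms of \<open>X\<close>, and
  the canonical homomorphism \<open>\<pi>\<close> maps slices to slices.  By a partition of unity every element of
  \<open>C\<^sub>c\<close> is a sum of functions supported in single slices, which reduces the algebraic claims to
  computations with slices.

  For the norm estimate let \<open>G(X,T)\<close> act on \<open>Germ\<^sub>u \<times> \<int>\<^sup>r\<close> by
  \<open>(x, z, y) \<cdot> (\<gamma>, k) = (\<pi>(x, z, y) \<gamma>, k + z)\<close>.  The action is free because an arrow is determined by
  its end points and its degree, so its orbits carry the regular representations of \<open>G(X,T)\<close>.  Since
  \<open>f \<in> C\<^sub>c\<close> has only finitely many degrees in its support, testing on \<open>\<xi> \<otimes> 1\<^sub>F\<close> with large boxes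
  \<open>F \<subseteq> \<int>\<^sup>r\<close> bounds the norm of the pushforward of \<open>f\<close> by the norm of \<open>f\<close>.
\<close>

text \<open>Reduced norms are not functorial: an etale homomorphism that fixes the units can be
  unbounded for them when its kernel is not amenable, as for a free group mapped to the trivial
  group. Here the kernel of \<pi> at a unit x consists of arrows (x, z, x), so it is a subgroup of
  Z^r, and the amenability of Z^r carries the estimate: the boxes are Folner sets, and the
  translations of Z^r turn a representation that factors through \<pi> into a sum of regular ones. A
  second obstacle is that germs need not form a Hausdorff space, so C_c is only a span and closed
  supports behave badly; bisections are Hausdorff because they embed in X, and compact sets are
  moved between groupoids through X. The domain condition serves to compare equations T^m x = T^n y
  with the same m - n near a solution, and to compose two such equations.\<close>

section \<open>Completions of normed *-algebras\<close>

text \<open>The axioms are the closure properties and the estimates on \<open>adist\<close> that let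
  the operations pass to classes of Cauchy sequences. The algebraic identities behind them, such as
  ab - a'b' = (a - a')b + a'(b - b') for \<open>adist_mult\<close>, are settled where the locale is
  instantiated.\<close>

locale pre_normed_star_alg =
  fixes A :: "'a star_alg"
  assumes add_closed: "a \<in> acarrier A \<Longrightarrow> b \<in> acarrier A \<Longrightarrow> aadd A a b \<in> acarrier A"
    and scale_closed: "a \<in> acarrier A \<Longrightarrow> ascale A c a \<in> acarrier A"
    and mult_closed: "a \<in> acarrier A \<Longrightarrow> b \<in> acarrier A \<Longrightarrow> amult A a b \<in> acarrier A"
    and star_closed: "a \<in> acarrier A \<Longrightarrow> astar A a \<in> acarrier A"
    and norm_nonneg: "a \<in> acarrier A \<Longrightarrow> 0 \<le> anorm A a"
    and adist_refl: "a \<in> acarrier A \<Longrightarrow> adist A a a = 0"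
    and adist_sym: "a \<in> acarrier A \<Longrightarrow> b \<in> acarrier A \<Longrightarrow> adist A a b = adist A b a"
    and adist_triangle: "a \<in> acarrier A \<Longrightarrow> b \<in> acarrier A \<Longrightarrow> d \<in> acarrier A \<Longrightarrow>
      adist A a d \<le> adist A a b + adist A b d"
    and norm_le_adist: "a \<in> acarrier A \<Longrightarrow> b \<in> acarrier A \<Longrightarrow> anorm A a \<le> anorm A b + adist A a b"
    and adist_add: "a \<in> acarrier A \<Longrightarrow> b \<in> acarrier A \<Longrightarrow> a' \<in> acarrier A \<Longrightarrow> b' \<in> acarrier A \<Longrightarrow>
      adist A (aadd A a b) (aadd A a' b') \<le> adist A a a' + adist A b b'"
    and adist_scale: "a \<in> acarrier A \<Longrightarrow> a' \<in> acarrier A \<Longrightarrow>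
      adist A (ascale A c a) (ascale A c a') \<le> cmod c * adist A a a'"
    and adist_mult: "a \<in> acarrier A \<Longrightarrow> b \<in> acarrier A \<Longrightarrow> a' \<in> acarrier A \<Longrightarrow> b' \<in> acarrier A \<Longrightarrow>
      adist A (amult A a b) (amult A a' b') \<le> adist A a a' * anorm A b + anorm A a' * adist A b b'"
    and adist_star: "a \<in> acarrier A \<Longrightarrow> a' \<in> acarrier A \<Longrightarrow>
      adist A (astar A a) (astar A a') \<le> adist A a a'"
begin

text \<open>Unlike \<open>cauchy_rel\<close>, this two-index form of asymptotic closeness contains the Cauchy
  property, as \<open>near s s\<close>, so that one estimate shows both that an operation preserves Cauchy
  sequences and that it is well defined on classes.\<close>

definition near :: "(nat \<Rightarrow> 'a) \<Rightarrow> (nat \<Rightarrow> 'a) \<Rightarrow> bool" where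
  "near s t \<longleftrightarrow> (\<forall>n. s n \<in> acarrier A) \<and> (\<forall>n. t n \<in> acarrier A) \<and>
     (\<forall>e>0. \<exists>K. \<forall>m\<ge>K. \<forall>n\<ge>K. adist A (s m) (t n) < e)"

lemma nearE:
  assumes "near s t" "e > 0"
  obtains K where "\<forall>m\<ge>K. \<forall>n\<ge>K. adist A (s m) (t n) < e"
  using assms by (auto simp: near_def)

lemma near_carrier: "near s t \<Longrightarrow> s n \<in> acarrier A" "near s t \<Longrightarrow> t n \<in> acarrier A"
  by (auto simp: near_def)

lemma adist_nonneg:
  assumes "a \<in> acarrier A" "b \<in> acarrier A" shows "0 \<le> adist A a b"
  using adist_triangle[OF assms(1,2,1)] adist_sym[OF assms] adist_refl[OF assms(1)] by simp

lemma cauchy_iff_near: "s \<in> cauchy_seqs A \<longleftrightarrow> near s s"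
  by (auto simp: cauchy_seqs_def near_def)

lemma near_sym: "near s t \<Longrightarrow> near t s"
  by (smt (verit, best) adist_sym near_def)

lemma near_trans:
  assumes "near s t" "near t u" shows "near s u"
  unfolding near_def
proof (intro conjI allI impI)
  show "s n \<in> acarrier A" "u n \<in> acarrier A" for n using assms by (auto simp: near_def)
  fix e :: real assume "e > 0"
  then have e: "e/2 > 0" by simp
  obtain K where K: "\<forall>m\<ge>K. \<forall>n\<ge>K. adist A (s m) (t n) < e/2" by (rule nearE[OF assms(1) e])
  obtain L where L: "\<forall>m\<ge>L. \<forall>n\<ge>L. adist A (t m) (u n) < e/2" by (rule nearE[OF assms(2) e])
  have "adist A (s m) (u n) < e" if "m \<ge> max K L" "n \<ge> max K L" for m n
  proof -
    have "adist A (s m) (u n) \<le> adist A (s m) (t n) + adist A (t n) (u n)"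
      using assms by (intro adist_triangle) (auto simp: near_def)
    also have "\<dots> < e" using K[rule_format, of m n] L[rule_format, of n n] that by simp
    finally show ?thesis .
  qed
  then show "\<exists>K. \<forall>m\<ge>K. \<forall>n\<ge>K. adist A (s m) (u n) < e" by blast
qed

text \<open>From the diagonal to two independent indices one triangle inequality through
  \<open>t m\<close> suffices, since \<open>t\<close> is Cauchy. Conversely, symmetry and
  transitivity of \<open>near\<close> yield the Cauchy property of both sequences.\<close>

lemma cauchy_rel_iff_near: "(s, t) \<in> cauchy_rel A \<longleftrightarrow> near s t"
proof
  assume "(s, t) \<in> cauchy_rel A"
  then have s: "near s s" and t: "near t t" and lim: "(\<lambda>n. adist A (s n) (t n)) \<longlonglongrightarrow> 0"
    by (auto simp: cauchy_rel_def cauchy_iff_near)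
  show "near s t" unfolding near_def
  proof (intro conjI allI impI)
    show "s n \<in> acarrier A" "t n \<in> acarrier A" for n using s t by (auto simp: near_def)
    fix e :: real assume "e > 0"
    then have e: "e/2 > 0" by simp
    obtain K where K: "\<forall>m\<ge>K. \<forall>n\<ge>K. adist A (t m) (t n) < e/2" by (rule nearE[OF t e])
    obtain L where L: "\<forall>n\<ge>L. adist A (s n) (t n) < e/2"
      using order_tendstoD(2)[OF lim e] by (auto simp: eventually_sequentially)
    have "adist A (s m) (t n) < e" if "m \<ge> max K L" "n \<ge> max K L" for m n
    proof -
      have "adist A (s m) (t n) \<le> adist A (s m) (t m) + adist A (t m) (t n)"
        using s t by (intro adist_triangle) (auto simp: near_def)
      also have "\<dots> < e" using K[rule_format, of m n] L[rule_format, of m] that by simp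
      finally show ?thesis .
    qed
    then show "\<exists>K. \<forall>m\<ge>K. \<forall>n\<ge>K. adist A (s m) (t n) < e" by blast
  qed
next
  assume st: "near s t"
  have "(\<lambda>n. adist A (s n) (t n)) \<longlonglongrightarrow> 0"
  proof (rule LIMSEQ_I)
    fix e :: real assume "e > 0"
    then obtain K where "\<forall>m\<ge>K. \<forall>n\<ge>K. adist A (s m) (t n) < e" using st by (auto simp: near_def)
    moreover have "adist A (s n) (t n) \<ge> 0" for n using st by (auto simp: near_def adist_nonneg)
    ultimately show "\<exists>K. \<forall>n\<ge>K. norm (adist A (s n) (t n) - 0) < e" by auto
  qed
  moreover have "near s s" "near t t" using st near_sym near_trans by blast+
  ultimately show "(s, t) \<in> cauchy_rel A" by (simp add: cauchy_rel_def cauchy_iff_near)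
qed

lemma equiv_cauchy_rel: "equiv (cauchy_seqs A) (cauchy_rel A)"
proof (rule equivI)
  show "refl_on (cauchy_seqs A) (cauchy_rel A)"
    by (auto simp: refl_on_def cauchy_rel_iff_near cauchy_iff_near)
  show "sym (cauchy_rel A)" by (auto simp: sym_def cauchy_rel_iff_near near_sym)
  show "trans (cauchy_rel A)" unfolding trans_def cauchy_rel_iff_near using near_trans by blast
  show "cauchy_rel A \<subseteq> cauchy_seqs A \<times> cauchy_seqs A" by (auto simp: cauchy_rel_def)
qed

lemma cauchy_class_eqI: "near s t \<Longrightarrow> cauchy_class A s = cauchy_class A t"
  unfolding cauchy_class_def
  by (rule equiv_class_eq[OF equiv_cauchy_rel]) (simp add: cauchy_rel_iff_near)

lemma in_completion_iff: "Z \<in> acarrier (completion A) \<longleftrightarrow> (\<exists>s. near s s \<and> Z = cauchy_class A s)"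
  by (auto simp: completion_def quotient_def cauchy_class_def cauchy_iff_near)

lemma mem_cauchy_class: "t \<in> cauchy_class A s \<longleftrightarrow> near s t"
  by (simp add: cauchy_class_def cauchy_rel_iff_near)

lemma near_add:
  assumes "near s s'" "near t t'"
  shows "near (\<lambda>n. aadd A (s n) (t n)) (\<lambda>n. aadd A (s' n) (t' n))"
  unfolding near_def
proof (intro conjI allI impI)
  show "aadd A (s n) (t n) \<in> acarrier A" "aadd A (s' n) (t' n) \<in> acarrier A" for n
    using assms by (auto simp: near_def intro: add_closed)
  fix e :: real assume "e > 0"
  then have e: "e/2 > 0" by simp
  obtain K where K: "\<forall>m\<ge>K. \<forall>n\<ge>K. adist A (s m) (s' n) < e/2" by (rule nearE[OF assms(1) e])
  obtain L where L: "\<forall>m\<ge>L. \<forall>n\<ge>L. adist A (t m) (t' n) < e/2" by (rule nearE[OF assms(2) e])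
  have "adist A (aadd A (s m) (t m)) (aadd A (s' n) (t' n)) < e" if "m \<ge> max K L" "n \<ge> max K L" for m n
  proof -
    have "adist A (aadd A (s m) (t m)) (aadd A (s' n) (t' n)) \<le> adist A (s m) (s' n) + adist A (t m) (t' n)"
      using assms by (intro adist_add) (auto simp: near_def)
    also have "\<dots> < e" using K[rule_format, of m n] L[rule_format, of m n] that by simp
    finally show ?thesis .
  qed
  then show "\<exists>K. \<forall>m\<ge>K. \<forall>n\<ge>K. adist A (aadd A (s m) (t m)) (aadd A (s' n) (t' n)) < e" by blast
qed

lemma near_scale:
  assumes "near s s'"
  shows "near (\<lambda>n. ascale A c (s n)) (\<lambda>n. ascale A c (s' n))"
  unfolding near_def
proof (intro conjI allI impI)
  show "ascale A c (s n) \<in> acarrier A" "ascale A c (s' n) \<in> acarrier A" for n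
    using assms by (auto simp: near_def intro: scale_closed)
  fix e :: real assume "e > 0"
  \<comment> \<open>Adding 1 keeps the denominator positive when \<open>c = 0\<close>.\<close>
  then have "e / (cmod c + 1) > 0" by (simp add: add_nonneg_pos)
  then obtain K where K: "\<forall>m\<ge>K. \<forall>n\<ge>K. adist A (s m) (s' n) < e / (cmod c + 1)"
    by (rule nearE[OF assms])
  have "adist A (ascale A c (s m)) (ascale A c (s' n)) < e" if "m \<ge> K" "n \<ge> K" for m n
  proof -
    have "adist A (ascale A c (s m)) (ascale A c (s' n)) \<le> cmod c * adist A (s m) (s' n)"
      using assms by (intro adist_scale) (auto simp: near_def)
    also have "\<dots> \<le> (cmod c + 1) * adist A (s m) (s' n)"
      using assms by (intro mult_right_mono adist_nonneg) (auto simp: near_def)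
    also have "\<dots> < e" using K[rule_format, of m n] that
      by (simp add: pos_less_divide_eq add_nonneg_pos mult.commute)
    finally show ?thesis .
  qed
  then show "\<exists>K. \<forall>m\<ge>K. \<forall>n\<ge>K. adist A (ascale A c (s m)) (ascale A c (s' n)) < e" by blast
qed

lemma near_star:
  assumes "near s s'"
  shows "near (\<lambda>n. astar A (s n)) (\<lambda>n. astar A (s' n))"
  unfolding near_def
proof (intro conjI allI impI)
  have c: "s n \<in> acarrier A" "s' n \<in> acarrier A" for n using assms by (auto simp: near_def)
  then show "astar A (s n) \<in> acarrier A" "astar A (s' n) \<in> acarrier A" for n
    by (auto intro: star_closed)
  fix e :: real assume "e > 0"
  then obtain K where "\<forall>m\<ge>K. \<forall>n\<ge>K. adist A (s m) (s' n) < e" by (rule nearE[OF assms])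
  then show "\<exists>K. \<forall>m\<ge>K. \<forall>n\<ge>K. adist A (astar A (s m)) (astar A (s' n)) < e"
    using adist_star[OF c] by (meson order.strict_trans1)
qed

text \<open>Multiplication is uniformly continuous only on bounded sets, so the product estimate
  needs a bound on the factors; a bound on a tail is enough.\<close>

lemma near_bounded:
  assumes "near s t"
  obtains M K where "M > 0" "\<And>n. n \<ge> K \<Longrightarrow> anorm A (s n) \<le> M"
proof -
  have "near s s" using assms near_sym near_trans by blast
  then obtain K where K: "\<forall>m\<ge>K. \<forall>n\<ge>K. adist A (s m) (s n) < 1"
    by (rule nearE[of s s 1]) auto
  have c: "s n \<in> acarrier A" for n using assms by (rule near_carrier)
  have "anorm A (s n) \<le> anorm A (s K) + 1" if "n \<ge> K" for n
    using norm_le_adist[OF c[of n] c[of K]] K[rule_format, of n K] that by simp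
  moreover have "anorm A (s K) + 1 > 0" using norm_nonneg[OF c[of K]] by simp
  ultimately show ?thesis using that by blast
qed

lemma near_mult:
  assumes "near s s'" "near t t'"
  shows "near (\<lambda>n. amult A (s n) (t n)) (\<lambda>n. amult A (s' n) (t' n))"
  unfolding near_def
proof (intro conjI allI impI)
  show "amult A (s n) (t n) \<in> acarrier A" "amult A (s' n) (t' n) \<in> acarrier A" for n
    using assms by (auto simp: near_def intro: mult_closed)
  obtain M1 N1 where M1: "M1 > 0" "\<And>n. n \<ge> N1 \<Longrightarrow> anorm A (t n) \<le> M1"
    by (rule near_bounded[OF assms(2)]) blast
  obtain M2 N2 where M2: "M2 > 0" "\<And>n. n \<ge> N2 \<Longrightarrow> anorm A (s' n) \<le> M2"
    by (rule near_bounded[OF near_sym[OF assms(1)]]) blast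
  fix e :: real assume "e > 0"
  then have e: "e/2/M1 > 0" "e/2/M2 > 0" using M1 M2 by auto
  obtain K where K: "\<forall>m\<ge>K. \<forall>n\<ge>K. adist A (s m) (s' n) < e/2/M1" by (rule nearE[OF assms(1) e(1)])
  obtain L where L: "\<forall>m\<ge>L. \<forall>n\<ge>L. adist A (t m) (t' n) < e/2/M2" by (rule nearE[OF assms(2) e(2)])
  define J where "J = max (max K L) (max N1 N2)"
  have "adist A (amult A (s m) (t m)) (amult A (s' n) (t' n)) < e" if "m \<ge> J" "n \<ge> J" for m n
  proof -
    have "adist A (amult A (s m) (t m)) (amult A (s' n) (t' n)) \<le>
       adist A (s m) (s' n) * anorm A (t m) + anorm A (s' n) * adist A (t m) (t' n)"
      using assms by (intro adist_mult) (auto simp: near_def)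
    also have "\<dots> \<le> adist A (s m) (s' n) * M1 + M2 * adist A (t m) (t' n)"
      using assms M1 M2 that
      by (intro add_mono mult_left_mono mult_right_mono adist_nonneg) (auto simp: near_def J_def)
    also have "\<dots> < e/2 + e/2"
    proof (rule add_strict_mono)
      show "adist A (s m) (s' n) * M1 < e/2"
        using K[rule_format, of m n] that M1(1) by (simp add: J_def field_simps)
      show "M2 * adist A (t m) (t' n) < e/2"
        using L[rule_format, of m n] that M2(1) by (simp add: J_def field_simps)
    qed
    finally show ?thesis by simp
  qed
  then show "\<exists>K. \<forall>m\<ge>K. \<forall>n\<ge>K. adist A (amult A (s m) (t m)) (amult A (s' n) (t' n)) < e" by blast
qed

text \<open>Operations on the completion are unions over all representatives. A class is nonempty,
  so such a union is evaluated as soon as its members are known to coincide.\<close>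

lemma UN_cauchy_class:
  assumes "near s s" "\<And>t. near s t \<Longrightarrow> F t = Z"
  shows "(\<Union>t\<in>cauchy_class A s. F t) = Z"
  using assms by (auto simp: mem_cauchy_class)

lemma completion_add:
  assumes "near s s" "near t t"
  shows "aadd (completion A) (cauchy_class A s) (cauchy_class A t) =
    cauchy_class A (\<lambda>n. aadd A (s n) (t n))"
  by (simp add: completion_def, intro UN_cauchy_class assms)
    (rule cauchy_class_eqI, rule near_add; erule near_sym)

lemma completion_mult:
  assumes "near s s" "near t t"
  shows "amult (completion A) (cauchy_class A s) (cauchy_class A t) =
    cauchy_class A (\<lambda>n. amult A (s n) (t n))"
  by (simp add: completion_def, intro UN_cauchy_class assms)
    (rule cauchy_class_eqI, rule near_mult; erule near_sym)

lemma completion_scale: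
  assumes "near s s"
  shows "ascale (completion A) c (cauchy_class A s) = cauchy_class A (\<lambda>n. ascale A c (s n))"
  by (simp add: completion_def, intro UN_cauchy_class assms)
    (rule cauchy_class_eqI, rule near_scale; erule near_sym)

lemma completion_star:
  assumes "near s s"
  shows "astar (completion A) (cauchy_class A s) = cauchy_class A (\<lambda>n. astar A (s n))"
  by (simp add: completion_def, intro UN_cauchy_class assms)
    (rule cauchy_class_eqI, rule near_star; erule near_sym)

end

text \<open>Extension by continuity: a contraction preserves \<open>near\<close>, so applying
  \<open>\<phi>\<close> termwise respects classes, and the algebraic identities carry over from
  representatives.\<close>

lemma star_hom_completion:
  assumes "pre_normed_star_alg A" "pre_normed_star_alg B" and hom: "star_hom A B \<phi>"
    and contr: "\<And>a b. a \<in> acarrier A \<Longrightarrow> b \<in> acarrier A \<Longrightarrow> adist B (\<phi> a) (\<phi> b) \<le> adist A a b"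
  shows "\<exists>\<Phi>. star_hom (completion A) (completion B) \<Phi> \<and>
    (\<forall>a\<in>acarrier A. \<Phi> (completion_embed A a) = completion_embed B (\<phi> a))"
proof -
  interpret A: pre_normed_star_alg A by fact
  interpret B: pre_normed_star_alg B by fact
  define \<Phi> where "\<Phi> Z = (\<Union>s\<in>Z. cauchy_class B (\<lambda>n. \<phi> (s n)))" for Z
  have near: "B.near (\<lambda>n. \<phi> (s n)) (\<lambda>n. \<phi> (t n))" if "A.near s t" for s t
  proof -
    have c: "s n \<in> acarrier A" "t n \<in> acarrier A" for n using that by (auto simp: A.near_def)
    have "\<exists>K. \<forall>m\<ge>K. \<forall>n\<ge>K. adist B (\<phi> (s m)) (\<phi> (t n)) < e" if e: "e > 0" for e
    proof -
      obtain K where "\<forall>m\<ge>K. \<forall>n\<ge>K. adist A (s m) (t n) < e" by (rule A.nearE[OF \<open>A.near s t\<close> e])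
      then show ?thesis using contr[OF c] by (meson order.strict_trans1)
    qed
    then show ?thesis using c hom by (auto simp: B.near_def star_hom_def)
  qed
  have \<Phi>: "\<Phi> (cauchy_class A s) = cauchy_class B (\<lambda>n. \<phi> (s n))" if "A.near s s" for s
    unfolding \<Phi>_def
    by (intro A.UN_cauchy_class that) (rule B.cauchy_class_eqI, rule near, erule A.near_sym)
  have [simp]: "\<phi> (s n) \<in> acarrier B" if "A.near s t" for s t n
    using that hom by (auto simp: A.near_def star_hom_def)
  have eqs: "(\<lambda>n. \<phi> (aadd A (s n) (t n))) = (\<lambda>n. aadd B (\<phi> (s n)) (\<phi> (t n)))"
    "(\<lambda>n. \<phi> (amult A (s n) (t n))) = (\<lambda>n. amult B (\<phi> (s n)) (\<phi> (t n)))"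
    "(\<lambda>n. \<phi> (ascale A c (s n))) = (\<lambda>n. ascale B c (\<phi> (s n)))"
    "(\<lambda>n. \<phi> (astar A (s n))) = (\<lambda>n. astar B (\<phi> (s n)))"
    if "A.near s s" "A.near t t" for s t c
    using that hom by (auto simp: A.near_def star_hom_def)
  have "star_hom (completion A) (completion B) \<Phi>"
    unfolding star_hom_def Ball_def A.in_completion_iff B.in_completion_iff
    using near
    by (auto simp: \<Phi> A.completion_add B.completion_add A.completion_mult B.completion_mult
        A.completion_scale B.completion_scale A.completion_star B.completion_star
        A.near_add A.near_mult A.near_scale A.near_star eqs) blast
  moreover have "\<Phi> (completion_embed A a) = completion_embed B (\<phi> a)" if "a \<in> acarrier A" for a
    unfolding completion_embed_def
    by (rule \<Phi>) (use that in \<open>auto simp: A.near_def A.adist_refl\<close>)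
  ultimately show ?thesis by blast
qed

section \<open>Square-summable families\<close>

text \<open>Membership and norm bound are tested together on finite subsets, so that the finite
  inequalities for \<open>L2_set\<close> (Minkowski, Cauchy-Schwarz) replace manipulations of
  infinite sums.\<close>

lemma ell2_finite_iff:
  assumes "\<And>g. g \<notin> A \<Longrightarrow> \<xi> g = 0" "0 \<le> M"
  shows "\<xi> \<in> ell2 A \<and> ell2_norm A \<xi> \<le> M \<longleftrightarrow>
    (\<forall>F. finite F \<longrightarrow> F \<subseteq> A \<longrightarrow> L2_set (\<lambda>g. cmod (\<xi> g)) F \<le> M)"
proof
  assume L: "\<xi> \<in> ell2 A \<and> ell2_norm A \<xi> \<le> M"
  show "\<forall>F. finite F \<longrightarrow> F \<subseteq> A \<longrightarrow> L2_set (\<lambda>g. cmod (\<xi> g)) F \<le> M"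
  proof (intro allI impI)
    fix F assume F: "finite F" "F \<subseteq> A"
    have "(\<Sum>g\<in>F. (cmod (\<xi> g))\<^sup>2) \<le> (\<Sum>\<^sub>\<infinity>g\<in>A. (cmod (\<xi> g))\<^sup>2)"
      using L F by (intro finite_sum_le_infsum) (auto simp: ell2_def)
    then have "L2_set (\<lambda>g. cmod (\<xi> g)) F \<le> ell2_norm A \<xi>"
      unfolding L2_set_def ell2_norm_def by simp
    then show "L2_set (\<lambda>g. cmod (\<xi> g)) F \<le> M" using L by simp
  qed
next
  assume R: "\<forall>F. finite F \<longrightarrow> F \<subseteq> A \<longrightarrow> L2_set (\<lambda>g. cmod (\<xi> g)) F \<le> M"
  have fin: "(\<Sum>g\<in>F. (cmod (\<xi> g))\<^sup>2) \<le> M\<^sup>2" if "finite F" "F \<subseteq> A" for F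
    using R that \<open>0 \<le> M\<close> unfolding L2_set_def by (metis real_sqrt_le_iff real_sqrt_abs abs_of_nonneg)
  have s: "(\<lambda>g. (cmod (\<xi> g))\<^sup>2) summable_on A"
    by (rule nonneg_bdd_above_summable_on) (auto intro!: bdd_aboveI[of _ "M\<^sup>2"] fin)
  then have "(\<Sum>\<^sub>\<infinity>g\<in>A. (cmod (\<xi> g))\<^sup>2) \<le> M\<^sup>2"
    by (intro infsum_le_finite_sums) (auto intro: fin)
  then show "\<xi> \<in> ell2 A \<and> ell2_norm A \<xi> \<le> M"
    using s assms by (auto simp: ell2_def ell2_norm_def real_le_lsqrt)
qed

lemma ell2_norm_nonneg [simp]: "0 \<le> ell2_norm A \<xi>"
  by (simp add: ell2_norm_def infsum_nonneg)

lemma L2_set_le_ell2_norm: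
  assumes "\<xi> \<in> ell2 A" "finite F" "F \<subseteq> A"
  shows "L2_set (\<lambda>g. cmod (\<xi> g)) F \<le> ell2_norm A \<xi>"
  using ell2_finite_iff[of A \<xi> "ell2_norm A \<xi>"] assms by (auto simp: ell2_def)

lemma ell2_boundI:
  assumes "\<And>g. g \<notin> A \<Longrightarrow> \<xi> g = 0" "0 \<le> M"
    and "\<And>F. finite F \<Longrightarrow> F \<subseteq> A \<Longrightarrow> L2_set (\<lambda>g. cmod (\<xi> g)) F \<le> M"
  shows "\<xi> \<in> ell2 A" "ell2_norm A \<xi> \<le> M"
  using ell2_finite_iff[of A \<xi> M] assms by auto

lemma ell2_add:
  assumes "\<xi> \<in> ell2 A" "\<eta> \<in> ell2 A"
  shows "(\<lambda>g. \<xi> g + \<eta> g) \<in> ell2 A" (is ?th1)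
    and "ell2_norm A (\<lambda>g. \<xi> g + \<eta> g) \<le> ell2_norm A \<xi> + ell2_norm A \<eta>" (is ?th2)
proof -
  have *: "L2_set (\<lambda>g. cmod (\<xi> g + \<eta> g)) F \<le> ell2_norm A \<xi> + ell2_norm A \<eta>"
    if "finite F" "F \<subseteq> A" for F
  proof -
    have "L2_set (\<lambda>g. cmod (\<xi> g + \<eta> g)) F \<le> L2_set (\<lambda>g. cmod (\<xi> g) + cmod (\<eta> g)) F"
      by (rule L2_set_mono) (auto simp: norm_triangle_ineq)
    also have "\<dots> \<le> L2_set (\<lambda>g. cmod (\<xi> g)) F + L2_set (\<lambda>g. cmod (\<eta> g)) F"
      by (rule L2_set_triangle_ineq)
    also have "\<dots> \<le> ell2_norm A \<xi> + ell2_norm A \<eta>"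
      using that assms by (intro add_mono L2_set_le_ell2_norm) auto
    finally show ?thesis .
  qed
  have z: "\<xi> g + \<eta> g = 0" if "g \<notin> A" for g using that assms by (auto simp: ell2_def)
  show ?th1 ?th2
    using ell2_boundI[of A "\<lambda>g. \<xi> g + \<eta> g", OF z _ *] by auto
qed

lemma ell2_scale:
  assumes "\<xi> \<in> ell2 A"
  shows "(\<lambda>g. c * \<xi> g) \<in> ell2 A" and "ell2_norm A (\<lambda>g. c * \<xi> g) = cmod c * ell2_norm A \<xi>"
proof -
  show "(\<lambda>g. c * \<xi> g) \<in> ell2 A"
    using assms by (auto simp: ell2_def norm_mult power_mult_distrib intro: summable_on_cmult_right)
  show "ell2_norm A (\<lambda>g. c * \<xi> g) = cmod c * ell2_norm A \<xi>"
    by (simp add: ell2_norm_def norm_mult power_mult_distrib infsum_cmult_right' real_sqrt_mult)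
qed

lemma ell2_zero [simp]: "(\<lambda>_. 0) \<in> ell2 A" "ell2_norm A (\<lambda>_. 0) = 0"
  by (simp_all add: ell2_def ell2_norm_def)

definition ell2_inner :: "'g set \<Rightarrow> ('g \<Rightarrow> complex) \<Rightarrow> ('g \<Rightarrow> complex) \<Rightarrow> complex" where
  "ell2_inner A \<xi> \<eta> = (\<Sum>\<^sub>\<infinity>g\<in>A. \<xi> g * cnj (\<eta> g))"

lemma ell2_Cauchy_Schwarz:
  assumes "\<xi> \<in> ell2 A" "\<eta> \<in> ell2 A"
  shows "(\<lambda>g. \<xi> g * cnj (\<eta> g)) summable_on A" (is ?th1)
    and "cmod (ell2_inner A \<xi> \<eta>) \<le> ell2_norm A \<xi> * ell2_norm A \<eta>" (is ?th2)
proof -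
  have *: "(\<Sum>g\<in>F. cmod (\<xi> g * cnj (\<eta> g))) \<le> ell2_norm A \<xi> * ell2_norm A \<eta>"
    if "finite F" "F \<subseteq> A" for F
  proof -
    have "(\<Sum>g\<in>F. cmod (\<xi> g * cnj (\<eta> g))) = (\<Sum>g\<in>F. \<bar>cmod (\<xi> g)\<bar> * \<bar>cmod (\<eta> g)\<bar>)"
      by (simp add: norm_mult)
    also have "\<dots> \<le> L2_set (\<lambda>g. cmod (\<xi> g)) F * L2_set (\<lambda>g. cmod (\<eta> g)) F"
      by (rule L2_set_mult_ineq)
    also have "\<dots> \<le> ell2_norm A \<xi> * ell2_norm A \<eta>"
      using that assms by (intro mult_mono L2_set_le_ell2_norm) auto
    finally show ?thesis .
  qed
  have s: "(\<lambda>g. cmod (\<xi> g * cnj (\<eta> g))) summable_on A"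
    by (rule nonneg_bdd_above_summable_on)
      (auto intro!: bdd_aboveI[of _ "ell2_norm A \<xi> * ell2_norm A \<eta>"] *)
  then show ?th1 by (rule abs_summable_summable)
  have "cmod (ell2_inner A \<xi> \<eta>) \<le> (\<Sum>\<^sub>\<infinity>g\<in>A. cmod (\<xi> g * cnj (\<eta> g)))"
    unfolding ell2_inner_def by (rule norm_infsum_bound) (rule s)
  also have "\<dots> \<le> ell2_norm A \<xi> * ell2_norm A \<eta>"
    using s by (intro infsum_le_finite_sums) (auto intro: *)
  finally show ?th2 .
qed

lemma ell2_inner_add:
  assumes "\<xi> \<in> ell2 A" "\<xi>' \<in> ell2 A" "\<eta> \<in> ell2 A"
  shows "ell2_inner A (\<lambda>g. \<xi> g + \<xi>' g) \<eta> = ell2_inner A \<xi> \<eta> + ell2_inner A \<xi>' \<eta>"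
    "ell2_inner A \<eta> (\<lambda>g. \<xi> g + \<xi>' g) = ell2_inner A \<eta> \<xi> + ell2_inner A \<eta> \<xi>'"
  using assms
  by (auto simp: ell2_inner_def distrib_right distrib_left infsum_add ell2_Cauchy_Schwarz)

lemma ell2_inner_self:
  assumes "\<xi> \<in> ell2 A" shows "Re (ell2_inner A \<xi> \<xi>) = (ell2_norm A \<xi>)\<^sup>2"
proof -
  have "Re (ell2_inner A \<xi> \<xi>) = (\<Sum>\<^sub>\<infinity>g\<in>A. Re (\<xi> g * cnj (\<xi> g)))"
    unfolding ell2_inner_def by (rule infsum_Re[symmetric]) (intro ell2_Cauchy_Schwarz assms)
  also have "\<dots> = (\<Sum>\<^sub>\<infinity>g\<in>A. (cmod (\<xi> g))\<^sup>2)"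
    by (simp only: complex_mult_cnj cmod_power2 Re_complex_of_real)
  finally show ?thesis by (simp add: ell2_norm_def infsum_nonneg)
qed

section \<open>Etale groupoids given by a base of slices\<close>

text \<open>Units are identified with the points of \<open>X\<close> through \<open>e\<close>; \<open>s\<close> and \<open>t\<close> are source and range
  as maps to \<open>X\<close>.  The members of \<open>BB\<close> are bisections whose induced partial maps of \<open>X\<close> are
  partial homeomorphisms, and the last three axioms say that the topology, the product and the
  inverse are determined locally by these partial maps.\<close>

locale slice_groupoid =
  fixes X :: "'x topology" and G :: "'g top_groupoid"
    and s t :: "'g \<Rightarrow> 'x" and e :: "'x \<Rightarrow> 'g" and BB :: "'g set set"
  assumes haus: "Hausdorff_space X" and lc: "locally_compact_space X"
    and inv_closed: "a \<in> arrows G \<Longrightarrow> ginv G a \<in> arrows G"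
    and inv_inv: "a \<in> arrows G \<Longrightarrow> ginv G (ginv G a) = a"
    and s_inv: "a \<in> arrows G \<Longrightarrow> s (ginv G a) = t a"
    and s_in: "a \<in> arrows G \<Longrightarrow> s a \<in> topspace X"
    and mult_closed: "a \<in> arrows G \<Longrightarrow> b \<in> arrows G \<Longrightarrow> s a = t b \<Longrightarrow> gmult G a b \<in> arrows G"
    and s_mult: "a \<in> arrows G \<Longrightarrow> b \<in> arrows G \<Longrightarrow> s a = t b \<Longrightarrow> s (gmult G a b) = s b"
    and t_mult: "a \<in> arrows G \<Longrightarrow> b \<in> arrows G \<Longrightarrow> s a = t b \<Longrightarrow> t (gmult G a b) = t a"
    and mult_assoc: "a \<in> arrows G \<Longrightarrow> b \<in> arrows G \<Longrightarrow> d \<in> arrows G \<Longrightarrow> s a = t b \<Longrightarrow> s b = t d \<Longrightarrow>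
      gmult G (gmult G a b) d = gmult G a (gmult G b d)"
    and inv_mult: "a \<in> arrows G \<Longrightarrow> gmult G (ginv G a) a = e (s a)"
    and unit_mult: "a \<in> arrows G \<Longrightarrow> gmult G (e (t a)) a = a"
    and unit_closed: "x \<in> topspace X \<Longrightarrow> e x \<in> arrows G"
    and s_unit: "x \<in> topspace X \<Longrightarrow> s (e x) = x"
    and gtop_eq: "gtop G = topology_generated_by BB"
    and Union_BB: "\<Union>BB = arrows G"
    and inj_s_BB: "W \<in> BB \<Longrightarrow> inj_on s W"
    and inj_t_BB: "W \<in> BB \<Longrightarrow> inj_on t W"
    and open_s_BB: "W \<in> BB \<Longrightarrow> openin X U \<Longrightarrow> openin X (s ` {a \<in> W. t a \<in> U})"
    and open_t_BB: "W \<in> BB \<Longrightarrow> openin X U \<Longrightarrow> openin X (t ` {a \<in> W. s a \<in> U})"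
    and restrict_BB: "W \<in> BB \<Longrightarrow> openin X U \<Longrightarrow> {a \<in> W. s a \<in> U} \<in> BB"
    and local_BB: "W \<in> BB \<Longrightarrow> W' \<in> BB \<Longrightarrow> a \<in> W \<Longrightarrow> a \<in> W' \<Longrightarrow>
      \<exists>U V. openin X U \<and> openin X V \<and> t a \<in> U \<and> s a \<in> V \<and>
        (\<forall>b\<in>W. t b \<in> U \<longrightarrow> s b \<in> V \<longrightarrow> b \<in> W')"
    and mult_BB: "W1 \<in> BB \<Longrightarrow> W2 \<in> BB \<Longrightarrow> W3 \<in> BB \<Longrightarrow> a \<in> W1 \<Longrightarrow> b \<in> W2 \<Longrightarrow> s a = t b \<Longrightarrow>
      gmult G a b \<in> W3 \<Longrightarrow>
      \<exists>U V V'. openin X U \<and> openin X V \<and> openin X V' \<and> t a \<in> U \<and> s a \<in> V \<and> s b \<in> V' \<and>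
        (\<forall>a'\<in>W1. \<forall>b'\<in>W2. s a' = t b' \<longrightarrow> t a' \<in> U \<longrightarrow> s a' \<in> V \<longrightarrow> s b' \<in> V' \<longrightarrow> gmult G a' b' \<in> W3)"
    and inv_BB: "W \<in> BB \<Longrightarrow> ginv G ` W \<in> BB"
begin

section \<open>Algebra of a slice groupoid\<close>

lemma t_inv: "a \<in> arrows G \<Longrightarrow> t (ginv G a) = s a"
  by (metis inv_closed inv_inv s_inv)

lemma t_in: "a \<in> arrows G \<Longrightarrow> t a \<in> topspace X"
  by (metis inv_closed s_in s_inv)

lemma gsrc_eq: "a \<in> arrows G \<Longrightarrow> gsrc G a = e (s a)"
  by (simp add: gsrc_def inv_mult)

lemma grng_eq: "a \<in> arrows G \<Longrightarrow> grng G a = e (t a)"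
  unfolding grng_def by (metis inv_closed inv_inv inv_mult s_inv)

lemma e_inj: "x \<in> topspace X \<Longrightarrow> y \<in> topspace X \<Longrightarrow> e x = e y \<longleftrightarrow> x = y"
  by (metis s_unit)

lemma units_eq: "units G = e ` topspace X"
proof -
  have "units G \<subseteq> e ` topspace X" by (auto simp: units_def gsrc_eq s_in)
  moreover have "e x \<in> units G" if "x \<in> topspace X" for x
    using gsrc_eq[OF unit_closed[OF that]] that by (auto simp: units_def s_unit unit_closed intro!: image_eqI[of _ _ "e x"])
  ultimately show ?thesis by blast
qed

lemma src_fibre_eq: "x \<in> topspace X \<Longrightarrow> src_fibre G (e x) = {a \<in> arrows G. s a = x}"
  by (auto simp: src_fibre_def gsrc_eq e_inj s_in)

lemma inv_mult_cancel:
  assumes "a \<in> arrows G" "b \<in> arrows G" "s a = t b"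
  shows "gmult G (ginv G a) (gmult G a b) = b"
  using assms mult_assoc[of "ginv G a" a b] by (simp add: inv_closed s_inv inv_mult unit_mult)

lemma mult_inv_cancel:
  assumes "a \<in> arrows G" "g \<in> arrows G" "t a = t g"
  shows "gmult G a (gmult G (ginv G a) g) = g"
  using inv_mult_cancel[of "ginv G a" g] assms by (simp add: inv_closed s_inv inv_inv)

lemma div_closed:
  assumes "a \<in> arrows G" "g \<in> arrows G" "t a = t g"
  shows "gmult G (ginv G a) g \<in> arrows G" "s (gmult G (ginv G a) g) = s g"
    "t (gmult G (ginv G a) g) = s a"
  using assms by (auto simp: inv_closed s_inv t_inv mult_closed s_mult t_mult)

text \<open>Both sides are the solution h of (ab)h = g, which avoids a formula for the inverse of a
  product. This is the algebraic core of associativity of convolution.\<close>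

lemma inv_mult_mult:
  assumes "a \<in> arrows G" "b \<in> arrows G" "g \<in> arrows G" "s a = t b" "t a = t g"
  shows "gmult G (ginv G (gmult G a b)) g = gmult G (ginv G b) (gmult G (ginv G a) g)"
proof -
  define h where "h = gmult G (ginv G b) (gmult G (ginv G a) g)"
  have h: "h \<in> arrows G" "t h = s b"
    using assms by (auto simp: h_def div_closed)
  have "gmult G (gmult G a b) h = gmult G a (gmult G b h)"
    using assms h by (simp add: mult_assoc)
  also have "gmult G b h = gmult G (ginv G a) g"
    unfolding h_def using assms by (intro mult_inv_cancel) (auto simp: div_closed)
  finally have "gmult G (gmult G a b) h = g" using assms by (simp add: mult_inv_cancel)
  then show ?thesis
    using inv_mult_cancel[of "gmult G a b" h] assms h by (simp add: mult_closed s_mult flip: h_def)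
qed

lemma BB_arrows: "W \<in> BB \<Longrightarrow> a \<in> W \<Longrightarrow> a \<in> arrows G"
  using Union_BB by blast

section \<open>Topology generated by the slices\<close>

lemma restrict2_BB:
  assumes "W \<in> BB" "openin X U" "openin X V"
  shows "{a \<in> W. t a \<in> U \<and> s a \<in> V} \<in> BB"
proof -
  \<comment> \<open>As \<open>s\<close> is injective on \<open>W\<close>, a condition on the range
    can be rewritten as a condition on the source.\<close>
  have "{a \<in> W. t a \<in> U \<and> s a \<in> V} = {a \<in> W. s a \<in> V \<inter> s ` {a \<in> W. t a \<in> U}}"
    using inj_s_BB[OF assms(1)] by (auto simp: inj_on_def)
  then show ?thesis using assms by (simp only: restrict_BB openin_Int open_s_BB)
qed

text \<open>\<open>BB\<close> is not assumed closed under intersections; shrinking \<open>W\<close>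
  around a common arrow is enough to make it a base.\<close>

lemma inter_BB:
  assumes "W \<in> BB" "W' \<in> BB" "a \<in> W" "a \<in> W'"
  obtains W'' where "W'' \<in> BB" "a \<in> W''" "W'' \<subseteq> W \<inter> W'"
proof -
  obtain U V where "openin X U" "openin X V" "t a \<in> U" "s a \<in> V"
     "\<forall>b\<in>W. t b \<in> U \<longrightarrow> s b \<in> V \<longrightarrow> b \<in> W'"
    using local_BB[OF assms] by blast
  then show ?thesis using assms by (intro that[of "{a \<in> W. t a \<in> U \<and> s a \<in> V}"] restrict2_BB) auto
qed

text \<open>The topology is given with \<open>BB\<close> as a subbase; \<open>inter_BB\<close> takes
  care of finite intersections, so \<open>BB\<close> is a base.\<close>

lemma openin_gtop_iff:
  "openin (gtop G) Q \<longleftrightarrow> (\<forall>a\<in>Q. \<exists>W\<in>BB. a \<in> W \<and> W \<subseteq> Q)"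
proof
  assume "openin (gtop G) Q"
  then have "generate_topology_on BB Q" by (simp add: gtop_eq openin_topology_generated_by)
  then show "\<forall>a\<in>Q. \<exists>W\<in>BB. a \<in> W \<and> W \<subseteq> Q"
  proof induction
    case (Int a b)
    show ?case
    proof
      fix x assume "x \<in> a \<inter> b"
      then obtain W W' where "W \<in> BB" "W' \<in> BB" "x \<in> W" "x \<in> W'" "W \<subseteq> a" "W' \<subseteq> b"
        using Int by blast
      then show "\<exists>W\<in>BB. x \<in> W \<and> W \<subseteq> a \<inter> b" using inter_BB[of W W' x] by (metis Int_mono subset_trans)
    qed
  next
    case (UN K)
    show ?case
    proof
      fix x assume "x \<in> \<Union>K"
      then obtain k where k: "k \<in> K" "x \<in> k" by blast
      then obtain W where "W \<in> BB" "x \<in> W" "W \<subseteq> k" using UN.IH[OF k(1)] by blast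
      then show "\<exists>W\<in>BB. x \<in> W \<and> W \<subseteq> \<Union>K" using k(1) by blast
    qed
  qed auto
next
  assume "\<forall>a\<in>Q. \<exists>W\<in>BB. a \<in> W \<and> W \<subseteq> Q"
  then show "openin (gtop G) Q"
    unfolding gtop_eq by (subst openin_subopen) (blast intro: topology_generated_by_Basis)
qed

lemma open_BB: "W \<in> BB \<Longrightarrow> openin (gtop G) W"
  by (auto simp: openin_gtop_iff)

lemma topspace_gtop: "topspace (gtop G) = arrows G"
  by (simp add: gtop_eq Union_BB)

lemma open_arrows: "openin (gtop G) Q \<Longrightarrow> a \<in> Q \<Longrightarrow> a \<in> arrows G"
  using openin_subset topspace_gtop by blast

lemma open_image_s:
  assumes "openin (gtop G) Q" shows "openin X (s ` Q)"
proof (subst openin_subopen, clarify)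
  fix a assume "a \<in> Q"
  then obtain W where W: "W \<in> BB" "a \<in> W" "W \<subseteq> Q" using assms openin_gtop_iff by blast
  have "{b \<in> W. t b \<in> topspace X} = W" using W t_in BB_arrows by blast
  then have "openin X (s ` W)" using open_s_BB[OF W(1) openin_topspace] by simp
  then show "\<exists>T. openin X T \<and> s a \<in> T \<and> T \<subseteq> s ` Q" using W by blast
qed

lemma open_image_t:
  assumes "openin (gtop G) Q" shows "openin X (t ` Q)"
proof (subst openin_subopen, clarify)
  fix a assume "a \<in> Q"
  then obtain W where W: "W \<in> BB" "a \<in> W" "W \<subseteq> Q" using assms openin_gtop_iff by blast
  have "{b \<in> W. s b \<in> topspace X} = W" using W s_in BB_arrows by blast
  then have "openin X (t ` W)" using open_t_BB[OF W(1) openin_topspace] by simp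
  then show "\<exists>T. openin X T \<and> t a \<in> T \<and> T \<subseteq> t ` Q" using W by blast
qed

lemma open_restrict:
  assumes "openin (gtop G) Q" "openin X U" "openin X V"
  shows "openin (gtop G) {a \<in> Q. t a \<in> U \<and> s a \<in> V}"
  unfolding openin_gtop_iff
proof
  fix a assume a: "a \<in> {a \<in> Q. t a \<in> U \<and> s a \<in> V}"
  then obtain W where W: "W \<in> BB" "a \<in> W" "W \<subseteq> Q" using assms openin_gtop_iff by blast
  then show "\<exists>W\<in>BB. a \<in> W \<and> W \<subseteq> {a \<in> Q. t a \<in> U \<and> s a \<in> V}"
    using restrict2_BB[OF W(1) assms(2,3)] a by (intro bexI[of _ "{a \<in> W. t a \<in> U \<and> s a \<in> V}"]) auto
qed

lemma continuous_s: "continuous_map (gtop G) X s"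
  unfolding continuous_map_def
proof (intro conjI allI impI)
  show "s \<in> topspace (gtop G) \<rightarrow> topspace X" by (simp add: topspace_gtop s_in)
  fix V assume "openin X V"
  then have "openin (gtop G) {a \<in> topspace (gtop G). t a \<in> topspace X \<and> s a \<in> V}"
    by (intro open_restrict) auto
  then show "openin (gtop G) {a \<in> topspace (gtop G). s a \<in> V}"
    by (simp add: topspace_gtop t_in cong: conj_cong)
qed

lemma continuous_t: "continuous_map (gtop G) X t"
  unfolding continuous_map_def
proof (intro conjI allI impI)
  show "t \<in> topspace (gtop G) \<rightarrow> topspace X" by (simp add: topspace_gtop t_in)
  fix V assume "openin X V"
  then have "openin (gtop G) {a \<in> topspace (gtop G). t a \<in> V \<and> s a \<in> topspace X}"
    by (intro open_restrict) auto
  then show "openin (gtop G) {a \<in> topspace (gtop G). t a \<in> V}"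
    by (simp add: topspace_gtop s_in cong: conj_cong)
qed

lemma open_image_inv:
  assumes "openin (gtop G) Q" shows "openin (gtop G) (ginv G ` Q)"
  unfolding openin_gtop_iff
proof clarify
  fix a assume "a \<in> Q"
  then obtain W where "W \<in> BB" "a \<in> W" "W \<subseteq> Q" using assms openin_gtop_iff by blast
  then show "\<exists>W\<in>BB. ginv G a \<in> W \<and> W \<subseteq> ginv G ` Q"
    by (intro bexI[of _ "ginv G ` W"]) (auto simp: inv_BB)
qed

lemma image_inv_eq:
  assumes "Q \<subseteq> arrows G" shows "ginv G ` Q = {a \<in> arrows G. ginv G a \<in> Q}"
  using assms inv_closed inv_inv by (force simp: image_iff)

lemma continuous_inv: "continuous_map (gtop G) (gtop G) (ginv G)"
  unfolding continuous_map_def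
proof (intro conjI allI impI)
  show "ginv G \<in> topspace (gtop G) \<rightarrow> topspace (gtop G)" by (simp add: topspace_gtop inv_closed)
  fix Q assume Q: "openin (gtop G) Q"
  then show "openin (gtop G) {a \<in> topspace (gtop G). ginv G a \<in> Q}"
    using open_image_inv[OF Q] image_inv_eq[of Q] openin_subset[OF Q] by (simp add: topspace_gtop)
qed

text \<open>The open bisections. Products of members of \<open>BB\<close> are not assumed to lie in
  \<open>BB\<close>, whereas open bisections are closed under products and inverses.\<close>

definition bis :: "'g set \<Rightarrow> bool" where
  "bis W \<longleftrightarrow> openin (gtop G) W \<and> inj_on s W \<and> inj_on t W"

lemma bis_BB: "W \<in> BB \<Longrightarrow> bis W"
  by (simp add: bis_def open_BB inj_s_BB inj_t_BB)

lemma bis_arrows: "bis W \<Longrightarrow> a \<in> W \<Longrightarrow> a \<in> arrows G"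
  by (auto simp: bis_def intro: open_arrows)

lemma bis_inv:
  assumes "bis W" shows "bis (ginv G ` W)"
proof -
  have "inj_on s (ginv G ` W)" "inj_on t (ginv G ` W)"
    using assms bis_arrows[OF assms] unfolding bis_def inj_on_def
    by (simp_all add: s_inv t_inv) metis+
  then show ?thesis using assms by (simp add: bis_def open_image_inv)
qed

definition sprod :: "'g set \<Rightarrow> 'g set \<Rightarrow> 'g set" where
  "sprod W1 W2 = {gmult G a b | a b. a \<in> W1 \<and> b \<in> W2 \<and> s a = t b}"

lemma sprodI: "a \<in> W1 \<Longrightarrow> b \<in> W2 \<Longrightarrow> s a = t b \<Longrightarrow> gmult G a b \<in> sprod W1 W2"
  by (auto simp: sprod_def)

text \<open>Take a slice \<open>W3\<close> through the product ab; by \<open>mult_BB\<close> nearby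
  products fall into it. An arrow of \<open>W3\<close> with the same source as such a product must
  equal it, as \<open>s\<close> is injective on \<open>W3\<close>, and the sources in question form
  the open set \<open>N\<close>.\<close>

lemma open_sprod:
  assumes "openin (gtop G) Q1" "openin (gtop G) Q2"
  shows "openin (gtop G) (sprod Q1 Q2)"
  unfolding openin_gtop_iff
proof
  fix g assume "g \<in> sprod Q1 Q2"
  then obtain a b where g: "g = gmult G a b" and ab: "a \<in> Q1" "b \<in> Q2" "s a = t b"
    by (auto simp: sprod_def)
  have arr: "a \<in> arrows G" "b \<in> arrows G" using ab assms open_arrows by auto
  obtain W1 where W1: "W1 \<in> BB" "a \<in> W1" "W1 \<subseteq> Q1" using assms ab openin_gtop_iff by blast
  obtain W2 where W2: "W2 \<in> BB" "b \<in> W2" "W2 \<subseteq> Q2" using assms ab openin_gtop_iff by blast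
  have "g \<in> arrows G" using arr ab g mult_closed by auto
  then obtain W3 where W3: "W3 \<in> BB" "g \<in> W3" using Union_BB by blast
  obtain U V V' where UV: "openin X U" "openin X V" "openin X V'" "t a \<in> U" "s a \<in> V" "s b \<in> V'"
    and loc: "\<And>a' b'. a' \<in> W1 \<Longrightarrow> b' \<in> W2 \<Longrightarrow> s a' = t b' \<Longrightarrow> t a' \<in> U \<Longrightarrow> s a' \<in> V \<Longrightarrow> s b' \<in> V'
      \<Longrightarrow> gmult G a' b' \<in> W3"
    using mult_BB[OF W1(1) W2(1) W3(1) W1(2) W2(2) ab(3)] g W3 by metis
  define N where "N = s ` {b' \<in> W2. t b' \<in> s ` {a' \<in> W1. t a' \<in> U \<and> s a' \<in> V} \<and> s b' \<in> V'}"
  have "openin X N" unfolding N_def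
    using W1(1) W2(1) UV by (intro open_image_s open_restrict open_BB)
  then have "{c \<in> W3. s c \<in> N} \<in> BB" using W3 by (intro restrict_BB)
  moreover have "s g = s b" using g arr ab s_mult by simp
  then have "s g \<in> N" unfolding N_def using W1(2) W2(2) UV ab
    by (intro image_eqI[of _ _ b] CollectI conjI image_eqI[of _ _ a]) auto
  moreover have "{c \<in> W3. s c \<in> N} \<subseteq> sprod Q1 Q2"
  proof
    fix c assume c: "c \<in> {c \<in> W3. s c \<in> N}"
    then obtain a' b' where *: "s c = s b'" "b' \<in> W2" "t b' = s a'" "a' \<in> W1" "t a' \<in> U" "s a' \<in> V" "s b' \<in> V'"
      by (auto simp: N_def)
    then have "gmult G a' b' \<in> W3" using loc by simp
    moreover have "s (gmult G a' b') = s c" using * W1 W2 BB_arrows by (simp add: s_mult)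
    ultimately have "gmult G a' b' = c" using c inj_s_BB[OF W3(1)] by (auto simp: inj_on_def)
    moreover have "gmult G a' b' \<in> sprod Q1 Q2" using * W1(3) W2(3) by (intro sprodI) auto
    ultimately show "c \<in> sprod Q1 Q2" by simp
  qed
  ultimately show "\<exists>W\<in>BB. g \<in> W \<and> W \<subseteq> sprod Q1 Q2"
    by (intro bexI[of _ "{c \<in> W3. s c \<in> N}"]) (simp_all add: W3(2))
qed

lemma bis_sprod:
  assumes "bis W1" "bis W2" shows "bis (sprod W1 W2)"
proof -
  have "inj_on s (sprod W1 W2)"
  proof (rule inj_onI)
    fix g h assume "g \<in> sprod W1 W2" "h \<in> sprod W1 W2" and eq: "s g = s h"
    then obtain a b a' b' where g: "g = gmult G a b" "a \<in> W1" "b \<in> W2" "s a = t b"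
      and h: "h = gmult G a' b'" "a' \<in> W1" "b' \<in> W2" "s a' = t b'" by (auto simp: sprod_def)
    then have "s b = s b'" using eq assms bis_arrows by (simp add: s_mult)
    then have "b = b'" using g h assms by (auto simp: bis_def inj_on_def)
    then have "a = a'" using g h assms by (auto simp: bis_def inj_on_def)
    then show "g = h" using \<open>b = b'\<close> g h by simp
  qed
  moreover have "inj_on t (sprod W1 W2)"
  proof (rule inj_onI)
    fix g h assume "g \<in> sprod W1 W2" "h \<in> sprod W1 W2" and eq: "t g = t h"
    then obtain a b a' b' where g: "g = gmult G a b" "a \<in> W1" "b \<in> W2" "s a = t b"
      and h: "h = gmult G a' b'" "a' \<in> W1" "b' \<in> W2" "s a' = t b'" by (auto simp: sprod_def)
    then have "t a = t a'" using eq assms bis_arrows by (simp add: t_mult)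
    then have "a = a'" using g h assms by (auto simp: bis_def inj_on_def)
    then have "b = b'" using g h assms by (auto simp: bis_def inj_on_def)
    then show "g = h" using \<open>a = a'\<close> g h by simp
  qed
  ultimately show ?thesis using assms by (simp add: bis_def open_sprod)
qed

text \<open>Continuity of the section is openness of \<open>s\<close>: the preimage of an open
  subset \<open>Q\<close> of \<open>W\<close> under the section is the image of \<open>Q\<close>
  under \<open>s\<close>.\<close>

lemma continuous_section_s:
  assumes "bis W"
  shows "continuous_map (subtopology X (s ` W)) (subtopology (gtop G) W) (inv_into W s)"
  unfolding continuous_map_def
proof (intro conjI allI impI)
  have W: "s ` W \<subseteq> topspace X" "W \<subseteq> arrows G" using assms bis_arrows s_in by auto
  show "inv_into W s \<in> topspace (subtopology X (s ` W)) \<rightarrow> topspace (subtopology (gtop G) W)"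
    using W(2) inv_into_into[of _ s W] by (auto simp: topspace_gtop simp del: inv_into_f_f)
  fix Q assume "openin (subtopology (gtop G) W) Q"
  then have Q: "openin (gtop G) Q" "Q \<subseteq> W" using assms openin_open_subtopology by (auto simp: bis_def)
  have "{x \<in> topspace (subtopology X (s ` W)). inv_into W s x \<in> Q} = s ` Q"
  proof (intro subset_antisym subsetI)
    fix x assume "x \<in> s ` Q"
    then obtain a where a: "a \<in> Q" "x = s a" by blast
    then have "inv_into W s x = a" using Q(2) assms by (auto simp: bis_def)
    then show "x \<in> {x \<in> topspace (subtopology X (s ` W)). inv_into W s x \<in> Q}"
      using a Q(2) W(1) by auto
  next
    fix x assume "x \<in> {x \<in> topspace (subtopology X (s ` W)). inv_into W s x \<in> Q}"
    then show "x \<in> s ` Q" using f_inv_into_f[of x s W] by (auto intro!: image_eqI[of _ _ "inv_into W s x"])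
  qed
  moreover have "openin (subtopology X (s ` W)) (s ` Q)"
    unfolding openin_subtopology using open_image_s[OF Q(1)] Q(2) by blast
  ultimately show "openin (subtopology X (s ` W)) {x \<in> topspace (subtopology X (s ` W)). inv_into W s x \<in> Q}"
    by (simp only:)
qed

lemma continuous_section_t:
  assumes "bis W"
  shows "continuous_map (subtopology X (t ` W)) (subtopology (gtop G) W) (inv_into W t)"
  unfolding continuous_map_def
proof (intro conjI allI impI)
  have W: "t ` W \<subseteq> topspace X" "W \<subseteq> arrows G" using assms bis_arrows t_in by auto
  show "inv_into W t \<in> topspace (subtopology X (t ` W)) \<rightarrow> topspace (subtopology (gtop G) W)"
    using W(2) inv_into_into[of _ t W] by (auto simp: topspace_gtop simp del: inv_into_f_f)
  fix Q assume "openin (subtopology (gtop G) W) Q"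
  then have Q: "openin (gtop G) Q" "Q \<subseteq> W" using assms openin_open_subtopology by (auto simp: bis_def)
  have "{x \<in> topspace (subtopology X (t ` W)). inv_into W t x \<in> Q} = t ` Q"
  proof (intro subset_antisym subsetI)
    fix x assume "x \<in> t ` Q"
    then obtain a where a: "a \<in> Q" "x = t a" by blast
    then have "inv_into W t x = a" using Q(2) assms by (auto simp: bis_def)
    then show "x \<in> {x \<in> topspace (subtopology X (t ` W)). inv_into W t x \<in> Q}"
      using a Q(2) W(1) by auto
  next
    fix x assume "x \<in> {x \<in> topspace (subtopology X (t ` W)). inv_into W t x \<in> Q}"
    then show "x \<in> t ` Q" using f_inv_into_f[of x t W] by (auto intro!: image_eqI[of _ _ "inv_into W t x"])
  qed
  moreover have "openin (subtopology X (t ` W)) (t ` Q)"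
    unfolding openin_subtopology using open_image_t[OF Q(1)] Q(2) by blast
  ultimately show "openin (subtopology X (t ` W)) {x \<in> topspace (subtopology X (t ` W)). inv_into W t x \<in> Q}"
    by (simp only:)
qed

end

subsection \<open>Functions supported in slices\<close>

lemma continuous_map_mult_algebra:
  fixes f g :: "'a \<Rightarrow> 'b::real_normed_algebra"
  assumes "continuous_map Y euclidean f" "continuous_map Y euclidean g"
  shows "continuous_map Y euclidean (\<lambda>x. f x * g x)"
  using assms by (simp add: continuous_map_atin tendsto_mult)

lemma Cc_gens_subset_Cc: "f \<in> Cc_gens (gtop G) \<Longrightarrow> f \<in> Cc G"
  unfolding Cc_def by (intro CollectI exI[of _ "{f}"] exI[of _ "\<lambda>_. 1"]) auto

lemma Cc_scale:
  assumes "f \<in> Cc G" shows "(\<lambda>g. c * f g) \<in> Cc G"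
proof -
  obtain F d where "finite F" "F \<subseteq> Cc_gens (gtop G)" "f = (\<lambda>g. \<Sum>h\<in>F. d h * h g)"
    using assms by (auto simp: Cc_def)
  then show ?thesis unfolding Cc_def
    by (intro CollectI exI[of _ F] exI[of _ "\<lambda>h. c * d h"]) (auto simp: sum_distrib_left mult.assoc)
qed

lemma Cc_add:
  assumes "f \<in> Cc G" "h \<in> Cc G" shows "(\<lambda>g. f g + h g) \<in> Cc G"
proof -
  obtain F d where F: "finite F" "F \<subseteq> Cc_gens (gtop G)" "f = (\<lambda>g. \<Sum>h\<in>F. d h * h g)"
    using assms by (auto simp: Cc_def)
  obtain F' d' where F': "finite F'" "F' \<subseteq> Cc_gens (gtop G)" "h = (\<lambda>g. \<Sum>h\<in>F'. d' h * h g)"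
    using assms by (auto simp: Cc_def)
  \<comment> \<open>The two representations may share generators, whose coefficients then have to be
    added.\<close>
  define dd where "dd k = (if k \<in> F then d k else 0) + (if k \<in> F' then d' k else 0)" for k
  have "(\<Sum>k\<in>F \<union> F'. dd k * k g) = f g + h g" for g
  proof -
    have "(\<Sum>k\<in>F \<union> F'. dd k * k g) =
      (\<Sum>k\<in>F \<union> F'. (if k \<in> F then d k * k g else 0)) + (\<Sum>k\<in>F \<union> F'. (if k \<in> F' then d' k * k g else 0))"
      unfolding sum.distrib[symmetric] by (rule sum.cong) (auto simp: dd_def distrib_right)
    also have "\<dots> = f g + h g"
      using F F' by (simp add: sum.If_cases Int_absorb1)
    finally show ?thesis .
  qed
  then show ?thesis unfolding Cc_def using F F'
    by (intro CollectI exI[of _ "F \<union> F'"] exI[of _ dd]) auto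
qed

lemma Cc_zero: "(\<lambda>_. 0) \<in> Cc G"
  unfolding Cc_def by (intro CollectI exI[of _ "{}"]) auto

lemma Cc_sum: "finite I \<Longrightarrow> (\<And>i. i \<in> I \<Longrightarrow> F i \<in> Cc G) \<Longrightarrow> (\<lambda>g. \<Sum>i\<in>I. F i g) \<in> Cc G"
  by (induction I rule: finite_induct) (auto simp: Cc_zero Cc_add)

context slice_groupoid
begin

text \<open>Instead of a closed support, some compact set \<open>C\<close> is required off which
  \<open>f\<close> vanishes: compact sets can be moved along continuous maps, and no closure has to
  be computed afterwards.\<close>

definition slice_fun :: "'g set \<Rightarrow> ('g \<Rightarrow> complex) \<Rightarrow> bool" where
  "slice_fun W f \<longleftrightarrow> continuous_map (subtopology (gtop G) W) euclidean f \<and>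
     (\<exists>C. compactin (gtop G) C \<and> C \<subseteq> W \<and> (\<forall>g. g \<notin> C \<longrightarrow> f g = 0))"

lemma slice_fun_zero: "slice_fun W f \<Longrightarrow> g \<notin> W \<Longrightarrow> f g = 0"
  by (auto simp: slice_fun_def)

lemma slice_fun_scale: "slice_fun W f \<Longrightarrow> slice_fun W (\<lambda>g. c * f g)"
  unfolding slice_fun_def by (intro conjI continuous_map_mult_algebra) auto

lemma continuous_map_on_bis:
  "continuous_map (gtop G) Y p \<Longrightarrow> continuous_map (subtopology (gtop G) W) Y p"
  by (rule continuous_map_from_subtopology)

text \<open>The space of all arrows may fail to be Hausdorff. On a bisection \<open>s\<close> is
  continuous and injective, so points are separated by preimages of open sets of
  \<open>X\<close>.\<close>

lemma Hausdorff_bis: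
  assumes "bis W" shows "Hausdorff_space (subtopology (gtop G) W)"
  unfolding Hausdorff_space_def
proof (intro allI impI, elim conjE)
  fix a b assume ab: "a \<in> topspace (subtopology (gtop G) W)" "b \<in> topspace (subtopology (gtop G) W)" "a \<noteq> b"
  then have "a \<in> W" "b \<in> W" by auto
  then have "s a \<noteq> s b" "s a \<in> topspace X" "s b \<in> topspace X"
    using ab assms bis_arrows s_in by (auto simp: bis_def inj_on_def)
  then obtain U V where UV: "openin X U" "openin X V" "s a \<in> U" "s b \<in> V" "disjnt U V"
    using haus unfolding Hausdorff_space_def by metis
  have "openin (subtopology (gtop G) W) {g \<in> topspace (subtopology (gtop G) W). s g \<in> Q}" if "openin X Q" for Q
    using continuous_map_on_bis[OF continuous_s] that by (rule openin_continuous_map_preimage)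
  then show "\<exists>U V. openin (subtopology (gtop G) W) U \<and> openin (subtopology (gtop G) W) V \<and> a \<in> U \<and> b \<in> V \<and> disjnt U V"
    using UV ab
    by (intro exI[of _ "{g \<in> topspace (subtopology (gtop G) W). s g \<in> U}"]
              exI[of _ "{g \<in> topspace (subtopology (gtop G) W). s g \<in> V}"]) (auto simp: disjnt_def)
qed

lemma slice_fun_Cc_gens:
  assumes "bis W" "slice_fun W f" shows "f \<in> Cc_gens (gtop G)"
  unfolding Cc_gens_def
proof (intro CollectI exI[of _ W] conjI)
  obtain C where C: "compactin (gtop G) C" "C \<subseteq> W" "\<And>g. g \<notin> C \<Longrightarrow> f g = 0"
    using assms by (auto simp: slice_fun_def)
  have C': "compactin (subtopology (gtop G) W) C" using C by (simp add: compactin_subtopology)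
  then have cl: "closedin (subtopology (gtop G) W) C" by (rule compactin_imp_closedin[OF Hausdorff_bis[OF assms(1)]])
  have "{g \<in> W. f g \<noteq> 0} \<subseteq> C" using C by auto
  then have "subtopology (gtop G) W closure_of {g \<in> W. f g \<noteq> 0} \<subseteq> C" using cl by (rule closure_of_minimal)
  then show "compactin (subtopology (gtop G) W) (subtopology (gtop G) W closure_of {g \<in> W. f g \<noteq> 0})"
    by (rule closed_compactin[OF C']) auto
qed (use assms Hausdorff_bis in \<open>auto simp: bis_def slice_fun_def\<close>)

lemma slice_fun_Cc: "bis W \<Longrightarrow> slice_fun W f \<Longrightarrow> f \<in> Cc G"
  by (intro Cc_gens_subset_Cc slice_fun_Cc_gens)

text \<open>A Urysohn function on \<open>X\<close> is pulled back along \<open>s\<close> to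
  \<open>W\<close> and extended by zero. Continuity of the extension is proved inside a Hausdorff
  open set \<open>U\<close>, where the compact set \<open>C\<close> is closed; hence everything
  stays relative to \<open>U\<close>.\<close>

lemma bump_function:
  assumes U: "openin (gtop G) U" "Hausdorff_space (subtopology (gtop G) U)"
    and W: "W \<in> BB" "W \<subseteq> U" "a \<in> W"
  obtains p :: "'g \<Rightarrow> real" and C where "continuous_map (subtopology (gtop G) U) euclideanreal p"
    "\<And>g. 0 \<le> p g" "p a = 1" "compactin (gtop G) C" "C \<subseteq> W" "\<And>g. g \<notin> C \<Longrightarrow> p g = 0"
proof -
  have bis: "bis W" using W bis_BB by simp
  have "openin X (s ` W)" using W open_BB open_image_s by blast
  moreover have "neighbourhood_base_of (compactin X) X"
    using haus lc locally_compact_space_neighbourhood_base by blast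
  ultimately obtain N L where N: "openin X N" "compactin X L" "s a \<in> N" "N \<subseteq> L" "L \<subseteq> s ` W"
    using W(3) unfolding neighbourhood_base_of by (metis imageI)
  have cr: "completely_regular_space X"
    using haus lc locally_compact_regular_imp_completely_regular_space by blast
  have sa: "s a \<in> topspace X" using bis W(3) bis_arrows s_in by blast
  have "closedin X (topspace X - N)" "compactin X {s a}" "disjnt {s a} (topspace X - N)"
    using N(1,3) sa by (auto simp: disjnt_def)
  then obtain k where k: "continuous_map X (subtopology euclideanreal {0..1}) k"
      "k ` (topspace X - N) \<subseteq> {0}" "k ` {s a} \<subseteq> {1}"
    using Urysohn_completely_regular_compact_closed[of 0 1 X "{s a}" "topspace X - N"] cr
    by (metis zero_le_one)
  define C where "C = inv_into W s ` L"
  define p where "p g = (if g \<in> W then k (s g) else 0)" for g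
  have kcont: "continuous_map X euclideanreal k" and k01: "\<And>x. x \<in> topspace X \<Longrightarrow> k x \<in> {0..1}"
    using k(1) by (auto simp: continuous_map_in_subtopology)
  have "compactin (subtopology (gtop G) W) C" unfolding C_def
    using N(2,5) continuous_section_s[OF bis] by (intro image_compactin) (auto simp: compactin_subtopology)
  then have C: "compactin (gtop G) C" "C \<subseteq> W" by (auto simp: compactin_subtopology)
  have p0: "p g = 0" if "g \<notin> C" for g
  proof (cases "g \<in> W")
    case True
    then have "s g \<notin> L" using that bis by (force simp: C_def bis_def)
    moreover have "s g \<in> topspace X" using True bis bis_arrows s_in by blast
    ultimately show ?thesis using k(2) N(4) by (auto simp: p_def)
  qed (simp add: p_def)
  have op: "openin (gtop G) {g \<in> U. p g \<in> P}" if P: "open P" for P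
  proof -
    have "compactin (subtopology (gtop G) U) C" using C W(2) by (simp add: compactin_subtopology)
    then have "closedin (subtopology (gtop G) U) C" using U(2) compactin_imp_closedin by blast
    then have "openin (subtopology (gtop G) U) (U - C)"
      using openin_subset[OF U(1)] by (simp add: closedin_def Int_absorb1)
    then have o: "openin (gtop G) (U - C)" using U(1) openin_trans_full by blast
    have "continuous_map (gtop G) euclideanreal (k \<circ> s)"
      using continuous_s kcont by (rule continuous_map_compose)
    then have "openin (gtop G) {g \<in> topspace (gtop G). (k \<circ> s) g \<in> P}"
      by (rule openin_continuous_map_preimage) (use P in simp)
    then have o': "openin (gtop G) (W \<inter> {g \<in> topspace (gtop G). (k \<circ> s) g \<in> P})"
      using bis by (auto simp: bis_def)
    \<comment> \<open>The open sets \<open>W\<close> and \<open>U - C\<close> cover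
      \<open>U\<close>; on their overlap both descriptions of \<open>p\<close> give 0.\<close>
    have "{g \<in> U. p g \<in> P} = (W \<inter> {g \<in> topspace (gtop G). (k \<circ> s) g \<in> P}) \<union> (if 0 \<in> P then U - C else {})"
    proof -
      have "k (s g) = 0" if "g \<in> W" "g \<notin> C" for g using p0[OF that(2)] that(1) by (simp add: p_def)
      then show ?thesis
        using C(2) W(2) bis_arrows[OF bis] by (auto simp: p_def topspace_gtop)
    qed
    then show ?thesis using o o' by (auto intro: openin_Un split: if_splits)
  qed
  have "continuous_map (subtopology (gtop G) U) euclideanreal p"
    unfolding continuous_map_def
  proof (intro conjI allI impI)
    fix P :: "real set" assume "openin euclideanreal P"
    moreover have "{x \<in> topspace (subtopology (gtop G) U). p x \<in> P} = {g \<in> U. p g \<in> P}"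
      using openin_subset[OF U(1)] by auto
    ultimately show "openin (subtopology (gtop G) U) {x \<in> topspace (subtopology (gtop G) U). p x \<in> P}"
      using op[of P] U(1) by (auto simp: openin_open_subtopology)
  qed auto
  moreover have "0 \<le> p g" for g
    using k01[of "s g"] bis bis_arrows s_in by (auto simp: p_def)
  moreover have "p a = 1" using k(3) W by (auto simp: p_def)
  ultimately show ?thesis using that C p0 by blast
qed

text \<open>A partition of unity on the compact set \<open>KK\<close>: finitely many bumps are
  chosen such that at each point of \<open>KK\<close> one of them exceeds 1/2, and \<open>f\<close>
  is split in proportion to them.\<close>

lemma Cc_gens_decompose:
  assumes "f \<in> Cc_gens (gtop G)"
  obtains I and F :: "'g \<Rightarrow> 'g \<Rightarrow> complex" where "finite I"
    "\<forall>i\<in>I. \<exists>W\<in>BB. slice_fun W (F i)" "f = (\<lambda>g. \<Sum>i\<in>I. F i g)"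
proof -
  obtain U where U: "openin (gtop G) U" "Hausdorff_space (subtopology (gtop G) U)"
    and f0: "\<And>g. g \<notin> U \<Longrightarrow> f g = 0" and fc: "continuous_map (subtopology (gtop G) U) euclidean f"
    and K: "compactin (subtopology (gtop G) U) (subtopology (gtop G) U closure_of {g \<in> U. f g \<noteq> 0})"
    using assms unfolding Cc_gens_def by blast
  define KK where "KK = subtopology (gtop G) U closure_of {g \<in> U. f g \<noteq> 0}"
  have KK: "compactin (gtop G) KK" "KK \<subseteq> U" using K by (auto simp: KK_def compactin_subtopology)
  have fKK: "g \<in> KK" if "f g \<noteq> 0" for g
  proof -
    have "{g \<in> U. f g \<noteq> 0} \<subseteq> KK" unfolding KK_def
      using openin_subset[OF U(1)] by (intro closure_of_subset) auto
    then show ?thesis using that f0 by blast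
  qed
  have "\<forall>a. \<exists>W p C. a \<in> KK \<longrightarrow> W \<in> BB \<and> W \<subseteq> U \<and> continuous_map (subtopology (gtop G) U) euclideanreal p \<and>
    (\<forall>g. 0 \<le> p g) \<and> p a = 1 \<and> compactin (gtop G) C \<and> C \<subseteq> W \<and> (\<forall>g. g \<notin> C \<longrightarrow> p g = 0)"
  proof (intro allI, goal_cases)
    case (1 a)
    show ?case
    proof (cases "a \<in> KK")
      case True
      have "a \<in> U" using True KK by blast
      then obtain W where "W \<in> BB" "a \<in> W" "W \<subseteq> U" using U(1) openin_gtop_iff by blast
      then show ?thesis using bump_function[OF U, of W a] by metis
    qed simp
  qed
  then obtain W p C where "\<forall>a. a \<in> KK \<longrightarrow> W a \<in> BB \<and> W a \<subseteq> U \<and>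
      continuous_map (subtopology (gtop G) U) euclideanreal (p a) \<and> (\<forall>g. 0 \<le> p a g) \<and> p a a = 1 \<and>
      compactin (gtop G) (C a) \<and> C a \<subseteq> W a \<and> (\<forall>g. g \<notin> C a \<longrightarrow> p a g = 0)"
    unfolding choice_iff by blast
  then have W: "\<And>a. a \<in> KK \<Longrightarrow> W a \<in> BB" "\<And>a. a \<in> KK \<Longrightarrow> W a \<subseteq> U"
    and p: "\<And>a. a \<in> KK \<Longrightarrow> continuous_map (subtopology (gtop G) U) euclideanreal (p a)"
      "\<And>a g. a \<in> KK \<Longrightarrow> 0 \<le> p a g" "\<And>a. a \<in> KK \<Longrightarrow> p a a = (1::real)"
    and C: "\<And>a. a \<in> KK \<Longrightarrow> compactin (gtop G) (C a)" "\<And>a. a \<in> KK \<Longrightarrow> C a \<subseteq> W a"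
      "\<And>a g. a \<in> KK \<Longrightarrow> g \<notin> C a \<Longrightarrow> p a g = 0"
    by auto
  define N where "N a = {g \<in> U. p a g > 1/2}" for a
  have "openin (gtop G) (N a)" if "a \<in> KK" for a
  proof -
    have "openin (subtopology (gtop G) U) {g \<in> topspace (subtopology (gtop G) U). p a g \<in> {1/2<..}}"
      using p(1)[OF that] by (rule openin_continuous_map_preimage) simp
    moreover have "{g \<in> topspace (subtopology (gtop G) U). p a g \<in> {1/2<..}} = N a"
      using openin_subset[OF U(1)] by (auto simp: N_def)
    ultimately show ?thesis using U(1) openin_trans_full by metis
  qed
  moreover have "KK \<subseteq> \<Union>(N ` KK)" using KK p by (force simp: N_def)
  ultimately obtain \<F> where "finite \<F>" "\<F> \<subseteq> N ` KK" "KK \<subseteq> \<Union>\<F>"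
    using KK(1) unfolding compactin_def by (metis (no_types, lifting) imageE)
  then obtain I where I: "finite I" "I \<subseteq> KK" "KK \<subseteq> \<Union>(N ` I)"
    by (metis finite_subset_image)
  \<comment> \<open>The floor 1/2 keeps \<open>q\<close> positive on all of \<open>U\<close>, so
    that the quotients are continuous there. It is inactive where \<open>f\<close> is nonzero,
    because there some bump exceeds 1/2.\<close>
  define q where "q g = max (1/2) (\<Sum>a\<in>I. p a g)" for g
  have qcont: "continuous_map (subtopology (gtop G) U) euclideanreal q" unfolding q_def
    using I p(1) by (intro continuous_map_real_max continuous_map_sum) auto
  have qpos: "q g > 0" for g by (simp add: q_def less_max_iff_disj)
  define F where "F a g = f g * complex_of_real (p a g / q g)" for a g
  have "\<exists>W\<in>BB. slice_fun W (F a)" if "a \<in> I" for a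
  proof
    have a: "a \<in> KK" using that I by auto
    show "W a \<in> BB" using W a by blast
    have "continuous_map (subtopology (gtop G) U) euclidean (\<lambda>g. p a g / q g)"
      using p(1)[OF a] qcont qpos by (intro continuous_map_real_divide) (auto simp: less_le)
    then have "continuous_map (subtopology (gtop G) U) euclidean (complex_of_real \<circ> (\<lambda>g. p a g / q g))"
      by (rule continuous_map_compose) (auto intro!: continuous_intros)
    then have "continuous_map (subtopology (gtop G) U) euclidean (F a)"
      unfolding F_def o_def by (rule continuous_map_mult_algebra[OF fc])
    then have "continuous_map (subtopology (gtop G) (W a)) euclidean (F a)"
      using W(2)[OF a] by (rule continuous_map_from_subtopology_mono)
    then show "slice_fun (W a) (F a)" unfolding slice_fun_def
      using C[OF a] by (intro conjI exI[of _ "C a"]) (auto simp: F_def)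
  qed
  moreover have "f g = (\<Sum>a\<in>I. F a g)" for g
  proof (cases "f g = 0")
    case False
    then obtain a where a: "a \<in> I" "g \<in> N a" using fKK I by blast
    have "1/2 < p a g" using a by (simp add: N_def)
    also have "p a g \<le> (\<Sum>a\<in>I. p a g)"
      using I p(2) a by (intro member_le_sum) auto
    finally have q: "q g = (\<Sum>a\<in>I. p a g)" by (simp add: q_def)
    have "(\<Sum>a\<in>I. F a g) = f g * complex_of_real ((\<Sum>a\<in>I. p a g) / q g)"
      unfolding F_def sum_distrib_left[symmetric] of_real_sum[symmetric] sum_divide_distrib by simp
    also have "\<dots> = f g" using qpos[of g] by (simp flip: q)
    finally show ?thesis by simp
  qed (simp add: F_def)
  ultimately show ?thesis using I by (intro that[of I F]) auto
qed

text \<open>Reduces an additive property to functions supported in one slice. Scalar factors are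
  absorbed into the slice functions, so they require no case of their own.\<close>

lemma Cc_induct [consumes 1, case_names zero slice add]:
  assumes "f \<in> Cc G" and zero: "P (\<lambda>_. 0)"
    and slice: "\<And>W f. W \<in> BB \<Longrightarrow> slice_fun W f \<Longrightarrow> P f"
    and add: "\<And>f h. f \<in> Cc G \<Longrightarrow> h \<in> Cc G \<Longrightarrow> P f \<Longrightarrow> P h \<Longrightarrow> P (\<lambda>g. f g + h g)"
  shows "P f"
proof -
  have sum: "P (\<lambda>g. \<Sum>i\<in>I. F i g)"
    if "finite I" "\<And>i. i \<in> I \<Longrightarrow> F i \<in> Cc G \<and> P (F i)" for I :: "'i set" and F
    using that
  proof (induction I rule: finite_induct)
    case (insert x I)
    then show ?case by (simp, intro add) (auto intro: Cc_sum)
  qed (simp add: zero)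
  have gens: "P (\<lambda>g. c * h g)" if h: "h \<in> Cc_gens (gtop G)" for h c
  proof -
    obtain I and F :: "'g \<Rightarrow> 'g \<Rightarrow> complex" where I: "finite I" and F: "\<forall>i\<in>I. \<exists>W\<in>BB. slice_fun W (F i)"

      and "h = (\<lambda>g. \<Sum>i\<in>I. F i g)"
      by (rule Cc_gens_decompose[OF h])
    then have eq: "(\<lambda>g. c * h g) = (\<lambda>g. \<Sum>i\<in>I. c * F i g)" by (simp add: sum_distrib_left)
    show ?thesis unfolding eq
    proof (rule sum[OF I])
      fix i assume "i \<in> I"
      then obtain W where W: "W \<in> BB" "slice_fun W (\<lambda>g. c * F i g)" using F slice_fun_scale by blast
      then show "(\<lambda>g. c * F i g) \<in> Cc G \<and> P (\<lambda>g. c * F i g)"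
        using slice slice_fun_Cc bis_BB by blast
    qed
  qed
  obtain F d where F: "finite F" "F \<subseteq> Cc_gens (gtop G)" and f: "f = (\<lambda>g. \<Sum>h\<in>F. d h * h g)"
    using \<open>f \<in> Cc G\<close> by (auto simp: Cc_def)
  show ?thesis unfolding f
  proof (rule sum[OF F(1)])
    fix h assume "h \<in> F"
    then have "h \<in> Cc_gens (gtop G)" using F(2) by auto
    then show "(\<lambda>g. d h * h g) \<in> Cc G \<and> P (\<lambda>g. d h * h g)"
      by (intro conjI Cc_scale Cc_gens_subset_Cc gens)
  qed
qed

end

subsection \<open>Convolution and involution\<close>

context slice_groupoid
begin

text \<open>\<open>rsum f \<kappa> x\<close> is the sum of \<open>f a * \<kappa> a\<close> over the range fibre at \<open>x\<close>; this is
  the common form of convolutions by \<open>f\<close>, by its pushforward, and of the skew action below.\<close>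

definition rsum :: "('g \<Rightarrow> complex) \<Rightarrow> ('g \<Rightarrow> complex) \<Rightarrow> 'x \<Rightarrow> complex" where
  "rsum f \<kappa> x = (\<Sum>a\<in>{a \<in> arrows G. t a = x \<and> f a \<noteq> 0}. f a * \<kappa> a)"

text \<open>Finiteness on range fibres makes convolution a finite sum; finiteness on source fibres
  does the same for the pushforward, since a fibre of \<pi> lies in one source fibre.\<close>

definition fibre_finite :: "('g \<Rightarrow> complex) \<Rightarrow> bool" where
  "fibre_finite f \<longleftrightarrow> (\<forall>x. finite {a \<in> arrows G. t a = x \<and> f a \<noteq> 0} \<and> finite {a \<in> arrows G. s a = x \<and> f a \<noteq> 0})"

lemma rsum_eq:
  assumes "finite A" "{a \<in> arrows G. t a = x \<and> f a \<noteq> 0} \<subseteq> A" "A \<subseteq> {a \<in> arrows G. t a = x}"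
  shows "rsum f \<kappa> x = (\<Sum>a\<in>A. f a * \<kappa> a)"
  unfolding rsum_def using assms by (intro sum.mono_neutral_left) auto

lemma rsum_add_left:
  assumes "fibre_finite f" "fibre_finite h"
  shows "rsum (\<lambda>a. f a + h a) \<kappa> x = rsum f \<kappa> x + rsum h \<kappa> x"
proof -
  define A where "A = {a \<in> arrows G. t a = x \<and> f a \<noteq> 0} \<union> {a \<in> arrows G. t a = x \<and> h a \<noteq> 0}"
  have "finite A" using assms by (auto simp: A_def fibre_finite_def)
  then show ?thesis
    by (subst (1 2 3) rsum_eq[of A]) (auto simp: A_def distrib_right sum.distrib)
qed

lemma rsum_add_right: "rsum f (\<lambda>a. \<kappa> a + \<kappa>' a) x = rsum f \<kappa> x + rsum f \<kappa>' x"
  by (simp add: rsum_def distrib_left sum.distrib)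

lemma rsum_scale_right: "rsum f (\<lambda>a. c * \<kappa> a) x = c * rsum f \<kappa> x"
  by (simp add: rsum_def sum_distrib_left mult.left_commute)

lemma rsum_scale_left: "rsum (\<lambda>a. c * f a) \<kappa> x = c * rsum f \<kappa> x"
  by (cases "c = 0") (simp_all add: rsum_def sum_distrib_left mult.assoc)

lemma rsum_cong: "(\<And>a. a \<in> arrows G \<Longrightarrow> t a = x \<Longrightarrow> f a \<noteq> 0 \<Longrightarrow> \<kappa> a = \<kappa>' a) \<Longrightarrow> rsum f \<kappa> x = rsum f \<kappa>' x"
  by (auto simp: rsum_def intro!: sum.cong)

text \<open>A bisection meets each range fibre in at most one arrow, so at most one term
  survives.\<close>

lemma rsum_slice:
  assumes "bis W" "\<And>g. g \<notin> W \<Longrightarrow> f g = 0" "a \<in> W"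
  shows "rsum f \<kappa> (t a) = f a * \<kappa> a"
proof -
  have "b = a" if "t b = t a" "f b \<noteq> 0" for b
    using assms that by (metis bis_def inj_onD)
  then have "rsum f \<kappa> (t a) = (\<Sum>b\<in>{a}. f b * \<kappa> b)"
    using assms bis_arrows by (intro rsum_eq) auto
  then show ?thesis by simp
qed

lemma rsum_slice_0:
  assumes "\<And>g. g \<notin> W \<Longrightarrow> f g = 0" "x \<notin> t ` W"
  shows "rsum f \<kappa> x = 0"
proof -
  have "{a \<in> arrows G. t a = x \<and> f a \<noteq> 0} = {}" using assms by auto
  then show ?thesis by (simp only: rsum_def sum.empty)
qed

lemma fibre_finite_slice:
  assumes "bis W" "\<And>g. g \<notin> W \<Longrightarrow> f g = 0" shows "fibre_finite f"
proof -
  have "finite {a \<in> arrows G. p a = x \<and> f a \<noteq> 0}" if "inj_on p W" for p :: "'g \<Rightarrow> 'x" and x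
  proof (rule finite_subset)
    have "a \<in> W" if "f a \<noteq> 0" for a using assms(2) that by blast
    then show "{a \<in> arrows G. p a = x \<and> f a \<noteq> 0} \<subseteq> {inv_into W p x}"
      using inv_into_f_f[OF that] by auto
  qed simp
  then show ?thesis using assms(1) by (auto simp: fibre_finite_def bis_def)
qed

lemma fibre_finite_add:
  assumes "fibre_finite f" "fibre_finite h" shows "fibre_finite (\<lambda>a. f a + h a)"
  unfolding fibre_finite_def
proof (intro allI conjI)
  fix x
  show "finite {a \<in> arrows G. t a = x \<and> f a + h a \<noteq> 0}"
    by (rule finite_subset[of _ "{a \<in> arrows G. t a = x \<and> f a \<noteq> 0} \<union> {a \<in> arrows G. t a = x \<and> h a \<noteq> 0}"])
      (use assms in \<open>auto simp: fibre_finite_def\<close>)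
  show "finite {a \<in> arrows G. s a = x \<and> f a + h a \<noteq> 0}"
    by (rule finite_subset[of _ "{a \<in> arrows G. s a = x \<and> f a \<noteq> 0} \<union> {a \<in> arrows G. s a = x \<and> h a \<noteq> 0}"])
      (use assms in \<open>auto simp: fibre_finite_def\<close>)
qed

lemma Cc_fibre_finite: "f \<in> Cc G \<Longrightarrow> fibre_finite f"
proof (induction rule: Cc_induct)
  case zero
  then show ?case by (simp add: fibre_finite_def)
next
  case (slice W f)
  then show ?case using fibre_finite_slice bis_BB slice_fun_zero by blast
qed (rule fibre_finite_add)

lemma conv_outside:
  assumes "g \<notin> arrows G" shows "conv G f h g = 0"
proof -
  have "{(a, b). a \<in> arrows G \<and> b \<in> arrows G \<and> gsrc G a = grng G b \<and> gmult G a b = g} = {}"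
    using assms by (auto simp: gsrc_eq grng_eq e_inj s_in t_in mult_closed)
  then show ?thesis by (simp only: conv_def infsum_empty)
qed

text \<open>Factorisations g = ab correspond to arrows a with the range of g, because then b is a^-1
  g. Only the finitely many a with \<open>f a \<noteq> 0\<close> contribute, whatever
  \<open>h\<close> is, which allows vectors of ell2 as second argument.\<close>

lemma conv_eq_rsum:
  assumes f: "fibre_finite f" and g: "g \<in> arrows G"
  shows "conv G f h g = rsum f (\<lambda>a. h (gmult G (ginv G a) g)) (t g)"
proof -
  define A where "A = {a \<in> arrows G. t a = t g \<and> f a \<noteq> 0}"
  define j where "j a = (a, gmult G (ginv G a) g)" for a
  have fin: "finite A" using f by (auto simp: A_def fibre_finite_def)
  have "conv G f h g = (\<Sum>\<^sub>\<infinity>(a, b)\<in>j ` A. f a * h b)" unfolding conv_def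
  proof (rule infsum_cong_neutral)
    fix p assume "p \<in> {(a, b). a \<in> arrows G \<and> b \<in> arrows G \<and> gsrc G a = grng G b \<and> gmult G a b = g} - j ` A"
    then obtain a b where p: "p = (a, b)" "a \<in> arrows G" "b \<in> arrows G" "s a = t b" "gmult G a b = g"
      and nj: "p \<notin> j ` A"
      by (auto simp: gsrc_eq grng_eq e_inj s_in t_in)
    then have "b = gmult G (ginv G a) g" "t a = t g" by (auto simp: inv_mult_cancel t_mult)
    then have "f a = 0" using p nj by (auto simp: j_def A_def)
    then show "(case p of (a, b) \<Rightarrow> f a * h b) = 0" using p by simp
  next
    fix p assume "p \<in> j ` A - {(a, b). a \<in> arrows G \<and> b \<in> arrows G \<and> gsrc G a = grng G b \<and> gmult G a b = g}"
    then show "(case p of (a, b) \<Rightarrow> f a * h b) = 0"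
      using g by (auto simp: j_def A_def div_closed mult_inv_cancel gsrc_eq grng_eq)
  qed auto
  also have "\<dots> = (\<Sum>(a, b)\<in>j ` A. f a * h b)" using fin by simp
  also have "\<dots> = (\<Sum>a\<in>A. f a * h (gmult G (ginv G a) g))"
    by (subst sum.reindex) (auto simp: j_def inj_on_def)
  finally show ?thesis by (simp add: rsum_def A_def)
qed

lemma conv_slice:
  assumes "bis W" "\<And>g. g \<notin> W \<Longrightarrow> f g = 0" "a \<in> W" "g \<in> arrows G" "t a = t g"
  shows "conv G f h g = f a * h (gmult G (ginv G a) g)"
proof -
  have "conv G f h g = rsum f (\<lambda>a. h (gmult G (ginv G a) g)) (t a)"
    unfolding assms(5) by (rule conv_eq_rsum[OF fibre_finite_slice[OF assms(1,2)] assms(4)])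
  then show ?thesis using rsum_slice[OF assms(1,2,3)] by simp
qed

lemma conv_slice_0:
  assumes "bis W" "\<And>g. g \<notin> W \<Longrightarrow> f g = 0" "t g \<notin> t ` W"
  shows "conv G f h g = 0"
proof (cases "g \<in> arrows G")
  case True
  have "conv G f h g = rsum f (\<lambda>a. h (gmult G (ginv G a) g)) (t g)"
    by (rule conv_eq_rsum[OF fibre_finite_slice[OF assms(1,2)] True])
  also have "\<dots> = 0" by (rule rsum_slice_0[OF assms(2,3)])
  finally show ?thesis .
qed (simp add: conv_outside)

lemma conv_add_left:
  assumes "f \<in> Cc G" "f' \<in> Cc G"
  shows "conv G (\<lambda>g. f g + f' g) h = (\<lambda>g. conv G f h g + conv G f' h g)"
proof
  fix g show "conv G (\<lambda>g. f g + f' g) h g = conv G f h g + conv G f' h g"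
    using assms by (cases "g \<in> arrows G")
      (simp_all add: conv_outside conv_eq_rsum Cc_fibre_finite fibre_finite_add rsum_add_left)
qed

lemma conv_add_right:
  assumes "f \<in> Cc G"
  shows "conv G f (\<lambda>g. h g + h' g) = (\<lambda>g. conv G f h g + conv G f h' g)"
proof
  fix g show "conv G f (\<lambda>g. h g + h' g) g = conv G f h g + conv G f h' g"
    using assms by (cases "g \<in> arrows G")
      (simp_all add: conv_outside conv_eq_rsum Cc_fibre_finite rsum_add_right)
qed

lemma conv_scale_left:
  assumes "f \<in> Cc G"
  shows "conv G (\<lambda>g. c * f g) h = (\<lambda>g. c * conv G f h g)"
proof
  fix g show "conv G (\<lambda>g. c * f g) h g = c * conv G f h g"
    using assms Cc_scale[OF assms, of c] by (cases "g \<in> arrows G")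
      (simp_all add: conv_outside conv_eq_rsum Cc_fibre_finite rsum_scale_left)
qed

lemma conv_scale_right:
  assumes "f \<in> Cc G"
  shows "conv G f (\<lambda>g. c * h g) = (\<lambda>g. c * conv G f h g)"
proof
  fix g show "conv G f (\<lambda>g. c * h g) g = c * conv G f h g"
    using assms by (cases "g \<in> arrows G")
      (simp_all add: conv_outside conv_eq_rsum Cc_fibre_finite rsum_scale_right)
qed

lemma conv_zero: "conv G (\<lambda>_. 0) h = (\<lambda>_. 0)" "conv G f (\<lambda>_. 0) = (\<lambda>_. 0)"
  by (auto simp: conv_def fun_eq_iff intro!: infsum_0)

text \<open>An arrow of a product of bisections factors uniquely: its range determines the first
  factor and its source the second. So convolution becomes a pointwise product there.\<close>

lemma conv_sprod:
  assumes W1: "bis W1" "\<And>g. g \<notin> W1 \<Longrightarrow> f1 g = 0" and W2: "bis W2" "\<And>g. g \<notin> W2 \<Longrightarrow> f2 g = 0"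
  shows "a \<in> W1 \<Longrightarrow> b \<in> W2 \<Longrightarrow> s a = t b \<Longrightarrow> conv G f1 f2 (gmult G a b) = f1 a * f2 b"
    and "g \<notin> sprod W1 W2 \<Longrightarrow> conv G f1 f2 g = 0"
proof -
  assume ab: "a \<in> W1" "b \<in> W2" "s a = t b"
  then have "a \<in> arrows G" "b \<in> arrows G" using W1 W2 bis_arrows by auto
  then show "conv G f1 f2 (gmult G a b) = f1 a * f2 b"
    using conv_slice[OF W1 ab(1), where g = "gmult G a b"] ab by (simp add: mult_closed t_mult inv_mult_cancel)
next
  assume g: "g \<notin> sprod W1 W2"
  show "conv G f1 f2 g = 0"
  proof (cases "t g \<in> t ` W1 \<and> g \<in> arrows G")
    case True
    then obtain a where a: "a \<in> W1" "t a = t g" "a \<in> arrows G" using W1 bis_arrows by force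
    have "gmult G (ginv G a) g \<notin> W2"
    proof
      assume "gmult G (ginv G a) g \<in> W2"
      then have "gmult G a (gmult G (ginv G a) g) \<in> sprod W1 W2"
        using a True by (intro sprodI) (auto simp: div_closed)
      then show False using g a True by (simp add: mult_inv_cancel)
    qed
    then show ?thesis using conv_slice[OF W1 a(1) _ a(2)] True W2(2) by simp
  next
    case False
    then show ?thesis using conv_slice_0[where f = f1, OF W1] conv_outside by blast
  qed
qed

lemma slice_fun_conv:
  assumes W1: "bis W1" "slice_fun W1 f1" and W2: "bis W2" "slice_fun W2 f2"
  shows "slice_fun (sprod W1 W2) (conv G f1 f2)"
proof -
  let ?W = "sprod W1 W2"
  obtain C1 where C1: "compactin (gtop G) C1" "C1 \<subseteq> W1" "\<And>g. g \<notin> C1 \<Longrightarrow> f1 g = 0"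
    using W1 by (auto simp: slice_fun_def)
  obtain C2 where C2: "compactin (gtop G) C2" "C2 \<subseteq> W2" "\<And>g. g \<notin> C2 \<Longrightarrow> f2 g = 0"
    using W2 by (auto simp: slice_fun_def)
  note z = slice_fun_zero[OF W1(2)] slice_fun_zero[OF W2(2)]
  have bW: "bis ?W" using W1 W2 bis_sprod by simp
  have "continuous_map (subtopology (gtop G) ?W) (subtopology X (t ` W1)) t"
    unfolding continuous_map_in_subtopology using continuous_map_on_bis[OF continuous_t]
    by (auto simp: sprod_def t_mult bis_arrows[OF W1(1)] bis_arrows[OF W2(1)])
  from continuous_map_compose[OF this continuous_section_t[OF W1(1)]]
  have p1: "continuous_map (subtopology (gtop G) ?W) (subtopology (gtop G) W1) (inv_into W1 t \<circ> t)" .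
  have "continuous_map (subtopology (gtop G) ?W) (subtopology X (s ` W2)) s"
    unfolding continuous_map_in_subtopology using continuous_map_on_bis[OF continuous_s]
    by (auto simp: sprod_def s_mult bis_arrows[OF W1(1)] bis_arrows[OF W2(1)])
  from continuous_map_compose[OF this continuous_section_s[OF W2(1)]]
  have p2: "continuous_map (subtopology (gtop G) ?W) (subtopology (gtop G) W2) (inv_into W2 s \<circ> s)" .
  \<comment> \<open>The two factors depend continuously on their product g: the first is found from
    the range of g, the second from its source.\<close>
  have cont: "continuous_map (subtopology (gtop G) ?W) euclidean
      (\<lambda>g. (f1 \<circ> (inv_into W1 t \<circ> t)) g * (f2 \<circ> (inv_into W2 s \<circ> s)) g)"
    using W1(2) W2(2) p1 p2 unfolding slice_fun_def
    by (intro continuous_map_mult_algebra continuous_map_compose[of _ "subtopology (gtop G) W1"]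
        continuous_map_compose[of _ "subtopology (gtop G) W2"]) auto
  have fc: "continuous_map (subtopology (gtop G) ?W) euclidean (conv G f1 f2)"
  proof (rule continuous_map_eq[OF cont])
    fix g assume "g \<in> topspace (subtopology (gtop G) ?W)"
    then obtain a b where "g = gmult G a b" "a \<in> W1" "b \<in> W2" "s a = t b" by (auto simp: sprod_def)
    moreover from this have "inv_into W1 t (t g) = a" "inv_into W2 s (s g) = b"
      using W1(1) W2(1) bis_arrows by (simp_all add: t_mult s_mult bis_def)
    ultimately show "(f1 \<circ> (inv_into W1 t \<circ> t)) g * (f2 \<circ> (inv_into W2 s \<circ> s)) g = conv G f1 f2 g"
      using conv_sprod(1)[OF W1(1) z(1) W2(1) z(2)] by simp
  qed
  \<comment> \<open>\<open>D\<close> consists of the arrows of \<open>C2\<close> that are composable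
    with \<open>C1\<close>. It is compact, since the sources of \<open>C1\<close> form a compact,
    hence closed, set in \<open>X\<close>. A product has the source of its second factor, so lifting
    the sources of \<open>D\<close> to the product bisection yields a compact set \<open>C\<close>
    outside which the convolution vanishes.\<close>
  define D where "D = {b \<in> topspace (gtop G). t b \<in> s ` C1} \<inter> C2"
  have "compactin X (s ` C1)" using C1(1) continuous_s by (rule image_compactin)
  then have "closedin X (s ` C1)" using haus compactin_imp_closedin by blast
  then have "closedin (gtop G) {b \<in> topspace (gtop G). t b \<in> s ` C1}"
    using continuous_t closedin_continuous_map_preimage by blast
  then have D: "compactin (gtop G) D" unfolding D_def using C2(1) by (rule closed_Int_compactin)
  define C where "C = inv_into ?W s ` s ` D"
  have sD: "\<exists>a\<in>C1. s a = t b \<and> gmult G a b \<in> ?W \<and> s b = s (gmult G a b)" if "b \<in> D" for b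
  proof -
    have "t b \<in> s ` C1" "b \<in> W2" using that C2(2) by (auto simp: D_def)
    then obtain a where "a \<in> C1" "s a = t b" by auto
    then show ?thesis using C1(2) \<open>b \<in> W2\<close> bis_arrows[OF W1(1)] bis_arrows[OF W2(1)]
      by (intro bexI[of _ a]) (auto simp: s_mult intro!: sprodI)
  qed
  have "compactin X (s ` D)" using D continuous_s by (rule image_compactin)
  moreover have sDW: "s ` D \<subseteq> s ` ?W" using sD by blast
  ultimately have "compactin (subtopology (gtop G) ?W) C" unfolding C_def
    using continuous_section_s[OF bW] by (intro image_compactin[of "subtopology X (s ` ?W)"]) (auto simp: compactin_subtopology)
  then have "compactin (gtop G) C" "C \<subseteq> ?W" by (auto simp: compactin_subtopology)
  moreover have "conv G f1 f2 g = 0" if g: "g \<notin> C" for g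
  proof (cases "g \<in> ?W")
    case True
    then obtain a b where ab: "g = gmult G a b" "a \<in> W1" "b \<in> W2" "s a = t b" by (auto simp: sprod_def)
    have arr: "a \<in> arrows G" "b \<in> arrows G" using ab W1 W2 bis_arrows by auto
    have "a \<notin> C1 \<or> b \<notin> C2"
    proof (rule ccontr)
      assume "\<not> ?thesis"
      then have "a \<in> C1" "b \<in> C2" by auto
      then have "b \<in> D" using ab(4) arr by (auto simp: D_def topspace_gtop intro!: image_eqI[of _ _ a])
      moreover have "s g = s b" using ab arr by (simp add: s_mult)
      moreover have "inv_into ?W s (s g) = g" using True bW by (simp add: bis_def)
      ultimately have "g \<in> C" unfolding C_def image_image by (intro image_eqI[of _ _ b]) auto
      then show False using g by simp
    qed
    then have "f1 a * f2 b = 0" using C1(3)[of a] C2(3)[of b] by auto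
    then show ?thesis using conv_sprod(1)[OF W1(1) z(1) W2(1) z(2)] ab by simp
  next
    case False
    then show ?thesis using conv_sprod(2)[OF W1(1) z(1) W2(1) z(2)] by simp
  qed
  ultimately show ?thesis unfolding slice_fun_def by (intro conjI exI[of _ C]) (simp_all add: fc)
qed

lemma conv_Cc:
  assumes "f \<in> Cc G" "h \<in> Cc G" shows "conv G f h \<in> Cc G"
  using assms(1)
proof (induction rule: Cc_induct)
  case (slice W f)
  have f: "f \<in> Cc G" using slice slice_fun_Cc bis_BB by blast
  from \<open>h \<in> Cc G\<close> show ?case
  proof (induction rule: Cc_induct)
    case (slice W' h)
    then show ?case
      using \<open>W \<in> BB\<close> \<open>slice_fun W f\<close> by (intro slice_fun_Cc[OF bis_sprod slice_fun_conv] bis_BB)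
  qed (simp_all add: conv_zero Cc_zero conv_add_right f Cc_add)
qed (simp_all add: conv_zero Cc_zero conv_add_left Cc_add)

text \<open>The third factor is arbitrary, so the identity also expresses multiplicativity of the
  regular representations. For slices each side has at most one term, and the cases record where a
  factorisation through \<open>W\<close> and \<open>W'\<close> breaks off.\<close>

lemma conv_assoc:
  assumes "f \<in> Cc G" "h \<in> Cc G"
  shows "conv G (conv G f h) \<xi> = conv G f (conv G h \<xi>)"
  using assms(1)
proof (induction rule: Cc_induct)
  case (slice W f)
  note W = \<open>W \<in> BB\<close> \<open>slice_fun W f\<close>
  have f: "f \<in> Cc G" using slice slice_fun_Cc bis_BB by blast
  from \<open>h \<in> Cc G\<close> show ?case
  proof (induction rule: Cc_induct)
    case (slice W' h)
    have bW: "bis W" "bis W'" using slice W bis_BB by auto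
    note z = slice_fun_zero[OF W(2)] slice_fun_zero[OF slice(2)]
    note cs = conv_sprod[OF bW(1) z(1) bW(2) z(2)]
    show ?case
    proof
      fix g
      consider "g \<notin> arrows G" | "g \<in> arrows G" "t g \<notin> t ` W"
        | a where "g \<in> arrows G" "a \<in> W" "t a = t g" "s a \<notin> t ` W'"
        | a b where "g \<in> arrows G" "a \<in> W" "t a = t g" "b \<in> W'" "s a = t b"
        by (metis (no_types, lifting) imageE)
      then show "conv G (conv G f h) \<xi> g = conv G f (conv G h \<xi>) g"
      proof cases
        case 1
        then show ?thesis by (simp add: conv_outside)
      next
        case 2
        have "t g \<notin> t ` sprod W W'"
          using 2 bis_arrows[OF bW(1)] bis_arrows[OF bW(2)] by (auto simp: sprod_def t_mult)
        then show ?thesis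
          using 2 conv_slice_0[where f = f, OF bW(1) z(1)] conv_slice_0[where f = "conv G f h", OF bis_sprod[OF bW] cs(2)] by simp
      next
        case (3 a)
        have arr: "a \<in> arrows G" using 3 bW bis_arrows by blast
        have "t g \<notin> t ` sprod W W'"
        proof
          assume "t g \<in> t ` sprod W W'"
          then obtain a' b' where "a' \<in> W" "b' \<in> W'" "s a' = t b'" "t g = t (gmult G a' b')"
            by (auto simp: sprod_def)
          moreover from this have "t a' = t a"
            using 3 bis_arrows[OF bW(1)] bis_arrows[OF bW(2)] by (simp add: t_mult)
          ultimately have "a' = a" using 3 bW by (auto simp: bis_def inj_on_def)
          then show False using 3 \<open>b' \<in> W'\<close> \<open>s a' = t b'\<close> by auto
        qed
        then have "conv G (conv G f h) \<xi> g = 0" using conv_slice_0[where f = "conv G f h", OF bis_sprod[OF bW] cs(2)] by simp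
        moreover have "conv G h \<xi> (gmult G (ginv G a) g) = 0"
          using 3 arr by (intro conv_slice_0[where f = h, OF bW(2) z(2)]) (simp_all add: div_closed)
        ultimately show ?thesis using conv_slice[OF bW(1) z(1), where a = a and g = g] 3 by simp
      next
        case (4 a b)
        have arr: "a \<in> arrows G" "b \<in> arrows G" using 4 bW bis_arrows by auto
        have "conv G (conv G f h) \<xi> g = conv G f h (gmult G a b) * \<xi> (gmult G (ginv G (gmult G a b)) g)"
          using 4 arr by (intro conv_slice[OF bis_sprod[OF bW] cs(2)] sprodI) (auto simp: t_mult)
        also have "\<dots> = f a * h b * \<xi> (gmult G (ginv G b) (gmult G (ginv G a) g))"
          using 4 arr cs(1) by (simp add: inv_mult_mult)
        also have "\<dots> = f a * conv G h \<xi> (gmult G (ginv G a) g)"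
          using 4 arr conv_slice[OF bW(2) z(2), where a = b and g = "gmult G (ginv G a) g"] by (simp add: div_closed)
        also have "\<dots> = conv G f (conv G h \<xi>) g"
          using 4 arr conv_slice[OF bW(1) z(1), where a = a and g = g] by simp
        finally show ?thesis .
      qed
    qed
  qed (simp_all add: conv_zero Cc_zero conv_add_right conv_add_left f conv_Cc)
qed (simp_all add: conv_zero Cc_zero conv_add_left conv_Cc assms)

lemma involution_zero [simp]: "involution G (\<lambda>_. 0) = (\<lambda>_. 0)"
  by (simp add: involution_def fun_eq_iff)

lemma involution_add: "involution G (\<lambda>g. f g + h g) = (\<lambda>g. involution G f g + involution G h g)"
  by (simp add: involution_def fun_eq_iff)

lemma slice_fun_involution:
  assumes "bis W" "slice_fun W f" shows "slice_fun (ginv G ` W) (involution G f)"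
proof -
  let ?W = "ginv G ` W"
  obtain C where C: "compactin (gtop G) C" "C \<subseteq> W" "\<And>g. g \<notin> C \<Longrightarrow> f g = 0"
    using assms by (auto simp: slice_fun_def)
  have bW: "bis ?W" using assms bis_inv by simp
  have "continuous_map (subtopology (gtop G) ?W) (subtopology (gtop G) W) (ginv G)"
    unfolding continuous_map_in_subtopology using continuous_map_on_bis[OF continuous_inv]
    by (auto simp: inv_inv bis_arrows[OF assms(1)])
  then have "continuous_map (subtopology (gtop G) ?W) euclidean (f \<circ> ginv G)"
    using assms(2) continuous_map_compose by (auto simp: slice_fun_def)
  then have "continuous_map (subtopology (gtop G) ?W) euclidean (cnj \<circ> (f \<circ> ginv G))"
    by (rule continuous_map_compose) (auto intro!: continuous_intros)
  then have "continuous_map (subtopology (gtop G) ?W) euclidean (involution G f)"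
    by (rule continuous_map_eq) (auto simp: involution_def topspace_gtop)
  moreover have "compactin (gtop G) (ginv G ` C)" using C(1) continuous_inv by (rule image_compactin)
  moreover have "involution G f g = 0" if "g \<notin> ginv G ` C" for g
  proof (cases "g \<in> arrows G")
    case True
    then have "ginv G g \<notin> C" using that inv_inv by (metis imageI)
    then show ?thesis using C by (simp add: involution_def)
  qed (simp add: involution_def)
  ultimately show ?thesis unfolding slice_fun_def
    using C(2) by (intro conjI exI[of _ "ginv G ` C"]) (simp_all add: image_mono)
qed

lemma involution_Cc: "f \<in> Cc G \<Longrightarrow> involution G f \<in> Cc G"
proof (induction rule: Cc_induct)
  case (slice W f)
  then show ?case by (intro slice_fun_Cc[OF bis_inv slice_fun_involution] bis_BB)
qed (simp_all add: Cc_zero involution_add Cc_add)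

end

subsection \<open>The reduced norm\<close>

context slice_groupoid
begin

section \<open>Boundedness of the regular representations\<close>

definition fib :: "'x \<Rightarrow> 'g set" where
  "fib x = {a \<in> arrows G. s a = x}"

lemma conv_fib_zero:
  assumes "f \<in> Cc G" "\<xi> \<in> ell2 (fib x)" "g \<notin> fib x"
  shows "conv G f \<xi> g = 0"
proof (cases "g \<in> arrows G")
  case True
  have "rsum f (\<lambda>a. \<xi> (gmult G (ginv G a) g)) (t g) = rsum f (\<lambda>a. 0) (t g)"
    using assms(2,3) True by (intro rsum_cong) (auto simp: ell2_def fib_def div_closed)
  then show ?thesis
    using True assms(1) by (simp add: conv_eq_rsum Cc_fibre_finite) (simp add: rsum_def)
qed (simp add: conv_outside)

text \<open>A function on a bisection acts as a weighted partial permutation of the fibre: the value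
  at g comes from a^-1 g for the unique a in \<open>W\<close> with the range of g, and g is
  recovered from a^-1 g. Hence a bound on the function bounds the operator.\<close>

lemma conv_slice_bound:
  assumes W: "bis W" "\<And>g. g \<notin> W \<Longrightarrow> f g = 0" and M: "\<And>g. cmod (f g) \<le> M" and "f \<in> Cc G"
    and \<xi>: "\<xi> \<in> ell2 (fib x)"
  shows "conv G f \<xi> \<in> ell2 (fib x)" "ell2_norm (fib x) (conv G f \<xi>) \<le> M * ell2_norm (fib x) \<xi>"
proof -
  have M0: "0 \<le> M" using M[of undefined] norm_ge_zero order_trans by blast
  define j where "j g = gmult G (ginv G (inv_into W t (t g))) g" for g
  have bound: "L2_set (\<lambda>g. cmod (conv G f \<xi> g)) F \<le> M * ell2_norm (fib x) \<xi>"
    if F: "finite F" "F \<subseteq> fib x" for F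
  proof -
    define F' where "F' = {g \<in> F. t g \<in> t ` W}"
    have F': "finite F'" "F' \<subseteq> F" using F by (auto simp: F'_def)
    have sec: "inv_into W t (t g) \<in> W" "inv_into W t (t g) \<in> arrows G" "t (inv_into W t (t g)) = t g"
      "g \<in> arrows G" "s g = x" if "g \<in> F'" for g
      using that F(2) W(1) bis_arrows[OF W(1)] by (auto simp: F'_def fib_def bis_def)
    have inj: "inj_on j F'"
    proof (rule inj_onI)
      fix g h assume gh: "g \<in> F'" "h \<in> F'" "j g = j h"
      let ?a = "inv_into W t (t g)" and ?b = "inv_into W t (t h)"
      have "s ?a = t (j g)" "s ?b = t (j h)" using sec[OF gh(1)] sec[OF gh(2)] by (simp_all add: j_def div_closed)
      then have eq: "s ?a = s ?b" using gh(3) by simp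
      have "inj_on s W" using W(1) by (simp add: bis_def)
      then have "?a = ?b" using eq sec(1)[OF gh(1)] sec(1)[OF gh(2)] by (rule inj_onD)
      have "g = gmult G ?a (j g)" using sec[OF gh(1)] by (simp add: j_def mult_inv_cancel)
      also have "\<dots> = gmult G ?b (j h)" by (simp only: \<open>?a = ?b\<close> gh(3))
      also have "\<dots> = h" using sec[OF gh(2)] by (simp add: j_def mult_inv_cancel)
      finally show "g = h" .
    qed
    have jF: "j ` F' \<subseteq> fib x" using sec by (auto simp: j_def fib_def div_closed)
    have zero: "conv G f \<xi> g = 0" if "g \<in> F - F'" for g
      using that conv_slice_0[where f = f, OF W] by (auto simp: F'_def)
    have "(\<Sum>g\<in>F. (cmod (conv G f \<xi> g))\<^sup>2) = (\<Sum>g\<in>F'. (cmod (conv G f \<xi> g))\<^sup>2)"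
      using F F' zero by (intro sum.mono_neutral_right) auto
    also have "\<dots> = (\<Sum>g\<in>F'. (cmod (f (inv_into W t (t g)) * \<xi> (j g)))\<^sup>2)"
    proof (rule sum.cong[OF refl])
      fix g assume "g \<in> F'"
      then show "(cmod (conv G f \<xi> g))\<^sup>2 = (cmod (f (inv_into W t (t g)) * \<xi> (j g)))\<^sup>2"
        using conv_slice[where f = f and a = "inv_into W t (t g)" and g = g, OF W] sec[of g]
        by (simp add: j_def)
    qed
    also have "\<dots> \<le> (\<Sum>g\<in>F'. M\<^sup>2 * (cmod (\<xi> (j g)))\<^sup>2)"
      using M by (intro sum_mono) (auto simp: norm_mult power_mult_distrib intro!: mult_right_mono power_mono)
    also have "\<dots> = M\<^sup>2 * (\<Sum>h\<in>j ` F'. (cmod (\<xi> h))\<^sup>2)"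
      using inj by (simp add: sum.reindex sum_distrib_left)
    finally have "L2_set (\<lambda>g. cmod (conv G f \<xi> g)) F \<le> M * L2_set (\<lambda>g. cmod (\<xi> g)) (j ` F')"
      unfolding L2_set_def using M0 real_sqrt_le_mono by (fastforce simp: real_sqrt_mult)
    also have "\<dots> \<le> M * ell2_norm (fib x) \<xi>"
      using M0 \<xi> F' jF by (intro mult_left_mono L2_set_le_ell2_norm) auto
    finally show ?thesis .
  qed
  have z: "conv G f \<xi> g = 0" if "g \<notin> fib x" for g
    using conv_fib_zero[OF \<open>f \<in> Cc G\<close> \<xi> that] .
  show "conv G f \<xi> \<in> ell2 (fib x)" "ell2_norm (fib x) (conv G f \<xi>) \<le> M * ell2_norm (fib x) \<xi>"
    using ell2_boundI[of "fib x" "conv G f \<xi>", OF z _ bound] M0 by auto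
qed

lemma slice_fun_bounded:
  assumes "slice_fun W f" shows "\<exists>M. \<forall>g. cmod (f g) \<le> M"
proof -
  obtain C where C: "compactin (gtop G) C" "C \<subseteq> W" "\<And>g. g \<notin> C \<Longrightarrow> f g = 0"
    and fc: "continuous_map (subtopology (gtop G) W) euclidean f"
    using assms by (auto simp: slice_fun_def)
  have "compactin (subtopology (gtop G) W) C" using C by (simp add: compactin_subtopology)
  then have "compactin euclidean (f ` C)" using fc by (rule image_compactin)
  then have "bounded (f ` C)" by (simp add: compact_imp_bounded)
  then obtain M where "M > 0" "\<And>z. z \<in> f ` C \<Longrightarrow> cmod z \<le> M" unfolding bounded_pos by blast
  then have "cmod (f g) \<le> M" for g using C(3)[of g] by (cases "g \<in> C") auto
  then show ?thesis by blast
qed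

text \<open>A crude bound, uniform in \<open>x\<close>; it ensures that the suprema defining the
  reduced norm are taken over bounded sets.\<close>

lemma conv_bounded:
  assumes "f \<in> Cc G"
  shows "\<exists>M\<ge>0. \<forall>x. \<forall>\<xi>\<in>ell2 (fib x).
    conv G f \<xi> \<in> ell2 (fib x) \<and> ell2_norm (fib x) (conv G f \<xi>) \<le> M * ell2_norm (fib x) \<xi>"
  using assms
proof (induction rule: Cc_induct)
  case zero
  then show ?case by (auto simp: conv_zero)
next
  case (slice W f)
  have W: "bis W" using slice bis_BB by blast
  obtain M where M: "\<And>g. cmod (f g) \<le> M" using slice_fun_bounded[OF slice(2)] by blast
  have "0 \<le> M" using M[of undefined] norm_ge_zero order_trans by blast
  then show ?case
    using conv_slice_bound[OF W slice_fun_zero[OF slice(2)] M slice_fun_Cc[OF W slice(2)]] by blast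
next
  case (add f h)
  obtain M where M: "M \<ge> 0" "\<And>x \<xi>. \<xi> \<in> ell2 (fib x) \<Longrightarrow> conv G f \<xi> \<in> ell2 (fib x)"
    "\<And>x \<xi>. \<xi> \<in> ell2 (fib x) \<Longrightarrow> ell2_norm (fib x) (conv G f \<xi>) \<le> M * ell2_norm (fib x) \<xi>"
    using add.IH(1) by blast
  obtain N where N: "N \<ge> 0" "\<And>x \<xi>. \<xi> \<in> ell2 (fib x) \<Longrightarrow> conv G h \<xi> \<in> ell2 (fib x)"
    "\<And>x \<xi>. \<xi> \<in> ell2 (fib x) \<Longrightarrow> ell2_norm (fib x) (conv G h \<xi>) \<le> N * ell2_norm (fib x) \<xi>"
    using add.IH(2) by blast
  have "conv G (\<lambda>g. f g + h g) \<xi> \<in> ell2 (fib x) \<and>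
    ell2_norm (fib x) (conv G (\<lambda>g. f g + h g) \<xi>) \<le> (M + N) * ell2_norm (fib x) \<xi>"
    if "\<xi> \<in> ell2 (fib x)" for x \<xi>
    using ell2_add[OF M(2)[OF that] N(2)[OF that]] M(3)[OF that] N(3)[OF that]
    by (simp add: conv_add_left[OF add(1,2)] distrib_right)
  then show ?case using M(1) N(1) by (intro exI[of _ "M + N"]) auto
qed

lemma conv_ell2: "f \<in> Cc G \<Longrightarrow> \<xi> \<in> ell2 (fib x) \<Longrightarrow> conv G f \<xi> \<in> ell2 (fib x)"
  using conv_bounded by blast

lemma src_fibre_unit: "x \<in> topspace X \<Longrightarrow> src_fibre G (e x) = fib x"
  by (simp add: src_fibre_eq fib_def)

lemma regular_rep_norm_le:
  assumes "f \<in> Cc G" "x \<in> topspace X" "0 \<le> M"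
    and "\<And>\<xi>. \<xi> \<in> ell2 (fib x) \<Longrightarrow> ell2_norm (fib x) (conv G f \<xi>) \<le> M * ell2_norm (fib x) \<xi>"
  shows "regular_rep_norm G (e x) f \<le> M"
  unfolding regular_rep_norm_def src_fibre_unit[OF assms(2)]
proof (rule cSup_least)
  show "{ell2_norm (fib x) (conv G f \<xi>) |\<xi>. \<xi> \<in> ell2 (fib x) \<and> ell2_norm (fib x) \<xi> \<le> 1} \<noteq> {}"
    by (auto intro!: exI[of _ "\<lambda>_. 0"])
  fix y assume "y \<in> {ell2_norm (fib x) (conv G f \<xi>) |\<xi>. \<xi> \<in> ell2 (fib x) \<and> ell2_norm (fib x) \<xi> \<le> 1}"
  then obtain \<xi> where \<xi>: "y = ell2_norm (fib x) (conv G f \<xi>)" "\<xi> \<in> ell2 (fib x)" "ell2_norm (fib x) \<xi> \<le> 1"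
    by blast
  have "y \<le> M * ell2_norm (fib x) \<xi>" using \<xi> assms(4) by simp
  also have "\<dots> \<le> M * 1" using \<xi> assms(3) by (intro mult_left_mono) auto
  finally show "y \<le> M" by simp
qed

lemma reduced_norm_le:
  assumes "f \<in> Cc G" "0 \<le> M"
    and "\<And>x \<xi>. x \<in> topspace X \<Longrightarrow> \<xi> \<in> ell2 (fib x) \<Longrightarrow> ell2_norm (fib x) (conv G f \<xi>) \<le> M * ell2_norm (fib x) \<xi>"
  shows "reduced_norm G f \<le> M"
  unfolding reduced_norm_def units_eq
  by (rule cSup_least) (use assms regular_rep_norm_le in auto)

text \<open>By \<open>conv_bounded\<close> the suprema are genuine upper bounds; the estimate for an
  arbitrary vector follows by scaling it into the unit ball.\<close>

lemma
  assumes "f \<in> Cc G"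
  shows reduced_norm_nonneg: "0 \<le> reduced_norm G f"
    and conv_le_reduced_norm: "x \<in> topspace X \<Longrightarrow> \<xi> \<in> ell2 (fib x) \<Longrightarrow>
      ell2_norm (fib x) (conv G f \<xi>) \<le> reduced_norm G f * ell2_norm (fib x) \<xi>"
proof -
  obtain M where M: "M \<ge> 0"
    "\<And>x \<xi>. \<xi> \<in> ell2 (fib x) \<Longrightarrow> ell2_norm (fib x) (conv G f \<xi>) \<le> M * ell2_norm (fib x) \<xi>"
    using conv_bounded[OF assms] by blast
  have bdd: "bdd_above (insert 0 ((\<lambda>u. regular_rep_norm G u f) ` units G))"
    unfolding units_eq
    by (rule bdd_aboveI[of _ M]) (use M regular_rep_norm_le[OF assms] in auto)
  show "0 \<le> reduced_norm G f" unfolding reduced_norm_def by (rule cSup_upper[OF _ bdd]) simp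
  assume x: "x \<in> topspace X" and \<xi>: "\<xi> \<in> ell2 (fib x)"
  show "ell2_norm (fib x) (conv G f \<xi>) \<le> reduced_norm G f * ell2_norm (fib x) \<xi>"
  proof (cases "ell2_norm (fib x) \<xi> = 0")
    case True
    then show ?thesis using M(2)[OF \<xi>] by simp
  next
    case False
    define n where "n = ell2_norm (fib x) \<xi>"
    have n: "n > 0" using False ell2_norm_nonneg[of "fib x" \<xi>] by (simp add: n_def less_le)
    define \<eta> where "\<eta> = (\<lambda>g. complex_of_real (1/n) * \<xi> g)"
    have \<eta>: "\<eta> \<in> ell2 (fib x)" "ell2_norm (fib x) \<eta> \<le> 1"
      using ell2_scale[OF \<xi>, of "complex_of_real (1/n)"] n by (simp_all add: \<eta>_def norm_divide flip: n_def)
    have bdd': "bdd_above {ell2_norm (fib x) (conv G f \<xi>) |\<xi>. \<xi> \<in> ell2 (fib x) \<and> ell2_norm (fib x) \<xi> \<le> 1}"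
    proof (rule bdd_aboveI[of _ M])
      fix y assume "y \<in> {ell2_norm (fib x) (conv G f \<xi>) |\<xi>. \<xi> \<in> ell2 (fib x) \<and> ell2_norm (fib x) \<xi> \<le> 1}"
      then obtain \<xi> where "y = ell2_norm (fib x) (conv G f \<xi>)" "\<xi> \<in> ell2 (fib x)" "ell2_norm (fib x) \<xi> \<le> 1" by blast
      then show "y \<le> M" using M(2)[of \<xi> x] mult_left_mono[of "ell2_norm (fib x) \<xi>" 1 M] M(1) by simp
    qed
    have "ell2_norm (fib x) (conv G f \<eta>) \<le> regular_rep_norm G (e x) f"
      unfolding regular_rep_norm_def src_fibre_unit[OF x] using \<eta> by (intro cSup_upper[OF _ bdd']) blast
    also have "\<dots> \<le> reduced_norm G f"
      unfolding reduced_norm_def using x by (intro cSup_upper[OF _ bdd]) (auto simp: units_eq)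
    finally have "ell2_norm (fib x) (conv G f \<xi>) / n \<le> reduced_norm G f"
      unfolding \<eta>_def conv_scale_right[OF assms] ell2_scale(2)[OF conv_ell2[OF assms \<xi>]]
      using n by (simp add: norm_divide)
    then show ?thesis using n by (simp add: n_def pos_divide_le_eq)
  qed
qed

lemma reduced_norm_add:
  assumes "f \<in> Cc G" "h \<in> Cc G"
  shows "reduced_norm G (\<lambda>g. f g + h g) \<le> reduced_norm G f + reduced_norm G h"
proof (rule reduced_norm_le[OF Cc_add[OF assms]])
  fix x \<xi> assume x: "x \<in> topspace X" "\<xi> \<in> ell2 (fib x)"
  show "ell2_norm (fib x) (conv G (\<lambda>g. f g + h g) \<xi>) \<le> (reduced_norm G f + reduced_norm G h) * ell2_norm (fib x) \<xi>"
    using ell2_add(2)[OF conv_ell2[OF assms(1) x(2)] conv_ell2[OF assms(2) x(2)]]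
      conv_le_reduced_norm[OF assms(1) x] conv_le_reduced_norm[OF assms(2) x]
    by (simp add: conv_add_left[OF assms] distrib_right)
qed (simp add: reduced_norm_nonneg assms)

lemma reduced_norm_scale_le:
  assumes "f \<in> Cc G"
  shows "reduced_norm G (\<lambda>g. c * f g) \<le> cmod c * reduced_norm G f"
proof (rule reduced_norm_le[OF Cc_scale[OF assms]])
  fix x \<xi> assume x: "x \<in> topspace X" "\<xi> \<in> ell2 (fib x)"
  show "ell2_norm (fib x) (conv G (\<lambda>g. c * f g) \<xi>) \<le> cmod c * reduced_norm G f * ell2_norm (fib x) \<xi>"
    using ell2_scale(2)[OF conv_ell2[OF assms x(2)]] conv_le_reduced_norm[OF assms x]
    by (simp add: conv_scale_left[OF assms] mult.assoc mult_left_mono)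
qed (simp add: reduced_norm_nonneg assms)

lemma reduced_norm_conv:
  assumes "f \<in> Cc G" "h \<in> Cc G"
  shows "reduced_norm G (conv G f h) \<le> reduced_norm G f * reduced_norm G h"
proof (rule reduced_norm_le[OF conv_Cc[OF assms]])
  fix x \<xi> assume x: "x \<in> topspace X" "\<xi> \<in> ell2 (fib x)"
  have "ell2_norm (fib x) (conv G f (conv G h \<xi>)) \<le> reduced_norm G f * ell2_norm (fib x) (conv G h \<xi>)"
    by (intro conv_le_reduced_norm assms conv_ell2 x)
  also have "\<dots> \<le> reduced_norm G f * (reduced_norm G h * ell2_norm (fib x) \<xi>)"
    by (intro mult_left_mono conv_le_reduced_norm reduced_norm_nonneg assms x)
  finally show "ell2_norm (fib x) (conv G (conv G f h) \<xi>) \<le> reduced_norm G f * reduced_norm G h * ell2_norm (fib x) \<xi>"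
    by (simp add: conv_assoc[OF assms] mult.assoc)
qed (simp add: reduced_norm_nonneg assms)

text \<open>Left multiplication by the slice, \<open>j\<close>, maps the arrows of the fibre
  starting at sources of \<open>W\<close> bijectively to those starting at ranges of
  \<open>W\<close>, where "starting" refers to the range map. Reindexing along \<open>j\<close>
  carries one inner product into the other, and off these two sets the convolutions vanish.\<close>

lemma conv_adjoint_slice:
  assumes W: "W \<in> BB" "slice_fun W f" and "\<xi> \<in> ell2 (fib x)" "\<eta> \<in> ell2 (fib x)"
  shows "ell2_inner (fib x) (conv G (involution G f) \<xi>) \<eta> = ell2_inner (fib x) \<xi> (conv G f \<eta>)"
proof -
  have bW: "bis W" using W bis_BB by blast
  have bV: "bis (ginv G ` W)" using bis_inv[OF bW] .
  note zW = slice_fun_zero[OF W(2)]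
  note zV = slice_fun_zero[OF slice_fun_involution[OF bW W(2)]]
  define A where "A = {g \<in> fib x. t g \<in> s ` W}"
  define B where "B = {g \<in> fib x. t g \<in> t ` W}"
  define j where "j g = gmult G (inv_into W s (t g)) g" for g
  have sec: "inv_into W s (t g) \<in> W" "inv_into W s (t g) \<in> arrows G" "s (inv_into W s (t g)) = t g"
    "g \<in> arrows G" "s g = x" if "g \<in> A" for g
    using that bW bis_arrows[OF bW] by (auto simp: A_def fib_def bis_def)
  have bij: "bij_betw j A B"
  proof (rule bij_betwI[where g = "\<lambda>g. gmult G (ginv G (inv_into W t (t g))) g"])
    have "t (j g) = t (inv_into W s (t g))" if "g \<in> A" for g using sec[OF that] by (simp add: j_def t_mult)
    then show "j \<in> A \<rightarrow> B" using sec by (auto simp: B_def fib_def j_def mult_closed s_mult)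
    show "(\<lambda>g. gmult G (ginv G (inv_into W t (t g))) g) \<in> B \<rightarrow> A"
    proof
      fix g assume "g \<in> B"
      then obtain a where "a \<in> W" "t g = t a" "g \<in> arrows G" "s g = x" by (auto simp: B_def fib_def)
      moreover from this have "inv_into W t (t g) = a" "a \<in> arrows G" using bW bis_arrows by (auto simp: bis_def)
      ultimately show "gmult G (ginv G (inv_into W t (t g))) g \<in> A" by (auto simp: A_def fib_def div_closed)
    qed
    show "gmult G (ginv G (inv_into W t (t (j g)))) (j g) = g" if "g \<in> A" for g
    proof -
      have "t (j g) = t (inv_into W s (t g))" using sec[OF that] by (simp add: j_def t_mult)
      then have "inv_into W t (t (j g)) = inv_into W s (t g)" using sec[OF that] bW by (simp add: bis_def)
      then show ?thesis using sec[OF that] by (simp add: j_def inv_mult_cancel)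
    qed
    show "j (gmult G (ginv G (inv_into W t (t g))) g) = g" if g: "g \<in> B" for g
    proof -
      obtain a where a: "a \<in> W" "t a = t g" "g \<in> arrows G" "s g = x" using g by (auto simp: B_def fib_def)
      have "inv_into W t (t g) = a" "inv_into W s (s a) = a" "a \<in> arrows G"
        using inv_into_f_f[of t W a] inv_into_f_f[of s W a] a bW bis_arrows[OF bW] by (simp_all add: bis_def)
      then show ?thesis using a by (simp add: j_def div_closed mult_inv_cancel)
    qed
  qed
  have l: "conv G (involution G f) \<xi> g = cnj (f (inv_into W s (t g))) * \<xi> (j g)" if "g \<in> A" for g
  proof -
    have "conv G (involution G f) \<xi> g =
        involution G f (ginv G (inv_into W s (t g))) * \<xi> (gmult G (ginv G (ginv G (inv_into W s (t g)))) g)"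
      using sec[OF that] by (intro conv_slice[OF bV zV]) (auto simp: t_inv)
    then show ?thesis using sec[OF that] by (simp add: involution_def inv_closed inv_inv j_def)
  qed
  have r: "conv G f \<eta> (j g) = f (inv_into W s (t g)) * \<eta> g" if "g \<in> A" for g
  proof -
    have "conv G f \<eta> (j g) = f (inv_into W s (t g)) * \<eta> (gmult G (ginv G (inv_into W s (t g))) (j g))"
      using sec[OF that] by (intro conv_slice[OF bW zW]) (auto simp: j_def t_mult mult_closed)
    then show ?thesis using sec[OF that] by (simp add: j_def inv_mult_cancel)
  qed
  have l0: "conv G (involution G f) \<xi> g = 0" if "g \<in> fib x - A" for g
  proof (rule conv_slice_0[OF bV zV])
    show "t g \<notin> t ` ginv G ` W" using that bis_arrows[OF bW] by (auto simp: A_def t_inv image_iff)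
  qed
  have r0: "conv G f \<eta> g = 0" if "g \<in> fib x - B" for g
    by (rule conv_slice_0[OF bW zW]) (use that in \<open>auto simp: B_def\<close>)
  have "ell2_inner (fib x) (conv G (involution G f) \<xi>) \<eta> = (\<Sum>\<^sub>\<infinity>g\<in>A. conv G (involution G f) \<xi> g * cnj (\<eta> g))"
    unfolding ell2_inner_def by (rule infsum_cong_neutral) (auto simp: l0 A_def)
  also have "\<dots> = (\<Sum>\<^sub>\<infinity>g\<in>A. \<xi> (j g) * cnj (conv G f \<eta> (j g)))"
    by (rule infsum_cong) (simp add: l r)
  also have "\<dots> = (\<Sum>\<^sub>\<infinity>g\<in>B. \<xi> g * cnj (conv G f \<eta> g))"
    using bij by (rule infsum_reindex_bij_betw)
  also have "\<dots> = ell2_inner (fib x) \<xi> (conv G f \<eta>)"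
    unfolding ell2_inner_def by (rule infsum_cong_neutral) (auto simp: r0 B_def)
  finally show ?thesis .
qed

lemma conv_adjoint:
  assumes "f \<in> Cc G" "\<xi> \<in> ell2 (fib x)" "\<eta> \<in> ell2 (fib x)"
  shows "ell2_inner (fib x) (conv G (involution G f) \<xi>) \<eta> = ell2_inner (fib x) \<xi> (conv G f \<eta>)"
  using assms(1)
proof (induction rule: Cc_induct)
  case (slice W f)
  then show ?case using conv_adjoint_slice assms by blast
next
  case (add f h)
  then show ?case
    using assms by (simp add: involution_add conv_add_left involution_Cc ell2_inner_add conv_ell2)
qed (simp add: conv_zero ell2_inner_def)

text \<open>The standard bound for an adjoint: the squared norm of the image \<open>\<zeta>\<close>
  is an inner product of \<open>\<xi>\<close> with \<open>conv G f \<zeta>\<close>, and after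
  Cauchy-Schwarz one factor, the norm of \<open>\<zeta>\<close>, cancels unless it is 0.\<close>

lemma reduced_norm_involution:
  assumes "f \<in> Cc G"
  shows "reduced_norm G (involution G f) \<le> reduced_norm G f"
proof (rule reduced_norm_le[OF involution_Cc[OF assms]])
  fix x \<xi> assume x: "x \<in> topspace X" and \<xi>: "\<xi> \<in> ell2 (fib x)"
  define \<zeta> where "\<zeta> = conv G (involution G f) \<xi>"
  have \<zeta>: "\<zeta> \<in> ell2 (fib x)" unfolding \<zeta>_def by (intro conv_ell2 involution_Cc assms \<xi>)
  have "(ell2_norm (fib x) \<zeta>)\<^sup>2 = Re (ell2_inner (fib x) \<zeta> \<zeta>)" by (simp add: ell2_inner_self \<zeta>)
  also have "\<dots> = Re (ell2_inner (fib x) \<xi> (conv G f \<zeta>))"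
    using conv_adjoint[OF assms \<xi> \<zeta>] by (simp add: \<zeta>_def)
  also have "\<dots> \<le> cmod (ell2_inner (fib x) \<xi> (conv G f \<zeta>))" by (rule complex_Re_le_cmod)
  also have "\<dots> \<le> ell2_norm (fib x) \<xi> * ell2_norm (fib x) (conv G f \<zeta>)"
    by (intro ell2_Cauchy_Schwarz \<xi> conv_ell2 assms \<zeta>)
  also have "\<dots> \<le> ell2_norm (fib x) \<xi> * (reduced_norm G f * ell2_norm (fib x) \<zeta>)"
    by (intro mult_left_mono conv_le_reduced_norm assms x \<zeta>) simp
  finally have "ell2_norm (fib x) \<zeta> * ell2_norm (fib x) \<zeta> \<le> (reduced_norm G f * ell2_norm (fib x) \<xi>) * ell2_norm (fib x) \<zeta>"
    by (simp add: power2_eq_square mult.assoc mult.left_commute)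
  then show "ell2_norm (fib x) (conv G (involution G f) \<xi>) \<le> reduced_norm G f * ell2_norm (fib x) \<xi>"
    unfolding \<zeta>_def[symmetric] using ell2_norm_nonneg[of "fib x" \<zeta>] reduced_norm_nonneg[OF assms]
    by (metis ell2_norm_nonneg mult_nonneg_nonneg mult_right_le_imp_le order_le_less)
qed (simp add: reduced_norm_nonneg assms)

lemma Cc_diff: "f \<in> Cc G \<Longrightarrow> h \<in> Cc G \<Longrightarrow> (\<lambda>g. f g - h g) \<in> Cc G"
  using Cc_add[OF _ Cc_scale[of h G "-1"], of f] by simp

lemma adist_Cc: "adist (Cc_alg G) f h = reduced_norm G (\<lambda>g. f g - h g)"
  by (simp add: adist_def Cc_alg_def)

lemma reduced_norm_diff_sym:
  assumes "f \<in> Cc G" "h \<in> Cc G"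
  shows "reduced_norm G (\<lambda>g. f g - h g) \<le> reduced_norm G (\<lambda>g. h g - f g)"
  using reduced_norm_scale_le[OF Cc_diff[OF assms(2,1)], of "-1"] by simp

lemma conv_diff_left:
  assumes "f \<in> Cc G" "f' \<in> Cc G"
  shows "conv G (\<lambda>g. f g - f' g) h = (\<lambda>g. conv G f h g - conv G f' h g)"
  using conv_add_left[OF assms(1) Cc_scale[OF assms(2), of "-1"], of h] conv_scale_left[OF assms(2), of "-1" h]
  by (simp add: fun_eq_iff)

lemma conv_diff_right:
  assumes "f \<in> Cc G"
  shows "conv G f (\<lambda>g. h g - h' g) = (\<lambda>g. conv G f h g - conv G f h' g)"
  using conv_add_right[OF assms, of h "\<lambda>g. -1 * h' g"] conv_scale_right[OF assms, of "-1" h']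
  by (simp add: fun_eq_iff)

lemma pre_normed_star_alg_Cc: "pre_normed_star_alg (Cc_alg G)"
proof (unfold_locales, unfold adist_Cc, simp_all add: Cc_alg_def)
  fix a b a' b' d :: "'g \<Rightarrow> complex" and c
  assume a: "a \<in> Cc G"
  show "(\<lambda>g. c * a g) \<in> Cc G" using a by (rule Cc_scale)
  show "involution G a \<in> Cc G" using a by (rule involution_Cc)
  show "0 \<le> reduced_norm G a" using a by (rule reduced_norm_nonneg)
  show "reduced_norm G (\<lambda>g. 0) = 0"
    using reduced_norm_scale_le[OF Cc_zero, of 0] reduced_norm_nonneg[OF Cc_zero] by simp
  show "reduced_norm G (\<lambda>g. involution G a g - involution G a' g) \<le> reduced_norm G (\<lambda>g. a g - a' g)" if "a' \<in> Cc G"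
  proof -
    have "(\<lambda>g. involution G a g - involution G a' g) = involution G (\<lambda>g. a g - a' g)"
      by (simp add: involution_def fun_eq_iff)
    then show ?thesis using reduced_norm_involution[OF Cc_diff[OF a that]] by simp
  qed
  show "reduced_norm G (\<lambda>g. c * a g - c * a' g) \<le> cmod c * reduced_norm G (\<lambda>g. a g - a' g)" if "a' \<in> Cc G"
    using reduced_norm_scale_le[OF Cc_diff[OF a that], of c] by (simp add: right_diff_distrib)
  assume b: "b \<in> Cc G"
  show "(\<lambda>g. a g + b g) \<in> Cc G" using a b by (rule Cc_add)
  show "conv G a b \<in> Cc G" using a b by (rule conv_Cc)
  show "reduced_norm G (\<lambda>g. a g - b g) = reduced_norm G (\<lambda>g. b g - a g)"
    using reduced_norm_diff_sym a b by (intro antisym) auto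
  show "reduced_norm G (\<lambda>g. a g - d g) \<le> reduced_norm G (\<lambda>g. a g - b g) + reduced_norm G (\<lambda>g. b g - d g)"
    if "d \<in> Cc G"
    using reduced_norm_add[OF Cc_diff[OF a b] Cc_diff[OF b that]] by simp
  show "reduced_norm G a \<le> reduced_norm G b + reduced_norm G (\<lambda>g. a g - b g)"
    using reduced_norm_add[OF b Cc_diff[OF a b]] by simp
  assume a': "a' \<in> Cc G" and b': "b' \<in> Cc G"
  show "reduced_norm G (\<lambda>g. a g + b g - (a' g + b' g)) \<le> reduced_norm G (\<lambda>g. a g - a' g) + reduced_norm G (\<lambda>g. b g - b' g)"
    using reduced_norm_add[OF Cc_diff[OF a a'] Cc_diff[OF b b']] by (simp add: algebra_simps)
  have "(\<lambda>g. conv G a b g - conv G a' b' g) =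
      (\<lambda>g. conv G (\<lambda>g. a g - a' g) b g + conv G a' (\<lambda>g. b g - b' g) g)"
    by (simp add: conv_diff_left conv_diff_right a a')
  then have "reduced_norm G (\<lambda>g. conv G a b g - conv G a' b' g) \<le>
    reduced_norm G (conv G (\<lambda>g. a g - a' g) b) + reduced_norm G (conv G a' (\<lambda>g. b g - b' g))"
    using a b a' b' by (simp add: reduced_norm_add conv_Cc Cc_diff)
  also have "\<dots> \<le> reduced_norm G (\<lambda>g. a g - a' g) * reduced_norm G b + reduced_norm G a' * reduced_norm G (\<lambda>g. b g - b' g)"
    using a b a' b' by (intro add_mono reduced_norm_conv Cc_diff)
  finally show "reduced_norm G (\<lambda>g. conv G a b g - conv G a' b' g) \<le>
    reduced_norm G (\<lambda>g. a g - a' g) * reduced_norm G b + reduced_norm G a' * reduced_norm G (\<lambda>g. b g - b' g)" .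
qed

end

section \<open>Morphisms with a separating cocycle\<close>

text \<open>By \<open>pi_BB\<close> and preservation of sources \<pi> is a local homeomorphism, and
  \<open>c\<close> is a locally constant cocycle with values in Z^r. \<open>separating\<close> makes
  the cocycle injective on arrows with prescribed end points; in particular it embeds the kernel of
  \<pi> at each unit into Z^r.\<close>

locale slice_morphism =
  G: slice_groupoid X G s t e BB + H: slice_groupoid X H s' t' e' BB'
  for X :: "'x topology" and G :: "'g top_groupoid" and s t e BB
    and H :: "'h top_groupoid" and s' t' e' BB' +
  fixes \<pi> :: "'g \<Rightarrow> 'h" and c :: "'g \<Rightarrow> nat \<Rightarrow> int" and r :: nat
  assumes pi_closed: "a \<in> arrows G \<Longrightarrow> \<pi> a \<in> arrows H"
    and s_pi: "a \<in> arrows G \<Longrightarrow> s' (\<pi> a) = s a"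
    and t_pi: "a \<in> arrows G \<Longrightarrow> t' (\<pi> a) = t a"
    and pi_mult: "a \<in> arrows G \<Longrightarrow> b \<in> arrows G \<Longrightarrow> s a = t b \<Longrightarrow> \<pi> (gmult G a b) = gmult H (\<pi> a) (\<pi> b)"
    and pi_inv: "a \<in> arrows G \<Longrightarrow> \<pi> (ginv G a) = ginv H (\<pi> a)"
    and pi_BB: "W \<in> BB \<Longrightarrow> \<pi> ` W \<in> BB'"
    and c_BB: "W \<in> BB \<Longrightarrow> \<exists>z. \<forall>a\<in>W. c a = z"
    and c_mult: "a \<in> arrows G \<Longrightarrow> b \<in> arrows G \<Longrightarrow> s a = t b \<Longrightarrow> c (gmult G a b) j = c a j + c b j"
    and c_vanish: "a \<in> arrows G \<Longrightarrow> r \<le> j \<Longrightarrow> c a j = 0"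
    and separating: "a \<in> arrows G \<Longrightarrow> b \<in> arrows G \<Longrightarrow> s a = s b \<Longrightarrow> t a = t b \<Longrightarrow> c a = c b \<Longrightarrow> a = b"
begin

abbreviation "push \<equiv> fibre_sum G H \<pi>"

lemma c_unit: "a \<in> arrows G \<Longrightarrow> c (e (s a)) j = 0"
  using c_mult[of "e (t (ginv G a))" "ginv G a" j] G.unit_mult[of "ginv G a"]
    G.unit_closed[OF G.s_in] G.s_unit[OF G.s_in]
  by (simp add: G.inv_closed G.t_inv)

lemma c_inv: "a \<in> arrows G \<Longrightarrow> c (ginv G a) j = - c a j"
  using c_mult[of "ginv G a" a j] c_unit[of a j] by (simp add: G.inv_closed G.s_inv G.inv_mult)

lemma pi_unit: "x \<in> topspace X \<Longrightarrow> \<pi> (e x) = e' x"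
  using pi_mult[of "ginv G (e x)" "e x"] G.inv_mult[of "e x"] H.inv_mult[of "\<pi> (e x)"]
  by (simp add: G.unit_closed G.s_unit G.inv_closed G.s_inv pi_inv pi_closed s_pi)

section \<open>The pushforward along the morphism\<close>

lemma bis_image:
  assumes "G.bis W" shows "H.bis (\<pi> ` W)"
proof -
  have arr: "\<And>a. a \<in> W \<Longrightarrow> a \<in> arrows G" using G.bis_arrows[OF assms] .
  have "openin (gtop H) (\<pi> ` W)" unfolding H.openin_gtop_iff
  proof clarify
    fix a assume "a \<in> W"
    then obtain V where "V \<in> BB" "a \<in> V" "V \<subseteq> W" using assms G.openin_gtop_iff G.bis_def by metis
    then show "\<exists>V\<in>BB'. \<pi> a \<in> V \<and> V \<subseteq> \<pi> ` W" by (intro bexI[of _ "\<pi> ` V"]) (auto simp: pi_BB)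
  qed
  moreover have "inj_on s' (\<pi> ` W)" "inj_on t' (\<pi> ` W)"
    using assms arr by (auto simp: G.bis_def inj_on_def s_pi t_pi)
  ultimately show ?thesis by (simp add: H.bis_def)
qed

text \<open>As \<pi> preserves sources, it is injective on a bisection, and the fibre sum has at
  most one nonzero term.\<close>

lemma push_slice:
  assumes W: "G.bis W" "\<And>g. g \<notin> W \<Longrightarrow> f g = 0"
  shows "a \<in> W \<Longrightarrow> push f (\<pi> a) = f a" and "\<gamma> \<notin> \<pi> ` W \<Longrightarrow> push f \<gamma> = 0"
proof -
  assume a: "a \<in> W"
  have arr: "a \<in> arrows G" using a W G.bis_arrows by blast
  have "push f (\<pi> a) = (\<Sum>\<^sub>\<infinity>b\<in>{b \<in> arrows G. \<pi> b = \<pi> a}. f b)"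
    using arr by (simp add: fibre_sum_def pi_closed)
  also have "\<dots> = (\<Sum>\<^sub>\<infinity>b\<in>{a}. f b)"
  proof (rule infsum_cong_neutral)
    fix b assume b: "b \<in> {b \<in> arrows G. \<pi> b = \<pi> a} - {a}"
    then have "s b = s a" using s_pi arr by (metis (mono_tags, lifting) DiffD1 mem_Collect_eq)
    then have "b \<notin> W" using b a W(1) by (auto simp: G.bis_def inj_on_def)
    then show "f b = 0" by (rule W(2))
  qed (use arr in auto)
  finally show "push f (\<pi> a) = f a" by simp
next
  assume "\<gamma> \<notin> \<pi> ` W"
  then show "push f \<gamma> = 0" using W(2) by (auto simp: fibre_sum_def intro!: infsum_0)
qed

lemma push_add:
  assumes "f \<in> Cc G" "h \<in> Cc G"
  shows "push (\<lambda>g. f g + h g) = (\<lambda>\<gamma>. push f \<gamma> + push h \<gamma>)"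
proof
  fix \<gamma>
  have "f summable_on {g \<in> arrows G. \<pi> g = \<gamma>}" if "f \<in> Cc G" for f
  proof (rule finite_nonzero_values_imp_summable_on, rule finite_subset)
    show "{g \<in> {g \<in> arrows G. \<pi> g = \<gamma>}. f g \<noteq> 0} \<subseteq> {g \<in> arrows G. s g = s' \<gamma> \<and> f g \<noteq> 0}"
      using s_pi by auto
    show "finite {g \<in> arrows G. s g = s' \<gamma> \<and> f g \<noteq> 0}"
      using G.Cc_fibre_finite[OF that] by (simp add: G.fibre_finite_def)
  qed
  then show "push (\<lambda>g. f g + h g) \<gamma> = push f \<gamma> + push h \<gamma>"
    using assms by (simp add: fibre_sum_def infsum_add)
qed

lemma push_scale: "push (\<lambda>g. k * f g) = (\<lambda>\<gamma>. k * push f \<gamma>)"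
  by (simp add: fibre_sum_def fun_eq_iff infsum_cmult_right')

lemma push_zero: "push (\<lambda>_. 0) = (\<lambda>_. 0)"
  by (simp add: fibre_sum_def fun_eq_iff)

lemma slice_fun_push:
  assumes W: "G.bis W" "G.slice_fun W f" shows "H.slice_fun (\<pi> ` W) (push f)"
proof -
  obtain C where C: "compactin (gtop G) C" "C \<subseteq> W" "\<And>g. g \<notin> C \<Longrightarrow> f g = 0"
    and fc: "continuous_map (subtopology (gtop G) W) euclidean f"
    using assms by (auto simp: G.slice_fun_def)
  have arr: "\<And>a. a \<in> W \<Longrightarrow> a \<in> arrows G" using G.bis_arrows[OF W(1)] .
  note z = G.slice_fun_zero[OF W(2)]
  have bW: "H.bis (\<pi> ` W)" using bis_image W by blast
  have im: "s' ` \<pi> ` W = s ` W" using arr by (simp add: image_image s_pi)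
  have sec: "inv_into W s (s a) = a" "inv_into (\<pi> ` W) s' (s a) = \<pi> a" if "a \<in> W" for a
  proof -
    show "inv_into W s (s a) = a" using W(1) that by (simp add: G.bis_def)
    have "inv_into (\<pi> ` W) s' (s' (\<pi> a)) = \<pi> a"
      using bW that by (intro inv_into_f_f) (auto simp: H.bis_def)
    then show "inv_into (\<pi> ` W) s' (s a) = \<pi> a" using arr that by (simp add: s_pi)
  qed
  \<comment> \<open>On the image slice \<open>push f\<close> is the source map to \<open>X\<close>,
    followed by the section of \<open>s\<close> over \<open>W\<close> and by
    \<open>f\<close>.\<close>
  have "continuous_map (subtopology (gtop H) (\<pi> ` W)) (subtopology X (s ` W)) s'"
    unfolding continuous_map_in_subtopology using H.continuous_map_on_bis[OF H.continuous_s] arr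
    by (auto simp: s_pi)
  from continuous_map_compose[OF continuous_map_compose[OF this G.continuous_section_s[OF W(1)]] fc]
  have "continuous_map (subtopology (gtop H) (\<pi> ` W)) euclidean (f \<circ> (inv_into W s \<circ> s'))" .
  then have "continuous_map (subtopology (gtop H) (\<pi> ` W)) euclidean (push f)"
    by (rule continuous_map_eq) (auto simp: s_pi arr sec push_slice(1)[where f = f, OF W(1) z])
  moreover
  \<comment> \<open>The compact set is carried over through its sources in \<open>X\<close>, which
    are lifted again to the image slice.\<close>
  define D where "D = inv_into (\<pi> ` W) s' ` s ` C"
  have "compactin X (s ` C)" using C(1) G.continuous_s by (rule image_compactin)
  then have "compactin (subtopology (gtop H) (\<pi> ` W)) D" unfolding D_def
    using H.continuous_section_s[OF bW] C(2)
    by (intro image_compactin[of "subtopology X (s ` W)"]) (auto simp: compactin_subtopology im)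
  then have "compactin (gtop H) D" "D \<subseteq> \<pi> ` W" by (auto simp: compactin_subtopology)
  moreover have "push f \<gamma> = 0" if "\<gamma> \<notin> D" for \<gamma>
  proof (cases "\<gamma> \<in> \<pi> ` W")
    case True
    then obtain a where a: "a \<in> W" "\<gamma> = \<pi> a" by blast
    have "a \<notin> C"
    proof
      assume "a \<in> C"
      then have "\<pi> a \<in> D" unfolding D_def image_image using sec(2)[OF a(1)] by (intro image_eqI[of _ _ a]) auto
      then show False using that a by simp
    qed
    then show ?thesis using push_slice(1)[where f = f, OF W(1) z a(1)] C(3) a by simp
  next
    case False
    then show ?thesis using push_slice(2)[where f = f, OF W(1) z] by blast
  qed
  ultimately show ?thesis unfolding H.slice_fun_def by (intro conjI exI[of _ D]) simp_all
qed

lemma push_Cc: "f \<in> Cc G \<Longrightarrow> push f \<in> Cc H"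
proof (induction rule: G.Cc_induct)
  case (slice W f)
  then show ?case by (intro H.slice_fun_Cc[OF bis_image slice_fun_push] G.bis_BB)
qed (simp_all add: push_zero push_add Cc_zero Cc_add)

text \<open>Rewrites the regular representation of \<open>H\<close>, composed with
  \<open>push\<close>, as a sum over arrows of \<open>G\<close> that act through \<pi>. In this form
  it can be compared with \<open>skew\<close>.\<close>

lemma conv_push:
  assumes "f \<in> Cc G" "\<gamma> \<in> arrows H"
  shows "conv H (push f) \<xi> \<gamma> = G.rsum f (\<lambda>a. \<xi> (gmult H (ginv H (\<pi> a)) \<gamma>)) (t' \<gamma>)"
  using assms(1)
proof (induction rule: G.Cc_induct)
  case zero
  then show ?case by (simp add: push_zero H.conv_zero G.rsum_def)
next
  case (slice W f)
  have W: "G.bis W" using slice G.bis_BB by blast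
  note z = G.slice_fun_zero[OF slice(2)]
  have p: "\<And>a. a \<in> W \<Longrightarrow> push (f) (\<pi> a) = (f) a" "\<And>\<gamma>. \<gamma> \<notin> \<pi> ` W \<Longrightarrow> push (f) \<gamma> = 0"
    using push_slice[where f = f, OF W z] by blast+
  show ?case
  proof (cases "t' \<gamma> \<in> t ` W")
    case True
    then obtain a where a: "a \<in> W" "t' \<gamma> = t a" by blast
    have "t' (\<pi> a) = t' \<gamma>" using a G.bis_arrows[OF W] by (simp add: t_pi)
    then have "conv H (push f) \<xi> \<gamma> = push f (\<pi> a) * \<xi> (gmult H (ginv H (\<pi> a)) \<gamma>)"
      using a assms(2) by (intro H.conv_slice[OF bis_image[OF W] p(2)]) auto
    also have "\<dots> = G.rsum f (\<lambda>a. \<xi> (gmult H (ginv H (\<pi> a)) \<gamma>)) (t' \<gamma>)"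
      unfolding a(2) using G.rsum_slice[where f = f, OF W z a(1)] p(1)[OF a(1)] by simp
    finally show ?thesis .
  next
    case False
    then have "t' \<gamma> \<notin> t' ` \<pi> ` W" using G.bis_arrows[OF W] by (auto simp: t_pi image_image)
    then have "conv H (push f) \<xi> \<gamma> = 0" by (intro H.conv_slice_0[OF bis_image[OF W] p(2)])
    then show ?thesis using G.rsum_slice_0[where f = f, OF z False] by simp
  qed
next
  case (add f h)
  then show ?case
    by (simp add: push_add H.conv_add_left push_Cc G.rsum_add_left G.Cc_fibre_finite)
qed

text \<open>For slices, \<pi> maps the product bisection onto the product of the image bisections,
  and there both sides are the product of two single values.\<close>

lemma push_conv:
  assumes "f \<in> Cc G" "h \<in> Cc G"
  shows "push (conv G f h) = conv H (push f) (push h)"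
  using assms(1)
proof (induction rule: G.Cc_induct)
  case (slice W f)
  note W = slice
  have f: "f \<in> Cc G" using slice G.slice_fun_Cc G.bis_BB by blast
  from \<open>h \<in> Cc G\<close> show ?case
  proof (induction rule: G.Cc_induct)
    case (slice W' h)
    have bW: "G.bis W" "G.bis W'" using slice W G.bis_BB by auto
    have arr: "\<And>a. a \<in> W \<Longrightarrow> a \<in> arrows G" "\<And>a. a \<in> W' \<Longrightarrow> a \<in> arrows G"
      using bW G.bis_arrows by auto
    note z = G.slice_fun_zero[OF W(2)] G.slice_fun_zero[OF slice(2)]
    have cG: "\<And>a b. a \<in> W \<Longrightarrow> b \<in> W' \<Longrightarrow> s a = t b \<Longrightarrow> conv G f h (gmult G a b) = f a * h b"
      "\<And>g. g \<notin> G.sprod W W' \<Longrightarrow> conv G f h g = 0"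
      using G.conv_sprod[where ?f1.0 = f and ?f2.0 = h, OF bW(1) z(1) bW(2) z(2)] by blast+
    have p1: "\<And>a. a \<in> W \<Longrightarrow> push (f) (\<pi> a) = (f) a" "\<And>\<gamma>. \<gamma> \<notin> \<pi> ` W \<Longrightarrow> push (f) \<gamma> = 0"
      using push_slice[where f = f, OF bW(1) z(1)] by blast+
    have p2: "\<And>a. a \<in> W' \<Longrightarrow> push (h) (\<pi> a) = (h) a" "\<And>\<gamma>. \<gamma> \<notin> \<pi> ` W' \<Longrightarrow> push (h) \<gamma> = 0"
      using push_slice[where f = h, OF bW(2) z(2)] by blast+
    have cH: "\<And>a b. a \<in> \<pi> ` W \<Longrightarrow> b \<in> \<pi> ` W' \<Longrightarrow> s' a = t' b \<Longrightarrow>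
        conv H (push f) (push h) (gmult H a b) = push f a * push h b"
      "\<And>g. g \<notin> H.sprod (\<pi> ` W) (\<pi> ` W') \<Longrightarrow> conv H (push f) (push h) g = 0"
      using H.conv_sprod[where ?f1.0 = "push f" and ?f2.0 = "push h",
        OF bis_image[OF bW(1)] p1(2) bis_image[OF bW(2)] p2(2)] by blast+
    have p: "\<And>a. a \<in> G.sprod W W' \<Longrightarrow> push (conv G f h) (\<pi> a) = (conv G f h) a" "\<And>\<gamma>. \<gamma> \<notin> \<pi> ` G.sprod W W' \<Longrightarrow> push (conv G f h) \<gamma> = 0"
      using push_slice[where f = "conv G f h", OF G.bis_sprod[OF bW] cG(2)] by blast+
    show ?case
    proof
      fix \<gamma>
      show "push (conv G f h) \<gamma> = conv H (push f) (push h) \<gamma>"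
      proof (cases "\<gamma> \<in> \<pi> ` G.sprod W W'")
        case True
        then obtain a b where ab: "a \<in> W" "b \<in> W'" "s a = t b" "\<gamma> = \<pi> (gmult G a b)"
          by (auto simp: G.sprod_def)
        have "push (conv G f h) \<gamma> = f a * h b"
          using p(1)[OF G.sprodI[OF ab(1-3)]] cG(1)[OF ab(1-3)] ab(4) by simp
        moreover have "conv H (push f) (push h) (gmult H (\<pi> a) (\<pi> b)) = push f (\<pi> a) * push h (\<pi> b)"
          using ab arr by (intro cH(1)) (auto simp: s_pi t_pi)
        ultimately show ?thesis using ab arr p1(1) p2(1) by (simp add: pi_mult)
      next
        case False
        have "\<gamma> \<notin> H.sprod (\<pi> ` W) (\<pi> ` W')"
        proof
          assume "\<gamma> \<in> H.sprod (\<pi> ` W) (\<pi> ` W')"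
          then obtain a b where ab: "a \<in> W" "b \<in> W'" "s' (\<pi> a) = t' (\<pi> b)" "\<gamma> = gmult H (\<pi> a) (\<pi> b)"
            by (auto simp: H.sprod_def)
          then have "\<gamma> = \<pi> (gmult G a b)" "gmult G a b \<in> G.sprod W W'"
            using arr by (auto simp: s_pi t_pi pi_mult intro: G.sprodI)
          then show False using False by blast
        qed
        then show ?thesis using cH(2) p(2)[OF False] by simp
      qed
    qed
  qed (simp_all add: G.conv_zero H.conv_zero push_zero G.conv_add_right H.conv_add_right f push_add G.conv_Cc push_Cc)
qed (simp_all add: assms G.conv_zero H.conv_zero push_zero G.conv_add_left H.conv_add_left push_add G.conv_Cc push_Cc)

lemma push_involution:
  assumes "f \<in> Cc G" shows "push (involution G f) = involution H (push f)"
  using assms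
proof (induction rule: G.Cc_induct)
  case (slice W f)
  have W: "G.bis W" using slice G.bis_BB by blast
  have arr: "\<And>a. a \<in> W \<Longrightarrow> a \<in> arrows G" using W G.bis_arrows by auto
  note z = G.slice_fun_zero[OF slice(2)] G.slice_fun_zero[OF G.slice_fun_involution[OF W slice(2)]]
  have p: "\<And>a. a \<in> W \<Longrightarrow> push (f) (\<pi> a) = (f) a" "\<And>\<gamma>. \<gamma> \<notin> \<pi> ` W \<Longrightarrow> push (f) \<gamma> = 0"
    using push_slice[where f = f, OF W z(1)] by blast+
  have q: "\<And>a. a \<in> (ginv G ` W) \<Longrightarrow> push (involution G f) (\<pi> a) = (involution G f) a" "\<And>\<gamma>. \<gamma> \<notin> \<pi> ` (ginv G ` W) \<Longrightarrow> push (involution G f) \<gamma> = 0"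
    using push_slice[where f = "involution G f", OF G.bis_inv[OF W] z(2)] by blast+
  show ?case
  proof
    fix \<gamma>
    show "push (involution G f) \<gamma> = involution H (push f) \<gamma>"
    proof (cases "\<gamma> \<in> \<pi> ` ginv G ` W")
      case True
      then obtain a where a: "a \<in> W" "\<gamma> = \<pi> (ginv G a)" by auto
      then have "push (involution G f) \<gamma> = cnj (f a)"
        using q(1)[of "ginv G a"] arr by (simp add: involution_def G.inv_closed G.inv_inv)
      moreover have "ginv H \<gamma> = \<pi> a" "\<gamma> \<in> arrows H"
        using a arr by (auto simp: pi_inv H.inv_inv pi_closed H.inv_closed)
      ultimately show ?thesis using p(1)[OF a(1)] by (simp add: involution_def)
    next
      case False
      have "ginv H \<gamma> \<notin> \<pi> ` W" if "\<gamma> \<in> arrows H"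
      proof
        assume "ginv H \<gamma> \<in> \<pi> ` W"
        then obtain a where a: "a \<in> W" "ginv H \<gamma> = \<pi> a" by blast
        then have "\<gamma> = \<pi> (ginv G a)" using H.inv_inv[OF that] arr by (simp add: pi_inv)
        then show False using False a by blast
      qed
      then show ?thesis using q(2)[OF False] p(2) by (simp add: involution_def)
    qed
  qed
qed (simp_all add: push_zero H.involution_add G.involution_add push_add G.involution_Cc)

text \<open>In integrated form, the tensor product of the regular representation of
  \<open>H\<close>, pulled back along \<pi>, with the translations of Z^r along
  \<open>c\<close>.\<close>

definition skew :: "('g \<Rightarrow> complex) \<Rightarrow> ('h \<times> (nat \<Rightarrow> int) \<Rightarrow> complex) \<Rightarrow> 'h \<times> (nat \<Rightarrow> int) \<Rightarrow> complex" where
  "skew f \<zeta> = (\<lambda>(\<gamma>, z). G.rsum f (\<lambda>a. \<zeta> (gmult H (ginv H (\<pi> a)) \<gamma>, \<lambda>j. z j - c a j)) (t' \<gamma>))"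

definition skew_act :: "'h \<times> (nat \<Rightarrow> int) \<Rightarrow> 'g \<Rightarrow> 'h \<times> (nat \<Rightarrow> int)" where
  "skew_act p a = (gmult H (\<pi> a) (fst p), \<lambda>j. snd p j + c a j)"

definition lattice :: "(nat \<Rightarrow> int) set" where
  "lattice = {z. \<forall>j\<ge>r. z j = 0}"

definition orbit :: "'h \<times> (nat \<Rightarrow> int) \<Rightarrow> ('h \<times> (nat \<Rightarrow> int)) set" where
  "orbit p = skew_act p ` G.fib (t' (fst p))"

lemma fst_skew_act:
  assumes "fst p \<in> arrows H" "a \<in> G.fib (t' (fst p))"
  shows "fst (skew_act p a) \<in> arrows H" "s' (fst (skew_act p a)) = s' (fst p)" "t' (fst (skew_act p a)) = t a"
  using assms by (auto simp: skew_act_def G.fib_def H.mult_closed H.s_mult H.t_mult pi_closed s_pi t_pi)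

text \<open>The range of the image is the range of the acting arrow, and the second component
  reveals its degree; the source is prescribed, so \<open>separating\<close> applies.\<close>

lemma inj_skew_act:
  assumes "fst p \<in> arrows H" shows "inj_on (skew_act p) (G.fib (t' (fst p)))"
proof (rule inj_onI)
  fix a b assume ab: "a \<in> G.fib (t' (fst p))" "b \<in> G.fib (t' (fst p))" "skew_act p a = skew_act p b"
  have "t a = t b" using fst_skew_act(3)[OF assms ab(1)] fst_skew_act(3)[OF assms ab(2)] ab(3) by simp
  moreover have "c a = c b" using ab(3) by (simp add: skew_act_def fun_eq_iff)
  ultimately show "a = b" using ab by (auto simp: G.fib_def intro: separating)
qed

lemma orbit_subset:
  assumes "p \<in> H.fib x \<times> lattice" shows "orbit p \<subseteq> H.fib x \<times> lattice"
proof
  fix q assume "q \<in> orbit p"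
  then obtain a where a: "a \<in> G.fib (t' (fst p))" "q = skew_act p a" by (auto simp: orbit_def)
  have "fst p \<in> arrows H" using assms by (auto simp: H.fib_def)
  from fst_skew_act[OF this a(1)] show "q \<in> H.fib x \<times> lattice"
    using assms a c_vanish by (auto simp: H.fib_def lattice_def skew_act_def G.fib_def)
qed

lemma orbit_self:
  assumes "fst p \<in> arrows H" shows "p \<in> orbit p"
proof -
  have x: "t' (fst p) \<in> topspace X" using assms H.t_in by blast
  have "skew_act p (e (t' (fst p))) = p"
    using assms c_unit[OF G.unit_closed[OF x]] x
    by (simp add: skew_act_def pi_unit H.unit_mult G.s_unit)
  moreover have "e (t' (fst p)) \<in> G.fib (t' (fst p))" using x by (simp add: G.fib_def G.unit_closed G.s_unit)
  ultimately show ?thesis unfolding orbit_def by (metis imageI)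
qed

lemma skew_act_mult:
  assumes "fst p \<in> arrows H" "b \<in> G.fib (t' (fst p))" "a \<in> arrows G" "s a = t b"
  shows "skew_act (skew_act p b) a = skew_act p (gmult G a b)"
  using assms by (auto simp: skew_act_def G.fib_def pi_mult c_mult H.mult_assoc pi_closed s_pi t_pi fun_eq_iff)

lemma orbit_mono:
  assumes "fst p \<in> arrows H" "q \<in> orbit p" shows "orbit q \<subseteq> orbit p"
proof
  fix u assume "u \<in> orbit q"
  then obtain a where a: "a \<in> G.fib (t' (fst q))" "u = skew_act q a" by (auto simp: orbit_def)
  obtain b where b: "b \<in> G.fib (t' (fst p))" "q = skew_act p b" using assms by (auto simp: orbit_def)
  have "s a = t b" "a \<in> arrows G" using a b fst_skew_act(3)[OF assms(1) b(1)] by (auto simp: G.fib_def)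
  moreover from this have "u = skew_act p (gmult G a b)" using a b assms skew_act_mult by simp
  moreover have "gmult G a b \<in> G.fib (t' (fst p))"
    using b \<open>s a = t b\<close> \<open>a \<in> arrows G\<close> by (auto simp: G.fib_def G.mult_closed G.s_mult)
  ultimately show "u \<in> orbit p" by (auto simp: orbit_def)
qed

text \<open>The inverse arrow leads back from \<open>q\<close> to \<open>p\<close>. So distinct
  orbits are disjoint, which is needed to add up the bounds obtained on each of them.\<close>

lemma orbit_eq:
  assumes "fst p \<in> arrows H" "q \<in> orbit p" shows "orbit q = orbit p"
proof
  show "orbit q \<subseteq> orbit p" using orbit_mono assms .
  obtain b where b: "b \<in> G.fib (t' (fst p))" "q = skew_act p b" using assms by (auto simp: orbit_def)
  have b': "b \<in> arrows G" "s b = t' (fst p)" using b by (auto simp: G.fib_def)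
  have q: "fst q \<in> arrows H" "t' (fst q) = t b" using fst_skew_act[OF assms(1) b(1)] b by auto
  have x: "t' (fst p) \<in> topspace X" using assms H.t_in by blast
  have "skew_act q (ginv G b) = skew_act p (gmult G (ginv G b) b)"
    unfolding b(2) using b' by (intro skew_act_mult assms b) (auto simp: G.inv_closed G.s_inv)
  also have "\<dots> = p"
    using assms c_unit[OF b'(1)] x b'
    by (simp add: skew_act_def pi_unit H.unit_mult G.s_unit G.inv_mult)
  finally have "p \<in> orbit q"
    unfolding orbit_def using q b' by (intro image_eqI[of _ _ "ginv G b"]) (auto simp: G.fib_def G.inv_closed G.s_inv)
  then show "orbit p \<subseteq> orbit q" using orbit_mono q by blast
qed

text \<open>The orbit map intertwines \<open>skew f\<close> with the left regular representation of
  \<open>f\<close> on a source fibre of \<open>G\<close>; this is how the reduced norm of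
  \<open>G\<close> enters.\<close>

lemma skew_on_orbit:
  assumes f: "f \<in> Cc G" and p: "fst p \<in> arrows H" and b: "b \<in> G.fib (t' (fst p))"
  shows "skew f \<zeta> (skew_act p b) =
    conv G f (\<lambda>a. if a \<in> G.fib (t' (fst p)) then \<zeta> (skew_act p a) else 0) b"
proof -
  have b': "b \<in> arrows G" "s b = t' (fst p)" using b by (auto simp: G.fib_def)
  have "skew f \<zeta> (skew_act p b) = G.rsum f (\<lambda>a. \<zeta> (gmult H (ginv H (\<pi> a)) (fst (skew_act p b)),
      \<lambda>j. snd (skew_act p b) j - c a j)) (t b)"
    using fst_skew_act(3)[OF p b] by (simp add: skew_def split_beta)
  also have "\<dots> = G.rsum f (\<lambda>a. if gmult G (ginv G a) b \<in> G.fib (t' (fst p))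
      then \<zeta> (skew_act p (gmult G (ginv G a) b)) else 0) (t b)"
  proof (rule G.rsum_cong)
    fix a assume a: "a \<in> arrows G" "t a = t b"
    then have "gmult G (ginv G a) b \<in> G.fib (t' (fst p))" using b' by (simp add: G.fib_def G.div_closed)
    moreover have "skew_act p (gmult G (ginv G a) b) = skew_act (skew_act p b) (ginv G a)"
      using a by (intro skew_act_mult[symmetric] p b) (auto simp: G.inv_closed G.s_inv)
    ultimately show "\<zeta> (gmult H (ginv H (\<pi> a)) (fst (skew_act p b)), \<lambda>j. snd (skew_act p b) j - c a j) =
      (if gmult G (ginv G a) b \<in> G.fib (t' (fst p)) then \<zeta> (skew_act p (gmult G (ginv G a) b)) else 0)"
      using a by (simp add: skew_act_def[of "skew_act p b"] pi_inv c_inv)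
  qed
  finally show ?thesis using b' f by (simp add: G.conv_eq_rsum G.Cc_fibre_finite)
qed

lemma skew_bound_orbit:
  assumes f: "f \<in> Cc G" and p: "fst p \<in> arrows H"
    and sm: "(\<lambda>q. (cmod (\<zeta> q))\<^sup>2) summable_on orbit p" and F: "finite F" "F \<subseteq> orbit p"
  shows "(\<Sum>q\<in>F. (cmod (skew f \<zeta> q))\<^sup>2) \<le> (reduced_norm G f)\<^sup>2 * (\<Sum>\<^sub>\<infinity>q\<in>orbit p. (cmod (\<zeta> q))\<^sup>2)"
proof -
  let ?B = "G.fib (t' (fst p))"
  define \<xi> where "\<xi> a = (if a \<in> ?B then \<zeta> (skew_act p a) else 0)" for a
  have inj: "inj_on (skew_act p) ?B" using p by (rule inj_skew_act)
  have x: "t' (fst p) \<in> topspace X" using p H.t_in by blast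
  have "(\<lambda>a. (cmod (\<zeta> (skew_act p a)))\<^sup>2) summable_on ?B"
    using sm unfolding orbit_def summable_on_reindex[OF inj] by (simp add: o_def)
  then have \<xi>: "\<xi> \<in> ell2 ?B" by (simp add: ell2_def \<xi>_def cong: summable_on_cong)
  have nrm: "(ell2_norm ?B \<xi>)\<^sup>2 = (\<Sum>\<^sub>\<infinity>q\<in>orbit p. (cmod (\<zeta> q))\<^sup>2)"
    unfolding orbit_def infsum_reindex[OF inj] ell2_norm_def
    by (simp add: infsum_nonneg \<xi>_def o_def cong: infsum_cong)
  obtain F0 where F0: "finite F0" "F0 \<subseteq> ?B" "F = skew_act p ` F0"
    using F unfolding orbit_def by (metis finite_subset_image)
  have "(\<Sum>q\<in>F. (cmod (skew f \<zeta> q))\<^sup>2) = (\<Sum>b\<in>F0. (cmod (skew f \<zeta> (skew_act p b)))\<^sup>2)"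
    unfolding F0(3) using inj_on_subset[OF inj F0(2)] by (simp add: sum.reindex)
  also have "\<dots> = (\<Sum>b\<in>F0. (cmod (conv G f \<xi> b))\<^sup>2)"
    using F0(2) skew_on_orbit[OF f p, of _ \<zeta>] by (intro sum.cong) (auto simp: \<xi>_def[abs_def])
  also have "\<dots> = (L2_set (\<lambda>b. cmod (conv G f \<xi> b)) F0)\<^sup>2" by (simp add: L2_set_def sum_nonneg)
  also have "\<dots> \<le> (ell2_norm ?B (conv G f \<xi>))\<^sup>2"
    using G.conv_ell2[OF f \<xi>] F0 by (intro power_mono L2_set_le_ell2_norm) auto
  also have "\<dots> \<le> (reduced_norm G f * ell2_norm ?B \<xi>)\<^sup>2"
    by (intro power_mono G.conv_le_reduced_norm f x \<xi>) simp
  finally show ?thesis by (simp add: power_mult_distrib nrm)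
qed

text \<open>The bound is tested on a finite set \<open>S\<close>, which meets only finitely many
  orbits; these are disjoint, so the bounds on single orbits can be summed.\<close>

lemma skew_bound:
  assumes f: "f \<in> Cc G" and sm: "(\<lambda>q. (cmod (\<zeta> q))\<^sup>2) summable_on H.fib x \<times> lattice"
    and S: "finite S" "S \<subseteq> H.fib x \<times> lattice"
  shows "(\<Sum>q\<in>S. (cmod (skew f \<zeta> q))\<^sup>2) \<le> (reduced_norm G f)\<^sup>2 * (\<Sum>\<^sub>\<infinity>q\<in>H.fib x \<times> lattice. (cmod (\<zeta> q))\<^sup>2)"
proof -
  have arr: "fst p \<in> arrows H" if "p \<in> H.fib x \<times> lattice" for p
    using that by (auto simp: H.fib_def)
  have sub: "orbit p \<subseteq> H.fib x \<times> lattice" if "p \<in> S" for p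
    using orbit_subset that S(2) by blast
  have smo: "(\<lambda>q. (cmod (\<zeta> q))\<^sup>2) summable_on Q" if "Q \<in> orbit ` S" for Q
    using that sub by (auto intro!: summable_on_subset_banach[OF sm])
  have "(\<Sum>q\<in>S. (cmod (skew f \<zeta> q))\<^sup>2) =
      (\<Sum>Q\<in>orbit ` S. \<Sum>q\<in>{q \<in> S. orbit q = Q}. (cmod (skew f \<zeta> q))\<^sup>2)"
    using S by (intro sum.group[symmetric]) auto
  also have "\<dots> \<le> (\<Sum>Q\<in>orbit ` S. (reduced_norm G f)\<^sup>2 * (\<Sum>\<^sub>\<infinity>q\<in>Q. (cmod (\<zeta> q))\<^sup>2))"
  proof (rule sum_mono)
    fix Q assume Q: "Q \<in> orbit ` S"
    then obtain p where p: "p \<in> S" "Q = orbit p" by blast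
    have "{q \<in> S. orbit q = Q} \<subseteq> orbit p"
      using p orbit_self arr S(2) by blast
    then show "(\<Sum>q\<in>{q \<in> S. orbit q = Q}. (cmod (skew f \<zeta> q))\<^sup>2) \<le>
       (reduced_norm G f)\<^sup>2 * (\<Sum>\<^sub>\<infinity>q\<in>Q. (cmod (\<zeta> q))\<^sup>2)"
      unfolding p(2) using p S smo[OF Q] arr by (intro skew_bound_orbit f) auto
  qed
  also have "\<dots> = (reduced_norm G f)\<^sup>2 * (\<Sum>Q\<in>orbit ` S. \<Sum>\<^sub>\<infinity>q\<in>Q. (cmod (\<zeta> q))\<^sup>2)"
    by (simp add: sum_distrib_left)
  also have "(\<Sum>Q\<in>orbit ` S. \<Sum>\<^sub>\<infinity>q\<in>Q. (cmod (\<zeta> q))\<^sup>2) = (\<Sum>\<^sub>\<infinity>q\<in>(\<Union>Q\<in>orbit ` S. Q). (cmod (\<zeta> q))\<^sup>2)"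
  proof (rule sum_infsum)
    fix Q Q' assume Q: "Q \<in> orbit ` S" "Q' \<in> orbit ` S" "Q \<noteq> Q'"
    then obtain p p' where p: "p \<in> S" "Q = orbit p" "p' \<in> S" "Q' = orbit p'" by blast
    show "Q \<inter> Q' = {}"
    proof (rule ccontr)
      assume "Q \<inter> Q' \<noteq> {}"
      then obtain q where "q \<in> orbit p" "q \<in> orbit p'" using p by blast
      then have "orbit p = orbit p'" using orbit_eq arr S(2) p by blast
      then show False using Q p by simp
    qed
  qed (use S smo in auto)
  also have "(\<Sum>\<^sub>\<infinity>q\<in>(\<Union>Q\<in>orbit ` S. Q). (cmod (\<zeta> q))\<^sup>2) \<le> (\<Sum>\<^sub>\<infinity>q\<in>H.fib x \<times> lattice. (cmod (\<zeta> q))\<^sup>2)"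
  proof -
    have u: "(\<Union>Q\<in>orbit ` S. Q) \<subseteq> H.fib x \<times> lattice" using sub by blast
    show ?thesis using u summable_on_subset_banach[OF sm u] sm by (intro infsum_mono2) auto
  qed
  finally show ?thesis by (simp add: mult_left_mono)
qed

text \<open>Half-open in each coordinate, so that the side is \<open>u - l\<close>; the count
  \<open>nat (u - l) ^ r\<close> then also covers empty boxes and \<open>r = 0\<close>.\<close>

definition box :: "int \<Rightarrow> int \<Rightarrow> (nat \<Rightarrow> int) set" where
  "box l u = {z \<in> lattice. \<forall>j<r. l \<le> z j \<and> z j < u}"

lemma finite_card_box: "finite (box l u) \<and> card (box l u) = nat (u - l) ^ r"
proof -
  have "bij_betw (\<lambda>z. \<lambda>j\<in>{..<r}. z j) (box l u) ({..<r} \<rightarrow>\<^sub>E {l..<u})"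
    by (rule bij_betwI[where g = "\<lambda>z j. if j < r then z j else 0"])
      (auto simp: box_def lattice_def fun_eq_iff PiE_iff extensional_def)
  moreover have "finite ({..<r} \<rightarrow>\<^sub>E {l..<u})" by (intro finite_PiE) auto
  moreover have "card ({..<r} \<rightarrow>\<^sub>E {l..<u}) = nat (u - l) ^ r" by (simp add: card_PiE)
  ultimately show ?thesis using bij_betw_finite bij_betw_same_card by metis
qed

text \<open>The degree is constant on each slice, and \<open>f\<close> is a finite sum of slice
  functions.\<close>

lemma cocycle_bounded:
  assumes "f \<in> Cc G"
  shows "\<exists>M::nat. \<forall>a j. f a \<noteq> 0 \<longrightarrow> \<bar>c a j\<bar> \<le> int M"
  using assms
proof (induction rule: G.Cc_induct)
  case (slice W f)
  obtain z where z: "\<And>a. a \<in> W \<Longrightarrow> c a = z" using c_BB[OF slice(1)] by blast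
  define M where "M = nat (\<Sum>j<r. \<bar>z j\<bar>)"
  have "\<bar>c a j\<bar> \<le> int M" if "f a \<noteq> 0" for a j
  proof -
    have a: "a \<in> W" using G.slice_fun_zero[OF slice(2)] that by blast
    show ?thesis
    proof (cases "j < r")
      case True
      then have "\<bar>z j\<bar> \<le> (\<Sum>j<r. \<bar>z j\<bar>)" by (intro member_le_sum) auto
      then show ?thesis using z[OF a] by (simp add: M_def)
    next
      case False
      then show ?thesis using c_vanish[of a j] G.BB_arrows[OF slice(1) a] by simp
    qed
  qed
  then show ?case by blast
next
  case (add f h)
  then obtain M N where M: "\<And>a j. f a \<noteq> 0 \<Longrightarrow> \<bar>c a j\<bar> \<le> int M" "\<And>a j. h a \<noteq> 0 \<Longrightarrow> \<bar>c a j\<bar> \<le> int N"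
    by blast
  have "\<bar>c a j\<bar> \<le> int (max M N)" if "f a + h a \<noteq> 0" for a j
  proof -
    have "f a \<noteq> 0 \<or> h a \<noteq> 0" using that by auto
    then show ?thesis using M[of a j] by (auto simp: le_max_iff_disj)
  qed
  then show ?case by blast
qed auto

text \<open>The test vector \<open>\<eta>\<close> is \<open>\<xi>\<close> times the indicator of the
  box of side \<open>n\<close>. On the inner box, smaller by \<open>M\<close> on every side, no
  degree in the support of \<open>f\<close> leads out of the large box, so
  \<open>skew f \<eta>\<close> has the value of the convolution with \<open>push f\<close>. Counting
  lattice points gives the two powers; the truncated difference \<open>n - 2 * M\<close> is the side
  of the inner box.\<close>

lemma push_bound_box:
  assumes f: "f \<in> Cc G" and M: "\<And>a j. f a \<noteq> 0 \<Longrightarrow> \<bar>c a j\<bar> \<le> int M"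
    and \<xi>: "\<xi> \<in> ell2 (H.fib x)" and F: "finite F" "F \<subseteq> H.fib x"
  shows "real (n - 2 * M) ^ r * (\<Sum>\<gamma>\<in>F. (cmod (conv H (push f) \<xi> \<gamma>))\<^sup>2) \<le>
    real n ^ r * ((reduced_norm G f)\<^sup>2 * (ell2_norm (H.fib x) \<xi>)\<^sup>2)"
proof -
  let ?B = "box 0 (int n)" and ?C = "box (int M) (int n - int M)"
  let ?Y = "H.fib x \<times> lattice"
  define \<eta> where "\<eta> = (\<lambda>(\<gamma>, z). if z \<in> ?B then \<xi> \<gamma> else 0)"
  have fin: "(\<Sum>q\<in>S. (cmod (\<eta> q))\<^sup>2) \<le> real n ^ r * (ell2_norm (H.fib x) \<xi>)\<^sup>2"
    if S: "finite S" "S \<subseteq> ?Y" for S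
  proof -
    have "(\<Sum>q\<in>S. (cmod (\<eta> q))\<^sup>2) = (\<Sum>q\<in>{q \<in> S. snd q \<in> ?B}. (cmod (\<eta> q))\<^sup>2)"
      using S by (intro sum.mono_neutral_right) (auto simp: \<eta>_def split: if_splits)
    \<comment> \<open>The finite set is enlarged to a product, over which the sum factors.\<close>
    also have "\<dots> \<le> (\<Sum>q\<in>fst ` S \<times> ?B. (cmod (\<eta> q))\<^sup>2)"
      using S finite_card_box by (intro sum_mono2) force+
    also have "\<dots> = (\<Sum>\<gamma>\<in>fst ` S. \<Sum>z\<in>?B. (cmod (\<xi> \<gamma>))\<^sup>2)"
      unfolding sum.cartesian_product by (intro sum.cong) (auto simp: \<eta>_def)
    also have "\<dots> = real n ^ r * (\<Sum>\<gamma>\<in>fst ` S. (cmod (\<xi> \<gamma>))\<^sup>2)"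
      using finite_card_box[of 0 "int n"] by (simp add: sum_distrib_left)
    also have "(\<Sum>\<gamma>\<in>fst ` S. (cmod (\<xi> \<gamma>))\<^sup>2) = (L2_set (\<lambda>\<gamma>. cmod (\<xi> \<gamma>)) (fst ` S))\<^sup>2"
      by (simp add: L2_set_def sum_nonneg)
    also have "\<dots> \<le> (ell2_norm (H.fib x) \<xi>)\<^sup>2"
      using S \<xi> by (intro power_mono L2_set_le_ell2_norm) auto
    finally show ?thesis by (simp add: mult_left_mono)
  qed
  have sm: "(\<lambda>q. (cmod (\<eta> q))\<^sup>2) summable_on ?Y"
    by (rule nonneg_bdd_above_summable_on)
      (auto intro!: bdd_aboveI[of _ "real n ^ r * (ell2_norm (H.fib x) \<xi>)\<^sup>2"] fin)
  then have le: "(\<Sum>\<^sub>\<infinity>q\<in>?Y. (cmod (\<eta> q))\<^sup>2) \<le> real n ^ r * (ell2_norm (H.fib x) \<xi>)\<^sup>2"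
    by (rule infsum_le_finite_sums) (rule fin)
  have eq: "skew f \<eta> (\<gamma>, z) = conv H (push f) \<xi> \<gamma>" if "\<gamma> \<in> F" "z \<in> ?C" for \<gamma> z
  proof -
    have \<gamma>: "\<gamma> \<in> arrows H" using that F by (auto simp: H.fib_def)
    have "skew f \<eta> (\<gamma>, z) = G.rsum f (\<lambda>a. \<xi> (gmult H (ginv H (\<pi> a)) \<gamma>)) (t' \<gamma>)"
      unfolding skew_def split
    proof (rule G.rsum_cong)
      fix a assume a: "a \<in> arrows G" "f a \<noteq> 0"
      have "(\<lambda>j. z j - c a j) \<in> ?B"
        using that(2) M[OF a(2)] c_vanish[OF a(1)]
        by (auto simp: box_def lattice_def abs_le_iff) (smt (verit, best))+
      then show "\<eta> (gmult H (ginv H (\<pi> a)) \<gamma>, \<lambda>j. z j - c a j) = \<xi> (gmult H (ginv H (\<pi> a)) \<gamma>)"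
        by (simp add: \<eta>_def)
    qed
    then show ?thesis using conv_push[OF f \<gamma>] by simp
  qed
  have "real (n - 2 * M) ^ r * (\<Sum>\<gamma>\<in>F. (cmod (conv H (push f) \<xi> \<gamma>))\<^sup>2) =
    (\<Sum>\<gamma>\<in>F. \<Sum>z\<in>?C. (cmod (conv H (push f) \<xi> \<gamma>))\<^sup>2)"
  proof -
    have "nat (int n - int M - int M) = n - 2 * M" by linarith
    then show ?thesis
      using finite_card_box[of "int M" "int n - int M"] by (simp add: sum_distrib_left)
  qed
  also have "\<dots> = (\<Sum>q\<in>F \<times> ?C. (cmod (skew f \<eta> q))\<^sup>2)"
    unfolding sum.cartesian_product by (intro sum.cong) (auto simp: eq)
  also have "\<dots> \<le> (reduced_norm G f)\<^sup>2 * (\<Sum>\<^sub>\<infinity>q\<in>?Y. (cmod (\<eta> q))\<^sup>2)"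
    using F finite_card_box by (intro skew_bound f sm) (auto simp: box_def)
  also have "\<dots> \<le> (reduced_norm G f)\<^sup>2 * (real n ^ r * (ell2_norm (H.fib x) \<xi>)\<^sup>2)"
    by (intro mult_left_mono le) simp
  finally show ?thesis by (simp add: mult.left_commute)
qed

text \<open>Dividing the box estimate by \<open>n ^ r\<close> leaves the factor ((n - 2M)/n)^r on
  the left, which tends to 1; so no constant is lost.\<close>

lemma reduced_norm_push:
  assumes f: "f \<in> Cc G"
  shows "reduced_norm H (push f) \<le> reduced_norm G f"
proof (rule H.reduced_norm_le[OF push_Cc[OF f] G.reduced_norm_nonneg[OF f]])
  fix x \<xi> assume \<xi>: "\<xi> \<in> ell2 (H.fib x)"
  let ?N = "reduced_norm G f * ell2_norm (H.fib x) \<xi>"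
  have N: "0 \<le> ?N" using G.reduced_norm_nonneg[OF f] by simp
  obtain M :: nat where M: "\<And>a j. f a \<noteq> 0 \<Longrightarrow> \<bar>c a j\<bar> \<le> int M" using cocycle_bounded[OF f] by blast
  have "L2_set (\<lambda>\<gamma>. cmod (conv H (push f) \<xi> \<gamma>)) F \<le> ?N" if F: "finite F" "F \<subseteq> H.fib x" for F
  proof -
    define Q where "Q = (\<Sum>\<gamma>\<in>F. (cmod (conv H (push f) \<xi> \<gamma>))\<^sup>2)"
    have "(\<lambda>n. (1 - 2 * real M * (1 / real n)) ^ r * Q) \<longlonglongrightarrow> (1 - 2 * real M * 0) ^ r * Q"
      by (intro tendsto_intros lim_1_over_n)
    then have lim: "(\<lambda>n. (1 - 2 * real M * (1 / real n)) ^ r * Q) \<longlonglongrightarrow> Q" by simp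
    have "Q \<le> ?N\<^sup>2"
    \<comment> \<open>From \<open>2 * M + 1\<close> on, \<open>n\<close> is positive and the
      truncated difference \<open>n - 2 * M\<close> is a true one.\<close>
    proof (rule LIMSEQ_le_const2[OF lim], intro exI[of _ "2 * M + 1"] allI impI)
      fix n assume n: "2 * M + 1 \<le> n"
      then have "(1 - 2 * real M * (1 / real n)) = real (n - 2 * M) / real n"
        by (simp add: field_simps of_nat_diff)
      then have "(1 - 2 * real M * (1 / real n)) ^ r * Q = (real (n - 2 * M) ^ r * Q) / real n ^ r"
        by (simp add: power_divide)
      also have "\<dots> \<le> (real n ^ r * ?N\<^sup>2) / real n ^ r"
        using push_bound_box[OF f M \<xi> F, of n] by (intro divide_right_mono) (auto simp: Q_def power_mult_distrib)
      also have "\<dots> = ?N\<^sup>2" using n by simp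
      finally show "(1 - 2 * real M * (1 / real n)) ^ r * Q \<le> ?N\<^sup>2" .
    qed
    then show ?thesis unfolding L2_set_def Q_def using N by (simp add: real_le_lsqrt sum_nonneg)
  qed
  then show "ell2_norm (H.fib x) (conv H (push f) \<xi>) \<le> ?N"
    using N H.conv_fib_zero[OF push_Cc[OF f] \<xi>] by (intro ell2_boundI) auto
qed

lemma push_extends:
  "\<exists>\<Phi>. star_hom (reduced_Cstar G) (reduced_Cstar H) \<Phi> \<and>
    (\<forall>f\<in>Cc G. push f \<in> Cc H \<and> \<Phi> (Cc_embed G f) = Cc_embed H (push f))"
proof -
  have hom: "star_hom (Cc_alg G) (Cc_alg H) push"
    by (simp add: star_hom_def Cc_alg_def push_Cc push_add push_scale push_conv push_involution)
  have "adist (Cc_alg H) (push f) (push h) \<le> adist (Cc_alg G) f h" if "f \<in> Cc G" "h \<in> Cc G" for f h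
  proof -
    have "push (\<lambda>g. f g - h g) = (\<lambda>g. push f g - push h g)"
      using push_add[OF that(1) Cc_scale[OF that(2), of "-1"]] push_scale[of "-1" h] by simp
    then show ?thesis using reduced_norm_push[OF G.Cc_diff[OF that]] by (simp add: G.adist_Cc H.adist_Cc)
  qed
  then show ?thesis
    using star_hom_completion[OF G.pre_normed_star_alg_Cc H.pre_normed_star_alg_Cc hom] push_Cc
    by (simp add: reduced_Cstar_def Cc_embed_def Cc_alg_def)
qed

end

section \<open>Partial maps\<close>

text \<open>A continuous open partial map with open domain and range, expressed through its graph.
  The symmetry between images and preimages reduces composition, restriction and inversion to
  identities of sets.\<close>

definition biopen :: "'x topology \<Rightarrow> ('x \<rightharpoonup> 'x) \<Rightarrow> bool" where
  "biopen X f \<longleftrightarrow> dom f \<subseteq> topspace X \<and> ran f \<subseteq> topspace X \<and>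
     (\<forall>Q. openin X Q \<longrightarrow> openin X {y. \<exists>x\<in>Q. f x = Some y} \<and> openin X {x. \<exists>y\<in>Q. f x = Some y})"

definition lhomeo :: "'x topology \<Rightarrow> ('x \<rightharpoonup> 'x) \<Rightarrow> bool" where
  "lhomeo X f \<longleftrightarrow> biopen X f \<and> (\<forall>x\<in>dom f. \<exists>U. inj_open X f U \<and> x \<in> U)"

lemma biopenD:
  assumes "biopen X f"
  shows "f x = Some y \<Longrightarrow> x \<in> topspace X" "f x = Some y \<Longrightarrow> y \<in> topspace X"
    "openin X Q \<Longrightarrow> openin X {y. \<exists>x\<in>Q. f x = Some y}" "openin X Q \<Longrightarrow> openin X {x. \<exists>y\<in>Q. f x = Some y}"
  using assms by (auto simp: biopen_def ran_def)

lemma biopen_dom: assumes "biopen X f" shows "openin X (dom f)"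
proof -
  have "dom f = {x. \<exists>y\<in>topspace X. f x = Some y}" using biopenD(2)[OF assms] by auto
  then show ?thesis using biopenD(4)[OF assms openin_topspace] by simp
qed

lemma biopen_ran: assumes "biopen X f" shows "openin X (ran f)"
proof -
  have "ran f = {y. \<exists>x\<in>topspace X. f x = Some y}" using biopenD(1)[OF assms] by (auto simp: ran_def)
  then show ?thesis using biopenD(3)[OF assms openin_topspace] by simp
qed

text \<open>Translates homeomorphisms between subspaces into the graph form, which frees the later
  arguments from subtopologies.\<close>

lemma partial_homeo_iff: "partial_homeo X S \<longleftrightarrow> biopen X S \<and> inj_on S (dom S)"
proof
  assume "partial_homeo X S"
  then have o: "openin X (dom S)" "openin X (ran S)"
    and h: "homeomorphic_map (subtopology X (dom S)) (subtopology X (ran S)) (the \<circ> S)"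
    by (auto simp: partial_homeo_def)
  have sub: "dom S \<subseteq> topspace X" "ran S \<subseteq> topspace X" using o openin_subset by auto
  have inj: "inj_on (the \<circ> S) (dom S)"
    using homeomorphic_imp_injective_map[OF h] sub by (simp add: Int_absorb1)
  then have "inj_on S (dom S)" by (auto simp: inj_on_def)
  moreover have "openin X {y. \<exists>x\<in>Q. S x = Some y}" "openin X {x. \<exists>y\<in>Q. S x = Some y}" if Q: "openin X Q" for Q
  proof -
    have "openin (subtopology X (dom S)) (dom S \<inter> Q)" using Q by (simp add: openin_subtopology_Int2)
    then have "openin (subtopology X (ran S)) ((the \<circ> S) ` (dom S \<inter> Q))"
      using homeomorphic_imp_open_map[OF h] by (simp add: open_map_def)
    moreover have "(the \<circ> S) ` (dom S \<inter> Q) = {y. \<exists>x\<in>Q. S x = Some y}" by force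
    ultimately show "openin X {y. \<exists>x\<in>Q. S x = Some y}" using o openin_trans_full by metis
    have "continuous_map (subtopology X (dom S)) X (the \<circ> S)"
      using homeomorphic_imp_continuous_map[OF h] by (simp add: continuous_map_in_subtopology)
    then have "openin (subtopology X (dom S)) {x \<in> topspace (subtopology X (dom S)). (the \<circ> S) x \<in> Q}"
      using Q by (rule openin_continuous_map_preimage)
    moreover have "{x \<in> topspace (subtopology X (dom S)). (the \<circ> S) x \<in> Q} = {x. \<exists>y\<in>Q. S x = Some y}"
      using sub by auto
    ultimately show "openin X {x. \<exists>y\<in>Q. S x = Some y}" using o openin_trans_full by metis
  qed
  ultimately show "biopen X S \<and> inj_on S (dom S)" using sub by (simp add: biopen_def)
next
  assume S: "biopen X S \<and> inj_on S (dom S)"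
  then have b: "biopen X S" by simp
  have o: "openin X (dom S)" "openin X (ran S)" using biopen_dom[OF b] biopen_ran[OF b] .
  have sub: "dom S \<subseteq> topspace X" "ran S \<subseteq> topspace X" using o openin_subset by auto
  have "homeomorphic_map (subtopology X (dom S)) (subtopology X (ran S)) (the \<circ> S)"
  proof (rule bijective_open_imp_homeomorphic_map)
    show "continuous_map (subtopology X (dom S)) (subtopology X (ran S)) (the \<circ> S)"
      unfolding continuous_map_in_subtopology
    proof
      show "continuous_map (subtopology X (dom S)) X (the \<circ> S)"
        unfolding continuous_map_def
      proof (intro conjI allI impI)
        show "the \<circ> S \<in> topspace (subtopology X (dom S)) \<rightarrow> topspace X"
          using sub by (auto simp: ran_def)
        fix Q assume "openin X Q"
        then have "openin X {x. \<exists>y\<in>Q. S x = Some y}" using biopenD(4)[OF b] by blast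
        moreover have "{x \<in> topspace (subtopology X (dom S)). (the \<circ> S) x \<in> Q} = {x. \<exists>y\<in>Q. S x = Some y}"
          using sub by auto
        ultimately show "openin (subtopology X (dom S)) {x \<in> topspace (subtopology X (dom S)). (the \<circ> S) x \<in> Q}"
          using o(1) by (auto simp: openin_open_subtopology)
      qed
    qed (auto simp: ran_def)
    show "open_map (subtopology X (dom S)) (subtopology X (ran S)) (the \<circ> S)"
      unfolding open_map_def
    proof (intro allI impI)
      fix Q assume "openin (subtopology X (dom S)) Q"
      then have Q: "openin X Q" "Q \<subseteq> dom S" using o by (auto simp: openin_open_subtopology)
      have "(the \<circ> S) ` Q = {y. \<exists>x\<in>Q. S x = Some y}" using Q(2) by force
      then show "openin (subtopology X (ran S)) ((the \<circ> S) ` Q)"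
        using biopenD(3)[OF b Q(1)] o(2) by (auto simp: openin_open_subtopology ran_def)
    qed
    show "(the \<circ> S) ` topspace (subtopology X (dom S)) = topspace (subtopology X (ran S))"
      using sub by (force simp: ran_def)
    show "inj_on (the \<circ> S) (topspace (subtopology X (dom S)))"
    proof (rule inj_onI)
      fix a b assume ab: "a \<in> topspace (subtopology X (dom S))" "b \<in> topspace (subtopology X (dom S))"
        "(the \<circ> S) a = (the \<circ> S) b"
      then have "S a = S b" by auto
      then show "a = b" using S ab inj_onD[of S "dom S" a b] by simp
    qed
  qed
  then show "partial_homeo X S" using o by (simp add: partial_homeo_def)
qed

lemma biopen_comp:
  assumes "biopen X f" "biopen X g" shows "biopen X (f \<circ>\<^sub>m g)"
  unfolding biopen_def
proof (intro conjI allI impI)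
  show "dom (f \<circ>\<^sub>m g) \<subseteq> topspace X" "ran (f \<circ>\<^sub>m g) \<subseteq> topspace X"
    using biopenD[OF assms(1)] biopenD[OF assms(2)] by (auto simp: map_comp_Some_iff ran_def)
  fix Q assume Q: "openin X Q"
  have "{z. \<exists>x\<in>Q. (f \<circ>\<^sub>m g) x = Some z} = {z. \<exists>y\<in>{y. \<exists>x\<in>Q. g x = Some y}. f y = Some z}"
    by (auto simp: map_comp_Some_iff)
  then show "openin X {z. \<exists>x\<in>Q. (f \<circ>\<^sub>m g) x = Some z}"
    using biopenD(3)[OF assms(1) biopenD(3)[OF assms(2) Q]] by simp
  have "{x. \<exists>z\<in>Q. (f \<circ>\<^sub>m g) x = Some z} = {x. \<exists>y\<in>{y. \<exists>z\<in>Q. f y = Some z}. g x = Some y}"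
    by (auto simp: map_comp_Some_iff)
  then show "openin X {x. \<exists>z\<in>Q. (f \<circ>\<^sub>m g) x = Some z}"
    using biopenD(4)[OF assms(2) biopenD(4)[OF assms(1) Q]] by simp
qed

lemma pid_Some_iff: "pid X x = Some y \<longleftrightarrow> y = x \<and> x \<in> topspace X"
  by (auto simp: pid_def restrict_map_def)

lemma biopen_pid: "biopen X (pid X)"
proof -
  have "{y. \<exists>x\<in>Q. pid X x = Some y} = Q" "{x. \<exists>y\<in>Q. pid X x = Some y} = Q" if "openin X Q" for Q
    using openin_subset[OF that] by (auto simp: pid_Some_iff)
  then show ?thesis by (auto simp: biopen_def pid_Some_iff ran_def)
qed

lemma restrict_Some_iff: "(f |` U) x = Some y \<longleftrightarrow> x \<in> U \<and> f x = Some y"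
  by (auto simp: restrict_map_def)

lemma biopen_restrict:
  assumes "biopen X f" "openin X U" shows "biopen X (f |` U)"
  unfolding biopen_def
proof (intro conjI allI impI)
  show "dom (f |` U) \<subseteq> topspace X" "ran (f |` U) \<subseteq> topspace X"
    using biopenD[OF assms(1)] by (auto simp: restrict_Some_iff ran_def)
  fix Q assume Q: "openin X Q"
  have "{y. \<exists>x\<in>Q. (f |` U) x = Some y} = {y. \<exists>x\<in>Q \<inter> U. f x = Some y}" by (auto simp: restrict_Some_iff)
  then show "openin X {y. \<exists>x\<in>Q. (f |` U) x = Some y}"
    using biopenD(3)[OF assms(1), of "Q \<inter> U"] Q assms(2) by auto
  have "{x. \<exists>y\<in>Q. (f |` U) x = Some y} = U \<inter> {x. \<exists>y\<in>Q. f x = Some y}" by (auto simp: restrict_Some_iff)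
  then show "openin X {x. \<exists>y\<in>Q. (f |` U) x = Some y}"
    using biopenD(4)[OF assms(1) Q] assms(2) by auto
qed

lemma pinv_Some_iff:
  assumes "inj_on S (dom S)" shows "pinv S y = Some x \<longleftrightarrow> S x = Some y"
proof -
  have the: "(THE x. S x = Some y) = x" if "S x = Some y" for x
    using that assms by (intro the_equality) (auto simp: inj_on_def dom_def)
  then show ?thesis by (auto simp: pinv_def ran_def)
qed

lemma partial_homeo_pinv:
  assumes "partial_homeo X S" shows "partial_homeo X (pinv S)"
proof -
  have S: "biopen X S" "inj_on S (dom S)" using assms by (auto simp: partial_homeo_iff)
  note p = pinv_Some_iff[OF S(2)]
  have "biopen X (pinv S)" unfolding biopen_def using biopenD[OF S(1)] by (auto simp: p ran_def)
  moreover have "inj_on (pinv S) (dom (pinv S))"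
  proof (rule inj_onI)
    fix a b assume "a \<in> dom (pinv S)" "b \<in> dom (pinv S)" "pinv S a = pinv S b"
    then obtain x where "pinv S a = Some x" "pinv S b = Some x" by auto
    then show "a = b" by (simp add: p)
  qed
  ultimately show ?thesis by (simp add: partial_homeo_iff)
qed

lemma partial_homeo_comp:
  assumes "partial_homeo X S" "partial_homeo X R" shows "partial_homeo X (S \<circ>\<^sub>m R)"
proof -
  have inj: "inj_on S (dom S)" "inj_on R (dom R)" using assms by (auto simp: partial_homeo_iff)
  have "inj_on (S \<circ>\<^sub>m R) (dom (S \<circ>\<^sub>m R))"
  proof (rule inj_onI)
    fix a b assume "a \<in> dom (S \<circ>\<^sub>m R)" "b \<in> dom (S \<circ>\<^sub>m R)" "(S \<circ>\<^sub>m R) a = (S \<circ>\<^sub>m R) b"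
    then obtain a' b' z where "R a = Some a'" "R b = Some b'" "S a' = Some z" "S b' = Some z"
      by (auto simp: map_comp_Some_iff)
    moreover from this have "a' = b'" using inj_onD[OF inj(1), of a' b'] by auto
    ultimately show "a = b" using inj_onD[OF inj(2), of a b] by auto
  qed
  then show ?thesis using assms biopen_comp by (auto simp: partial_homeo_iff)
qed

lemma partial_homeo_pid: "partial_homeo X (pid X)"
proof -
  have "inj_on (pid X) (dom (pid X))"
  proof (rule inj_onI)
    fix x y assume "x \<in> dom (pid X)" "y \<in> dom (pid X)" "pid X x = pid X y"
    then obtain z where "pid X x = Some z" "pid X y = Some z" by auto
    then show "x = y" by (simp add: pid_Some_iff)
  qed
  then show ?thesis using biopen_pid by (simp add: partial_homeo_iff)
qed

lemma partial_homeo_restrict: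
  assumes "biopen X f" "inj_open X f U" shows "partial_homeo X (f |` U)"
proof -
  have U: "openin X U" "inj_on f U" using assms(2) by (auto simp: inj_open_def)
  have "inj_on (f |` U) (dom (f |` U))"
  proof (rule inj_onI)
    fix a b assume ab: "a \<in> dom (f |` U)" "b \<in> dom (f |` U)" "(f |` U) a = (f |` U) b"
    then have "a \<in> U" "b \<in> U" by auto
    then show "a = b" using ab(3) inj_onD[OF U(2), of a b] by simp
  qed
  then show ?thesis using biopen_restrict[OF assms(1) U(1)] by (simp add: partial_homeo_iff)
qed

text \<open>Images and preimages of an open set are unions of those under the local homeomorphic
  pieces of \<open>f\<close>, and these are open.\<close>

lemma lhomeo_if_partial_local_homeo:
  assumes "partial_local_homeo X f" shows "lhomeo X f"
proof -
  have d: "dom f \<subseteq> topspace X" "ran f \<subseteq> topspace X"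
    using assms openin_subset by (auto simp: partial_local_homeo_def)
  have loc: "\<exists>U. openin X U \<and> x \<in> U \<and> U \<subseteq> dom f \<and> biopen X (f |` U) \<and> inj_on f U" if "f x = Some y" for x y
  proof -
    have "x \<in> dom f" using that by blast
    then obtain U where U: "openin X U" "x \<in> U" "U \<subseteq> dom f" "partial_homeo X (f |` U)"
      using assms unfolding partial_local_homeo_def by blast
    have "dom (f |` U) = U" using U(3) by auto
    then have "inj_on f U" using U(4) by (auto simp: partial_homeo_iff inj_on_def restrict_map_def)
    then show ?thesis using U by (auto simp: partial_homeo_iff)
  qed
  have "openin X {y. \<exists>x\<in>Q. f x = Some y}" if Q: "openin X Q" for Q
  proof (subst openin_subopen, clarify)
    fix x y assume "x \<in> Q" "f x = Some y"
    moreover from this obtain U where "openin X U" "x \<in> U" "biopen X (f |` U)" using loc by blast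
    ultimately show "\<exists>V. openin X V \<and> y \<in> V \<and> V \<subseteq> {y. \<exists>x\<in>Q. f x = Some y}"
      using biopenD(3)[OF \<open>biopen X (f |` U)\<close> Q]
      by (intro exI[of _ "{y. \<exists>x\<in>Q. (f |` U) x = Some y}"]) (auto simp: restrict_Some_iff)
  qed
  moreover have "openin X {x. \<exists>y\<in>Q. f x = Some y}" if Q: "openin X Q" for Q
  proof (subst openin_subopen, clarify)
    fix x y assume "y \<in> Q" "f x = Some y"
    moreover from this obtain U where "openin X U" "x \<in> U" "biopen X (f |` U)" using loc by blast
    ultimately show "\<exists>V. openin X V \<and> x \<in> V \<and> V \<subseteq> {x. \<exists>y\<in>Q. f x = Some y}"
      using biopenD(4)[OF \<open>biopen X (f |` U)\<close> Q]
      by (intro exI[of _ "{x. \<exists>y\<in>Q. (f |` U) x = Some y}"]) (auto simp: restrict_Some_iff)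
  qed
  ultimately have "biopen X f" using d by (simp add: biopen_def)
  moreover have "\<exists>U. inj_open X f U \<and> x \<in> U" if "x \<in> dom f" for x
    using loc that unfolding inj_open_def by blast
  ultimately show ?thesis by (simp add: lhomeo_def)
qed

lemma lhomeo_comp:
  assumes "lhomeo X f" "lhomeo X g" shows "lhomeo X (f \<circ>\<^sub>m g)"
proof -
  have bf: "biopen X f" and bg: "biopen X g" using assms by (auto simp: lhomeo_def)
  have "\<exists>W. inj_open X (f \<circ>\<^sub>m g) W \<and> x \<in> W" if "x \<in> dom (f \<circ>\<^sub>m g)" for x
  proof -
    obtain y z where yz: "g x = Some y" "f y = Some z" using \<open>x \<in> dom (f \<circ>\<^sub>m g)\<close> by (auto simp: map_comp_Some_iff)
    obtain U V where U: "inj_open X f U" "y \<in> U" and V: "inj_open X g V" "x \<in> V"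
      using assms yz unfolding lhomeo_def by blast
    define W where "W = V \<inter> {x. \<exists>y\<in>U. g x = Some y}"
    have "openin X W" unfolding W_def using V U biopenD(4)[OF bg] by (auto simp: inj_open_def)
    moreover have "W \<subseteq> dom (f \<circ>\<^sub>m g)" using U by (force simp: W_def inj_open_def map_comp_Some_iff)
    moreover have "inj_on (f \<circ>\<^sub>m g) W"
    proof (rule inj_onI)
      fix a b assume ab: "a \<in> W" "b \<in> W" "(f \<circ>\<^sub>m g) a = (f \<circ>\<^sub>m g) b"
      then obtain a' b' where a: "a' \<in> U" "g a = Some a'" and b: "b' \<in> U" "g b = Some b'" by (auto simp: W_def)
      then have "f a' = f b'" using ab(3) by (simp add: map_comp_def)
      then have "g a = g b" using a b U by (auto simp: inj_open_def inj_on_def)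
      then show "a = b" using ab V by (auto simp: W_def inj_open_def inj_on_def)
    qed
    ultimately have "inj_open X (f \<circ>\<^sub>m g) W" by (simp add: inj_open_def)
    moreover have "x \<in> W" using V U yz by (auto simp: W_def)
    ultimately show ?thesis by blast
  qed
  then show ?thesis using biopen_comp[OF bf bg] by (simp add: lhomeo_def)
qed

lemma lhomeo_pid: "lhomeo X (pid X)"
proof -
  have "inj_open X (pid X) (topspace X)" by (auto simp: inj_open_def inj_on_def pid_def)
  then show ?thesis using biopen_pid by (force simp: lhomeo_def pid_Some_iff)
qed

lemma map_comp_assoc': "(f \<circ>\<^sub>m g) \<circ>\<^sub>m h = f \<circ>\<^sub>m (g \<circ>\<^sub>m h)"
  by (rule ext) (simp add: map_comp_def split: option.splits)

lemma pid_comp: assumes "biopen X f" shows "pid X \<circ>\<^sub>m f = f" "f \<circ>\<^sub>m pid X = f"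
proof -
  have "(pid X \<circ>\<^sub>m f) x = Some y \<longleftrightarrow> f x = Some y" "(f \<circ>\<^sub>m pid X) x = Some y \<longleftrightarrow> f x = Some y" for x y
    using biopenD(1,2)[OF assms] by (auto simp: map_comp_Some_iff pid_Some_iff)
  then show "pid X \<circ>\<^sub>m f = f" "f \<circ>\<^sub>m pid X = f" by (metis ext option.exhaust)+
qed

lemma lhomeo_ppow: "lhomeo X f \<Longrightarrow> lhomeo X (ppow X f k)"
  by (induction k) (simp_all add: lhomeo_pid lhomeo_comp)

lemma biopen_ppow: "lhomeo X f \<Longrightarrow> biopen X (ppow X f k)"
  using lhomeo_ppow lhomeo_def by blast

lemma ppow_add: "lhomeo X f \<Longrightarrow> ppow X f (a + b) = ppow X f a \<circ>\<^sub>m ppow X f b"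
  by (induction a) (simp_all add: pid_comp biopen_ppow map_comp_assoc')

lemma ppow_commute1:
  assumes "f \<circ>\<^sub>m g = g \<circ>\<^sub>m f" "biopen X g" shows "ppow X f k \<circ>\<^sub>m g = g \<circ>\<^sub>m ppow X f k"
proof (induction k)
  case (Suc k)
  have "ppow X f (Suc k) \<circ>\<^sub>m g = f \<circ>\<^sub>m (g \<circ>\<^sub>m ppow X f k)" by (simp add: map_comp_assoc' Suc)
  also have "\<dots> = g \<circ>\<^sub>m ppow X f (Suc k)" by (simp add: assms(1) flip: map_comp_assoc')
  finally show ?case .
qed (simp add: pid_comp assms)

locale commuting_lhomeos =
  fixes X :: "'x topology" and r :: nat and T :: "nat \<Rightarrow> 'x \<rightharpoonup> 'x"
  assumes lh: "j < r \<Longrightarrow> lhomeo X (T j)"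
    and comm: "i < r \<Longrightarrow> j < r \<Longrightarrow> T i \<circ>\<^sub>m T j = T j \<circ>\<^sub>m T i"
begin

text \<open>The list is left arbitrary so that facts about \<open>mpow\<close>, which folds over
  \<open>[0..<r]\<close>, can be proved by induction on it.\<close>

abbreviation "pw js n \<equiv> foldr (\<lambda>j g. ppow X (T j) (n j) \<circ>\<^sub>m g) js (pid X)"

lemma lhomeo_pw: "set js \<subseteq> {..<r} \<Longrightarrow> lhomeo X (pw js n)"
  by (induction js) (auto simp: lhomeo_pid intro!: lhomeo_comp lhomeo_ppow lh)

lemma ppow_commute: "i < r \<Longrightarrow> j < r \<Longrightarrow> ppow X (T i) a \<circ>\<^sub>m ppow X (T j) b = ppow X (T j) b \<circ>\<^sub>m ppow X (T i) a"
  using ppow_commute1[OF ppow_commute1[OF comm[of j i], symmetric], of X X b a] lh biopen_ppow lhomeo_def by metis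

lemma ppow_pw_commute:
  assumes "i < r" "set js \<subseteq> {..<r}"
  shows "ppow X (T i) a \<circ>\<^sub>m pw js n = pw js n \<circ>\<^sub>m ppow X (T i) a"
  using assms(2)
proof (induction js)
  case Nil
  then show ?case by (simp add: pid_comp biopen_ppow lh assms)
next
  case (Cons j js)
  have "ppow X (T i) a \<circ>\<^sub>m pw (j # js) n = ppow X (T j) (n j) \<circ>\<^sub>m (ppow X (T i) a \<circ>\<^sub>m pw js n)"
    using Cons.prems ppow_commute[of i j a "n j"] assms by (simp flip: map_comp_assoc')
  also have "\<dots> = pw (j # js) n \<circ>\<^sub>m ppow X (T i) a" using Cons by (simp add: map_comp_assoc')
  finally show ?case .
qed

text \<open>Commutation of the generators enters here: a power of \<open>T j\<close> has to be moved
  past the powers of the remaining generators.\<close>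

lemma pw_add: "set js \<subseteq> {..<r} \<Longrightarrow> pw js (\<lambda>j. m j + n j) = pw js m \<circ>\<^sub>m pw js n"
proof (induction js)
  case Nil
  then show ?case by (simp add: pid_comp biopen_pid)
next
  case (Cons j js)
  have "pw (j # js) (\<lambda>j. m j + n j) = ppow X (T j) (m j) \<circ>\<^sub>m ((ppow X (T j) (n j) \<circ>\<^sub>m pw js m) \<circ>\<^sub>m pw js n)"
    using Cons by (simp add: ppow_add lh map_comp_assoc')
  also have "ppow X (T j) (n j) \<circ>\<^sub>m pw js m = pw js m \<circ>\<^sub>m ppow X (T j) (n j)"
    using Cons.prems by (intro ppow_pw_commute) auto
  finally show ?case by (simp add: map_comp_assoc')
qed

lemma lhomeo_mpow: "lhomeo X (mpow X r T n)"
  unfolding mpow_def by (rule lhomeo_pw) auto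

lemma biopen_mpow: "biopen X (mpow X r T n)"
  using lhomeo_mpow lhomeo_def by blast

lemma mpow_add: "mpow X r T (\<lambda>j. m j + n j) = mpow X r T m \<circ>\<^sub>m mpow X r T n"
  unfolding mpow_def by (rule pw_add) auto

lemma mpow_zero: "mpow X r T (\<lambda>_. 0) = pid X"
proof -
  have "pw js (\<lambda>_. 0) = pid X" for js by (induction js) (simp_all add: pid_comp biopen_pid)
  then show ?thesis by (simp add: mpow_def)
qed

end

section \<open>The semidirect product groupoid as a slice groupoid\<close>

lemma map_comp_cong: "g x = g' y \<Longrightarrow> (f \<circ>\<^sub>m g) x = (f \<circ>\<^sub>m g') y"
  by (simp add: map_comp_def)

definition sdp_slices :: "'x topology \<Rightarrow> nat \<Rightarrow> (nat \<Rightarrow> 'x \<rightharpoonup> 'x) \<Rightarrow> ('x \<times> (nat \<Rightarrow> int) \<times> 'x) set set" where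
  "sdp_slices X r T = {sdp_basic X r T U m n V | U m n V. m \<in> multi_indices r \<and> n \<in> multi_indices r \<and>
     inj_open X (mpow X r T m) U \<and> inj_open X (mpow X r T n) V}"

lemma sdp_basic_iff:
  "(x, z, y) \<in> sdp_basic X r T U m n V \<longleftrightarrow>
    z = mdiff m n \<and> x \<in> U \<and> y \<in> V \<and> mpow X r T m x = mpow X r T n y"
  by (auto simp: sdp_basic_def)

lemma sdp_arrows_iff:
  "(x, z, y) \<in> sdp_arrows X r T \<longleftrightarrow> (\<exists>m\<in>multi_indices r. \<exists>n\<in>multi_indices r. z = mdiff m n \<and>
     x \<in> dom (mpow X r T m) \<and> y \<in> dom (mpow X r T n) \<and> mpow X r T m x = mpow X r T n y)"
  by (auto simp: sdp_arrows_def)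

locale mgds_dc =
  fixes X :: "'x topology" and r :: nat and T :: "nat \<Rightarrow> 'x \<rightharpoonup> 'x"
  assumes hausdorff: "Hausdorff_space X" and locally_compact: "locally_compact_space X"
    and mgds: "mgds X r T" and domain_condition: "domain_condition X r T"
begin

sublocale commuting_lhomeos X r T
  using mgds lhomeo_if_partial_local_homeo by unfold_locales (auto simp: mgds_def)

abbreviation "Tm \<equiv> mpow X r T"
abbreviation "MI \<equiv> multi_indices r"

section \<open>Local solution sets of the equations T^m x = T^n y\<close>

lemma DC:
  assumes "m \<in> MI" "n \<in> MI" "x \<in> dom (Tm m)" "x \<in> dom (Tm n)"
  shows "x \<in> dom (Tm (\<lambda>j. max (m j) (n j)))"
  using domain_condition assms unfolding domain_condition_def by blast

text \<open>Applying T^k to both sides loses no information near the common value \<open>w\<close>,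
  because T^k is injective on a neighbourhood \<open>N\<close> of \<open>w\<close>; \<open>U\<close>
  and \<open>V\<close> are the preimages of \<open>N\<close>.\<close>

lemma equation_shift:
  assumes x: "x \<in> dom (Tm ((\<lambda>j. k j + m j)))" and xy: "Tm m x = Tm n y"
  shows "\<exists>U V. openin X U \<and> openin X V \<and> x \<in> U \<and> y \<in> V \<and>
    (\<forall>x'\<in>U. \<forall>y'\<in>V. Tm m x' = Tm n y' \<longleftrightarrow> Tm (\<lambda>j. k j + m j) x' = Tm (\<lambda>j. k j + n j) y')"
proof -
  obtain w where w: "Tm m x = Some w" "Tm n y = Some w" "w \<in> dom (Tm k)"
    using x xy by (force simp: mpow_add map_comp_Some_iff)
  then obtain N where N: "inj_open X (Tm k) N" "w \<in> N" using lhomeo_mpow[of k] unfolding lhomeo_def by blast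
  have oN: "openin X N" using N by (simp add: inj_open_def)
  define U where "U = {x. \<exists>w\<in>N. Tm m x = Some w}"
  define V where "V = {y. \<exists>w\<in>N. Tm n y = Some w}"
  have "openin X U" "openin X V" unfolding U_def V_def using biopenD(4)[OF biopen_mpow oN] by auto
  moreover have "x \<in> U" "y \<in> V" using w N by (auto simp: U_def V_def)
  moreover have "Tm m x' = Tm n y' \<longleftrightarrow> Tm (\<lambda>j. k j + m j) x' = Tm (\<lambda>j. k j + n j) y'"
    if xy': "x' \<in> U" "y' \<in> V" for x' y'
  proof -
    obtain a b where ab: "Tm m x' = Some a" "a \<in> N" "Tm n y' = Some b" "b \<in> N"
      using xy' unfolding U_def V_def by blast
    have "inj_on (Tm k) N" using N by (simp add: inj_open_def)
    then have "a = b \<longleftrightarrow> Tm k a = Tm k b" using ab by (simp add: inj_on_eq_iff)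
    then show ?thesis using ab by (simp add: mpow_add map_comp_def)
  qed
  ultimately show ?thesis by (intro exI[of _ U] exI[of _ V]) blast
qed

text \<open>Here the domain condition makes the local solution sets of \<open>T\<^sup>m x = T\<^sup>n y\<close> depend on
  \<open>m - n\<close> only: both equations are compared with the one for the componentwise maxima.\<close>

lemma equation_local:
  assumes MI: "m \<in> MI" "n \<in> MI" "m' \<in> MI" "n' \<in> MI" and d: "mdiff m n = mdiff m' n'"
    and x: "x \<in> dom (Tm m)" "x \<in> dom (Tm m')" and eq: "Tm m x = Tm n y" "Tm m' x = Tm n' y"
  obtains U V where "openin X U" "openin X V" "x \<in> U" "y \<in> V"
    "\<And>x' y'. x' \<in> U \<Longrightarrow> y' \<in> V \<Longrightarrow> Tm m x' = Tm n y' \<longleftrightarrow> Tm m' x' = Tm n' y'"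
proof -
  \<comment> \<open>With these exponents m + k = m' + k' is the maximum, and n + k = n' + k' because
    the differences agree. The subtractions are exact.\<close>
  define k where "k j = max (m j) (m' j) - m j" for j
  define k' where "k' j = max (m j) (m' j) - m' j" for j
  have d': "int (m j) - int (n j) = int (m' j) - int (n' j)" for j
    using d by (simp add: mdiff_def fun_eq_iff)
  have km: "(\<lambda>j. k j + m j) = (\<lambda>j. max (m j) (m' j))" "(\<lambda>j. k' j + m' j) = (\<lambda>j. max (m j) (m' j))"
    by (auto simp: k_def k'_def)
  have kn: "(\<lambda>j. k j + n j) = (\<lambda>j. k' j + n' j)"
  proof
    show "k j + n j = k' j + n' j" for j using d'[of j] unfolding k_def k'_def by linarith
  qed
  have dom: "x \<in> dom (Tm (\<lambda>j. max (m j) (m' j)))" using DC MI x by blast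
  obtain U V where UV: "openin X U" "openin X V" "x \<in> U" "y \<in> V"
    "\<forall>x'\<in>U. \<forall>y'\<in>V. Tm m x' = Tm n y' \<longleftrightarrow> Tm (\<lambda>j. k j + m j) x' = Tm (\<lambda>j. k j + n j) y'"
    using equation_shift[of x k m n y] dom eq unfolding km by blast
  obtain U' V' where UV': "openin X U'" "openin X V'" "x \<in> U'" "y \<in> V'"
    "\<forall>x'\<in>U'. \<forall>y'\<in>V'. Tm m' x' = Tm n' y' \<longleftrightarrow> Tm (\<lambda>j. k' j + m' j) x' = Tm (\<lambda>j. k' j + n' j) y'"
    using equation_shift[of x k' m' n' y] dom eq unfolding km by blast
  show ?thesis
    using UV UV' by (intro that[of "U \<inter> U'" "V \<inter> V'"]) (auto simp: km kn)
qed

text \<open>Two equations that meet at y are raised to the common exponent max(n, m') there;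
  \<open>p\<close> and \<open>q\<close> are m and n' increased by the same amounts as n and m'. The
  condition on y stays a hypothesis because it describes an open set, which serves later as the
  neighbourhood of the middle point.\<close>

lemma mult_equation:
  assumes MI: "m \<in> MI" "n \<in> MI" "m' \<in> MI" "n' \<in> MI"
  shows "\<exists>p\<in>MI. \<exists>q\<in>MI. (\<forall>j. mdiff p q j = mdiff m n j + mdiff m' n' j) \<and>
    (\<forall>x y w. y \<in> dom (Tm (\<lambda>j. max (n j) (m' j))) \<longrightarrow> Tm m x = Tm n y \<longrightarrow> Tm m' y = Tm n' w \<longrightarrow>
      x \<in> dom (Tm p) \<and> w \<in> dom (Tm q) \<and> Tm p x = Tm q w)"
proof -
  define k where "k j = max (n j) (m' j) - n j" for j
  define k' where "k' j = max (n j) (m' j) - m' j" for j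
  define p where "p j = k j + m j" for j
  define q where "q j = k' j + n' j" for j
  have kk: "(\<lambda>j. k j + n j) = (\<lambda>j. max (n j) (m' j))" "(\<lambda>j. k' j + m' j) = (\<lambda>j. max (n j) (m' j))"
    by (auto simp: k_def k'_def)
  have "p \<in> MI" "q \<in> MI" using MI by (auto simp: multi_indices_def p_def q_def k_def k'_def)
  moreover have "mdiff p q j = mdiff m n j + mdiff m' n' j" for j
    using fun_cong[OF kk(1), of j] fun_cong[OF kk(2), of j] by (simp add: mdiff_def p_def q_def)
  moreover have "x \<in> dom (Tm p) \<and> w \<in> dom (Tm q) \<and> Tm p x = Tm q w"
    if "y \<in> dom (Tm (\<lambda>j. max (n j) (m' j)))" "Tm m x = Tm n y" "Tm m' y = Tm n' w" for x y w
  proof -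
    have "Tm p x = Tm (\<lambda>j. k j + n j) y"
      unfolding p_def[abs_def] mpow_add by (rule map_comp_cong) fact
    moreover have "Tm q w = Tm (\<lambda>j. k' j + m' j) y"
      unfolding q_def[abs_def] mpow_add by (rule map_comp_cong) (simp add: that)
    ultimately show ?thesis using that(1) by (auto simp: kk)
  qed
  ultimately show ?thesis by (intro bexI[of _ p] bexI[of _ q]) simp_all
qed

lemma sdp_slicesE:
  assumes "W \<in> sdp_slices X r T"
  obtains U m n V where "W = sdp_basic X r T U m n V" "m \<in> MI" "n \<in> MI"
    "inj_open X (Tm m) U" "inj_open X (Tm n) V"
  using assms by (auto simp: sdp_slices_def)

lemma sdp_slicesI:
  "m \<in> MI \<Longrightarrow> n \<in> MI \<Longrightarrow> inj_open X (Tm m) U \<Longrightarrow> inj_open X (Tm n) V \<Longrightarrow>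
    sdp_basic X r T U m n V \<in> sdp_slices X r T"
  by (auto simp: sdp_slices_def)

lemma Union_sdp_slices: "\<Union>(sdp_slices X r T) = sdp_arrows X r T"
proof (intro subset_antisym subsetI)
  fix a assume "a \<in> \<Union>(sdp_slices X r T)"
  then obtain W where "W \<in> sdp_slices X r T" "a \<in> W" by blast
  then obtain U m n V where *: "a \<in> sdp_basic X r T U m n V" "m \<in> MI" "n \<in> MI"
    "inj_open X (Tm m) U" "inj_open X (Tm n) V" by (auto elim!: sdp_slicesE)
  obtain x z y where a: "a = (x, z, y)" by (cases a) auto
  show "a \<in> sdp_arrows X r T"
    unfolding a sdp_arrows_iff
    by (rule bexI[OF _ *(2)], rule bexI[OF _ *(3)]) (use * in \<open>auto simp: a sdp_basic_iff inj_open_def\<close>)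
next
  fix a assume a: "a \<in> sdp_arrows X r T"
  obtain x z y where xyz: "a = (x, z, y)" by (cases a) auto
  then obtain m n where mn: "m \<in> MI" "n \<in> MI" "z = mdiff m n" "x \<in> dom (Tm m)" "y \<in> dom (Tm n)" "Tm m x = Tm n y"
    using a by (auto simp: sdp_arrows_iff)
  obtain U where U: "inj_open X (Tm m) U" "x \<in> U" using lhomeo_mpow mn(4) unfolding lhomeo_def by blast
  obtain V where V: "inj_open X (Tm n) V" "y \<in> V" using lhomeo_mpow mn(5) unfolding lhomeo_def by blast
  have "a \<in> sdp_basic X r T U m n V" using xyz mn U V by (simp add: sdp_basic_iff)
  then show "a \<in> \<Union>(sdp_slices X r T)" using sdp_slicesI[OF mn(1,2) U(1) V(1)] by blast
qed

lemma sdp_basic_inverse: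
  "(\<lambda>(x, z, y). (y, \<lambda>j. - z j, x)) ` sdp_basic X r T U m n V = sdp_basic X r T V n m U"
  by (force simp: sdp_basic_def mdiff_def image_iff)

lemma sdp_slices_local:
  assumes W: "W \<in> sdp_slices X r T" "W' \<in> sdp_slices X r T" "a \<in> W" "a \<in> W'"
  shows "\<exists>U V. openin X U \<and> openin X V \<and> fst a \<in> U \<and> snd (snd a) \<in> V \<and>
    (\<forall>b\<in>W. fst b \<in> U \<longrightarrow> snd (snd b) \<in> V \<longrightarrow> b \<in> W')"
proof -
  obtain U m n V where 1: "W = sdp_basic X r T U m n V" "m \<in> MI" "n \<in> MI"
    "inj_open X (Tm m) U" "inj_open X (Tm n) V" using W(1) by (rule sdp_slicesE)
  obtain U' m' n' V' where 2: "W' = sdp_basic X r T U' m' n' V'" "m' \<in> MI" "n' \<in> MI"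
    "inj_open X (Tm m') U'" "inj_open X (Tm n') V'" using W(2) by (rule sdp_slicesE)
  obtain x z y where a: "a = (x, z, y)" by (cases a) auto
  have xy: "z = mdiff m n" "mdiff m n = mdiff m' n'" "x \<in> U" "x \<in> U'" "y \<in> V" "y \<in> V'" "Tm m x = Tm n y" "Tm m' x = Tm n' y"
    using W(3,4) by (auto simp: 1(1) 2(1) a sdp_basic_iff)
  have "x \<in> dom (Tm m)" "x \<in> dom (Tm m')" using xy 1(4) 2(4) by (auto simp: inj_open_def)
  then obtain A B where AB: "openin X A" "openin X B" "x \<in> A" "y \<in> B"
    "\<And>x' y'. x' \<in> A \<Longrightarrow> y' \<in> B \<Longrightarrow> Tm m x' = Tm n y' \<longleftrightarrow> Tm m' x' = Tm n' y'"
    using equation_local[OF 1(2,3) 2(2,3) xy(2), of x y] xy(7,8) by blast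
  have op: "openin X (A \<inter> U')" "openin X (B \<inter> V')" using AB 2 by (auto simp: inj_open_def)
  have "b \<in> W'" if "b \<in> W" "fst b \<in> A \<inter> U'" "snd (snd b) \<in> B \<inter> V'" for b
  proof -
    obtain x' z' y' where b: "b = (x', z', y')" by (cases b) auto
    show ?thesis using that AB(5)[of x' y'] xy(2) by (simp add: 1(1) 2(1) b sdp_basic_iff)
  qed
  then show ?thesis using op AB(3,4) xy a by (intro exI[of _ "A \<inter> U'"] exI[of _ "B \<inter> V'"]) auto
qed

text \<open>Products of the first two slices satisfy the equation with the exponents of
  \<open>mult_equation\<close>. Its difference equals that of the exponents of \<open>W3\<close>, so
  \<open>equation_local\<close> exchanges the one equation for the other near the end points of the
  product.\<close>

lemma sdp_slices_mult:
  assumes W: "W1 \<in> sdp_slices X r T" "W2 \<in> sdp_slices X r T" "W3 \<in> sdp_slices X r T"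
    and ab: "a \<in> W1" "b \<in> W2" "snd (snd a) = fst b" "gmult (sdp_groupoid X r T) a b \<in> W3"
  shows "\<exists>U V V'. openin X U \<and> openin X V \<and> openin X V' \<and> fst a \<in> U \<and> snd (snd a) \<in> V \<and> snd (snd b) \<in> V' \<and>
    (\<forall>a'\<in>W1. \<forall>b'\<in>W2. snd (snd a') = fst b' \<longrightarrow> fst a' \<in> U \<longrightarrow> snd (snd a') \<in> V \<longrightarrow> snd (snd b') \<in> V' \<longrightarrow>
      gmult (sdp_groupoid X r T) a' b' \<in> W3)"
proof -
  obtain U1 m1 n1 V1 where 1: "W1 = sdp_basic X r T U1 m1 n1 V1" "m1 \<in> MI" "n1 \<in> MI"
    "inj_open X (Tm m1) U1" "inj_open X (Tm n1) V1" using W(1) by (rule sdp_slicesE)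
  obtain U2 m2 n2 V2 where 2: "W2 = sdp_basic X r T U2 m2 n2 V2" "m2 \<in> MI" "n2 \<in> MI"
    "inj_open X (Tm m2) U2" "inj_open X (Tm n2) V2" using W(2) by (rule sdp_slicesE)
  obtain U m n V where 3: "W3 = sdp_basic X r T U m n V" "m \<in> MI" "n \<in> MI"
    "inj_open X (Tm m) U" "inj_open X (Tm n) V" using W(3) by (rule sdp_slicesE)
  obtain x z y where a: "a = (x, z, y)" by (cases a) auto
  obtain z' w where b: "b = (y, z', w)" using ab(3) a by (cases b) auto
  have xy: "Tm m1 x = Tm n1 y" "Tm m2 y = Tm n2 w" "y \<in> V1" "y \<in> U2" "z = mdiff m1 n1" "z' = mdiff m2 n2"
    using ab(1,2) by (auto simp: 1(1) 2(1) a b sdp_basic_iff)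
  have xw: "Tm m x = Tm n w" "x \<in> U" "w \<in> V" and d: "(\<lambda>j. z j + z' j) = mdiff m n"
    using ab(4) by (auto simp: 3(1) a b sdp_groupoid_def sdp_basic_iff)
  obtain p q where pq: "p \<in> MI" "q \<in> MI" "\<And>j. mdiff p q j = mdiff m1 n1 j + mdiff m2 n2 j"
    and eq: "\<And>x y w. y \<in> dom (Tm (\<lambda>j. max (n1 j) (m2 j))) \<Longrightarrow> Tm m1 x = Tm n1 y \<Longrightarrow> Tm m2 y = Tm n2 w \<Longrightarrow>
      x \<in> dom (Tm p) \<and> w \<in> dom (Tm q) \<and> Tm p x = Tm q w"
    using mult_equation[OF 1(2,3) 2(2,3)] by blast
  let ?D = "dom (Tm (\<lambda>j. max (n1 j) (m2 j)))"
  have "y \<in> dom (Tm n1)" "y \<in> dom (Tm m2)" using 1(5) 2(4) xy(3,4) by (auto simp: inj_open_def)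
  then have yD: "y \<in> ?D" by (rule DC[OF 1(3) 2(2)])
  have dpq: "mdiff p q = mdiff m n" using pq(3) d xy by (auto simp: fun_eq_iff)
  have "x \<in> dom (Tm m)" using xw 3 by (auto simp: inj_open_def)
  then obtain A B where AB: "openin X A" "openin X B" "x \<in> A" "w \<in> B"
    "\<And>x' y'. x' \<in> A \<Longrightarrow> y' \<in> B \<Longrightarrow> Tm p x' = Tm q y' \<longleftrightarrow> Tm m x' = Tm n y'"
    using equation_local[OF pq(1,2) 3(2,3) dpq, of x w] eq[OF yD xy(1,2)] xw(1) by blast
  have op: "openin X (A \<inter> U)" "openin X (B \<inter> V)" "openin X ?D"
    using AB 3 biopen_dom[OF biopen_mpow] by (auto simp: inj_open_def)
  have "gmult (sdp_groupoid X r T) a' b' \<in> W3"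
    if h: "a' \<in> W1" "b' \<in> W2" "snd (snd a') = fst b'" "fst a' \<in> A \<inter> U" "snd (snd a') \<in> ?D" "snd (snd b') \<in> B \<inter> V" for a' b'
  proof -
    obtain x' u' y' where a': "a' = (x', u', y')" by (cases a') auto
    obtain v' w' where b': "b' = (y', v', w')" using h(3) a' by (cases b') auto
    have *: "Tm m1 x' = Tm n1 y'" "Tm m2 y' = Tm n2 w'" "u' = mdiff m1 n1" "v' = mdiff m2 n2"
      using h(1,2) by (auto simp: 1(1) 2(1) a' b' sdp_basic_iff)
    have "y' \<in> ?D" "x' \<in> A" "x' \<in> U" "w' \<in> B" "w' \<in> V" using h(4-6) unfolding a' b' by simp_all
    moreover from this have "Tm m x' = Tm n w'" using eq[of y' x' w'] * AB(5)[of x' w'] by blast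
    ultimately show ?thesis
      using * d xy by (simp add: 3(1) a' b' sdp_groupoid_def sdp_basic_iff)
  qed
  then show ?thesis using op AB(3,4) xw yD a b
    by (intro exI[of _ "A \<inter> U"] exI[of _ ?D] exI[of _ "B \<inter> V"]) auto
qed

text \<open>A slice is the fibre product of T^m on \<open>U\<close> and T^n on \<open>V\<close>, so
  its projections are preimages under one power of images under the other.\<close>

lemma openin_graph_projections:
  assumes "inj_open X (Tm m) U" "inj_open X (Tm n) V" "openin X Q"
  shows "openin X ((\<lambda>a. snd (snd a)) ` {a \<in> sdp_basic X r T U m n V. fst a \<in> Q})"
    and "openin X (fst ` {a \<in> sdp_basic X r T U m n V. snd (snd a) \<in> Q})"
proof -
  have "(\<lambda>a. snd (snd a)) ` {a \<in> sdp_basic X r T U m n V. fst a \<in> Q} =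
      V \<inter> {y. \<exists>z\<in>{z. \<exists>x\<in>U \<inter> Q. Tm m x = Some z}. Tm n y = Some z}"
    using assms(1,2) by (force simp: sdp_basic_def inj_open_def image_iff)
  then show "openin X ((\<lambda>a. snd (snd a)) ` {a \<in> sdp_basic X r T U m n V. fst a \<in> Q})"
    using biopenD(4)[OF biopen_mpow[of n] biopenD(3)[OF biopen_mpow[of m], of "U \<inter> Q"]] assms
    by (auto simp: inj_open_def)
  have "fst ` {a \<in> sdp_basic X r T U m n V. snd (snd a) \<in> Q} =
      U \<inter> {x. \<exists>z\<in>{z. \<exists>y\<in>V \<inter> Q. Tm n y = Some z}. Tm m x = Some z}"
    using assms(1,2) by (force simp: sdp_basic_def inj_open_def image_iff)
  then show "openin X (fst ` {a \<in> sdp_basic X r T U m n V. snd (snd a) \<in> Q})"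
    using biopenD(4)[OF biopen_mpow[of m] biopenD(3)[OF biopen_mpow[of n], of "V \<inter> Q"]] assms
    by (auto simp: inj_open_def)
qed

sublocale G: slice_groupoid X "sdp_groupoid X r T" "\<lambda>a. snd (snd a)" fst "\<lambda>x. (x, \<lambda>_. 0, x)" "sdp_slices X r T"
proof
  let ?G = "sdp_groupoid X r T"
  have simps: "arrows ?G = sdp_arrows X r T" "gtop ?G = sdp_topology X r T"
    "gmult ?G (x, z, y) (y', z', w) = (x, (\<lambda>j. z j + z' j), w)" "ginv ?G (x, z, y) = (y, (\<lambda>j. - z j), x)"
    for x z y y' z' w by (simp_all add: sdp_groupoid_def)
  have gm: "gmult ?G a b = (fst a, (\<lambda>j. fst (snd a) j + fst (snd b) j), snd (snd b))"
    and gi: "ginv ?G a = (snd (snd a), (\<lambda>j. - fst (snd a) j), fst a)" for a b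
    by (cases a; cases b; simp add: simps)+
  have md: "(\<lambda>j. - mdiff m n j) = mdiff n m" for m n by (auto simp: mdiff_def)
  show "Hausdorff_space X" by (rule hausdorff)
  show "locally_compact_space X" by (rule locally_compact)
  show "gtop ?G = topology_generated_by (sdp_slices X r T)"
    by (simp add: simps sdp_topology_def sdp_slices_def)
  show "\<Union>(sdp_slices X r T) = arrows ?G" by (simp add: Union_sdp_slices simps)
  fix a b d :: "'x \<times> (nat \<Rightarrow> int) \<times> 'x"
  show "ginv ?G a \<in> arrows ?G" if "a \<in> arrows ?G"
    using that unfolding simps gi by (cases a) (fastforce simp: sdp_arrows_iff md)
  show "ginv ?G (ginv ?G a) = a" by (simp add: gi)
  show "snd (snd (ginv ?G a)) = fst a" by (simp add: gi)
  show "snd (snd a) \<in> topspace X" if "a \<in> arrows ?G"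
    using that biopenD(1)[OF biopen_mpow] unfolding simps by (cases a) (auto simp: sdp_arrows_iff)
  show "gmult ?G a b \<in> arrows ?G" if ab: "a \<in> arrows ?G" "b \<in> arrows ?G" "snd (snd a) = fst b"
  proof -
    obtain x z y where a: "a = (x, z, y)" by (cases a) auto
    obtain z' w where b: "b = (y, z', w)" using ab(3) a by (cases b) auto
    obtain m n where mn: "m \<in> MI" "n \<in> MI" "z = mdiff m n" "x \<in> dom (Tm m)" "y \<in> dom (Tm n)" "Tm m x = Tm n y"
      using ab(1) by (auto simp: simps a sdp_arrows_iff)
    obtain m' n' where mn': "m' \<in> MI" "n' \<in> MI" "z' = mdiff m' n'" "y \<in> dom (Tm m')" "w \<in> dom (Tm n')" "Tm m' y = Tm n' w"
      using ab(2) by (auto simp: simps b sdp_arrows_iff)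
    obtain p q where pq: "p \<in> MI" "q \<in> MI" "\<And>j. mdiff p q j = mdiff m n j + mdiff m' n' j"
      and eq: "\<And>x y w. y \<in> dom (Tm (\<lambda>j. max (n j) (m' j))) \<Longrightarrow> Tm m x = Tm n y \<Longrightarrow> Tm m' y = Tm n' w \<Longrightarrow>
        x \<in> dom (Tm p) \<and> w \<in> dom (Tm q) \<and> Tm p x = Tm q w"
      using mult_equation[OF mn(1,2) mn'(1,2)] by blast
    have "y \<in> dom (Tm (\<lambda>j. max (n j) (m' j)))" using DC mn mn' by blast
    from eq[OF this mn(6) mn'(6)] show ?thesis unfolding a b simps sdp_arrows_iff
      using pq(3) mn(3) mn'(3) by (intro bexI[OF _ pq(1)] bexI[OF _ pq(2)]) auto
  qed
  show "snd (snd (gmult ?G a b)) = snd (snd b)" "fst (gmult ?G a b) = fst a" by (simp_all add: gm)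
  show "gmult ?G (gmult ?G a b) d = gmult ?G a (gmult ?G b d)" by (simp add: gm add.assoc)
  show "gmult ?G (ginv ?G a) a = (snd (snd a), \<lambda>_. 0, snd (snd a))" by (simp add: gm gi)
  show "gmult ?G (fst a, \<lambda>_. 0, fst a) a = a" by (simp add: gm)
  show "(x, \<lambda>_. 0, x) \<in> arrows ?G" if "x \<in> topspace X" for x
  proof -
    have "(\<lambda>_. 0) \<in> MI" "mdiff (\<lambda>_. 0) (\<lambda>_. 0) = (\<lambda>_. 0)" by (auto simp: multi_indices_def mdiff_def)
    moreover have "x \<in> dom (Tm (\<lambda>_. 0))" using that by (auto simp: mpow_zero pid_Some_iff)
    ultimately show ?thesis unfolding simps sdp_arrows_iff by metis
  qed
  show "snd (snd (x, \<lambda>_. 0, x)) = x" for x :: 'x by simp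
  fix W assume W: "W \<in> sdp_slices X r T"
  obtain U m n V where 1: "W = sdp_basic X r T U m n V" "m \<in> MI" "n \<in> MI"
    "inj_open X (Tm m) U" "inj_open X (Tm n) V" using W by (rule sdp_slicesE)
  show "inj_on (\<lambda>a. snd (snd a)) W"
    using 1(4) by (auto simp: 1(1) sdp_basic_def inj_on_def inj_open_def)
  show "inj_on fst W"
    using 1(5) by (auto simp: 1(1) sdp_basic_def inj_on_def inj_open_def)
  fix Q assume Q: "openin X Q"
  show "openin X ((\<lambda>a. snd (snd a)) ` {a \<in> W. fst a \<in> Q})" "openin X (fst ` {a \<in> W. snd (snd a) \<in> Q})"
    unfolding 1(1) using openin_graph_projections 1(4,5) Q by blast+
  have "{a \<in> W. snd (snd a) \<in> Q} = sdp_basic X r T U m n (V \<inter> Q)"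
    unfolding 1(1) sdp_basic_def by auto
  moreover have "inj_open X (Tm n) (V \<inter> Q)" using 1(5) Q by (auto simp: inj_open_def inj_on_def)
  ultimately show "{a \<in> W. snd (snd a) \<in> Q} \<in> sdp_slices X r T" using 1 sdp_slicesI by metis
next
  fix W assume W: "W \<in> sdp_slices X r T"
  then show "ginv (sdp_groupoid X r T) ` W \<in> sdp_slices X r T"
    by (elim sdp_slicesE) (auto simp: sdp_groupoid_def sdp_basic_inverse intro: sdp_slicesI)
qed (fact sdp_slices_local sdp_slices_mult)+

end

section \<open>The groupoid of germs as a slice groupoid\<close>

lemma agree_near_sym: "agree_near X y S R \<Longrightarrow> agree_near X y R S"
  unfolding agree_near_def by (metis Int_commute)

lemma agree_near_trans:
  assumes "agree_near X y S R" "agree_near X y R Q" shows "agree_near X y S Q"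
proof -
  obtain V where V: "openin X V" "y \<in> V" "V \<subseteq> dom S \<inter> dom R" "\<And>w. w \<in> V \<Longrightarrow> S w = R w"
    using assms(1) unfolding agree_near_def by blast
  obtain W where W: "openin X W" "y \<in> W" "W \<subseteq> dom R \<inter> dom Q" "\<And>w. w \<in> W \<Longrightarrow> R w = Q w"
    using assms(2) unfolding agree_near_def by blast
  show ?thesis unfolding agree_near_def using V W by (intro exI[of _ "V \<inter> W"]) auto
qed

lemma agree_near_refl: "biopen X S \<Longrightarrow> y \<in> dom S \<Longrightarrow> agree_near X y S S"
  unfolding agree_near_def using biopen_dom by blast

lemma agree_near_eq: "agree_near X y S R \<Longrightarrow> S y = R y"
  unfolding agree_near_def by blast

lemma agree_near_comp:
  assumes "biopen X S'" "S' z = Some y" "agree_near X y S R" "agree_near X z S' R'"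
  shows "agree_near X z (S \<circ>\<^sub>m S') (R \<circ>\<^sub>m R')"
proof -
  obtain V where V: "openin X V" "y \<in> V" "V \<subseteq> dom S \<inter> dom R" "\<And>w. w \<in> V \<Longrightarrow> S w = R w"
    using assms(3) unfolding agree_near_def by blast
  obtain W where W: "openin X W" "z \<in> W" "W \<subseteq> dom S' \<inter> dom R'" "\<And>w. w \<in> W \<Longrightarrow> S' w = R' w"
    using assms(4) unfolding agree_near_def by blast
  let ?N = "W \<inter> {z. \<exists>y\<in>V. S' z = Some y}"
  have o: "openin X ?N" using W(1) biopenD(4)[OF assms(1) V(1)] by blast
  have eq: "(S \<circ>\<^sub>m S') w = (R \<circ>\<^sub>m R') w \<and> w \<in> dom (S \<circ>\<^sub>m S')" if wN: "w \<in> ?N" for w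
  proof -
    obtain v where v: "v \<in> V" "S' w = Some v" using wN by blast
    then have "R' w = Some v" "R v = S v" using W(4)[of w] V(4) wN by auto
    moreover obtain u where "S v = Some u" using V(3) v by blast
    ultimately show ?thesis using v by (simp add: map_comp_def domI)
  qed
  have "?N \<subseteq> dom (S \<circ>\<^sub>m S') \<inter> dom (R \<circ>\<^sub>m R')"
  proof
    fix w assume "w \<in> ?N"
    from eq[OF this] show "w \<in> dom (S \<circ>\<^sub>m S') \<inter> dom (R \<circ>\<^sub>m R')" by (metis IntI domIff)
  qed
  moreover have "z \<in> ?N" using W(2) V(2) assms(2) by auto
  ultimately show ?thesis unfolding agree_near_def using o eq by (intro exI[of _ ?N]) blast
qed

lemma agree_near_pinv:
  assumes "partial_homeo X S" "partial_homeo X R" "S y = Some x" "agree_near X y S R"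
  shows "agree_near X x (pinv S) (pinv R)"
proof -
  obtain V where V: "openin X V" "y \<in> V" "V \<subseteq> dom S \<inter> dom R" "\<And>w. w \<in> V \<Longrightarrow> S w = R w"
    using assms(4) unfolding agree_near_def by blast
  have S: "biopen X S" "\<And>a b. pinv S b = Some a \<longleftrightarrow> S a = Some b"
    and R: "\<And>a b. pinv R b = Some a \<longleftrightarrow> R a = Some b"
    using assms(1,2) by (simp_all add: partial_homeo_iff pinv_Some_iff)
  let ?N = "{x. \<exists>y\<in>V. S y = Some x}"
  have eq: "\<exists>w. pinv S v = Some w \<and> pinv R v = Some w" if vN: "v \<in> ?N" for v
  proof -
    obtain w where "w \<in> V" "S w = Some v" using vN by blast
    then show ?thesis using V(4)[of w] by (auto simp: S R)
  qed
  have "openin X ?N" by (rule biopenD(3)[OF S(1) V(1)])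
  moreover have "x \<in> ?N" using V(2) assms(3) by blast
  moreover have "?N \<subseteq> dom (pinv S) \<inter> dom (pinv R)" "\<forall>v\<in>?N. pinv S v = pinv R v" using eq by force+
  ultimately show ?thesis unfolding agree_near_def by blast
qed

lemma UN_const_eq: "a \<in> A \<Longrightarrow> (\<And>b. b \<in> A \<Longrightarrow> F b = C) \<Longrightarrow> (\<Union>b\<in>A. F b) = C"
  by blast

text \<open>Read off from an arbitrary representative: all representatives of a germ have the same
  end points, and only the partial map varies (\<open>SOME_germ\<close>).\<close>

definition germ_src :: "('x \<times> ('x \<rightharpoonup> 'x) \<times> 'x) set \<Rightarrow> 'x" where
  "germ_src a = snd (snd (SOME p. p \<in> a))"

definition germ_rng :: "('x \<times> ('x \<rightharpoonup> 'x) \<times> 'x) set \<Rightarrow> 'x" where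
  "germ_rng a = fst (SOME p. p \<in> a)"

definition germ_slices :: "'x topology \<Rightarrow> ('x \<rightharpoonup> 'x) set \<Rightarrow> ('x \<times> ('x \<rightharpoonup> 'x) \<times> 'x) set set set" where
  "germ_slices X P = {{germ X P (the (S y)) S y | y. y \<in> W} | S W. S \<in> P \<and> openin X W \<and> W \<subseteq> dom S}"

locale lc_pseudogroup =
  fixes X :: "'x topology" and P :: "('x \<rightharpoonup> 'x) set"
  assumes hausdorff: "Hausdorff_space X" and locally_compact: "locally_compact_space X"
    and pg: "pseudogroup X P"
begin

lemma P_homeo: "S \<in> P \<Longrightarrow> partial_homeo X S" and P_pid: "pid X \<in> P"
  and P_comp: "S \<in> P \<Longrightarrow> R \<in> P \<Longrightarrow> S \<circ>\<^sub>m R \<in> P" and P_pinv: "S \<in> P \<Longrightarrow> pinv S \<in> P"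
  using pg by (auto simp: pseudogroup_def)

lemma P_biopen: "S \<in> P \<Longrightarrow> biopen X S"
  using P_homeo partial_homeo_iff by blast

lemma P_pinv_iff: "S \<in> P \<Longrightarrow> pinv S x = Some y \<longleftrightarrow> S y = Some x"
  using P_homeo[of S] by (simp add: partial_homeo_iff pinv_Some_iff)

lemma mem_germ:
  "(x', S', y') \<in> germ X P x S y \<longleftrightarrow> S \<in> P \<and> S y = Some x \<and> S' \<in> P \<and> S' y' = Some x' \<and>
    y = y' \<and> agree_near X y S S'"
  by (auto simp: germ_def germ_rel_def)

lemma germ_self: "S \<in> P \<Longrightarrow> S y = Some x \<Longrightarrow> (x, S, y) \<in> germ X P x S y"
  using agree_near_refl[OF P_biopen] by (auto simp: mem_germ)

lemma germ_eqI:
  assumes "S \<in> P" "S y = Some x" "R \<in> P" "R y = Some x'" "agree_near X y S R"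
  shows "germ X P x S y = germ X P x' R y"
proof -
  have "agree_near X y S Q \<longleftrightarrow> agree_near X y R Q" for Q
    using assms(5) agree_near_sym agree_near_trans by metis
  then show ?thesis using assms by (auto simp: mem_germ)
qed

lemma germ_eq_iff:
  assumes "S \<in> P" "S y = Some x" "R \<in> P" "R y' = Some x'"
  shows "germ X P x S y = germ X P x' R y' \<longleftrightarrow> y = y' \<and> agree_near X y S R"
proof
  assume "germ X P x S y = germ X P x' R y'"
  then have "(x', R, y') \<in> germ X P x S y" using germ_self[OF assms(3,4)] by simp
  then show "y = y' \<and> agree_near X y S R" unfolding mem_germ by blast
qed (use germ_eqI assms in auto)

lemma SOME_germ:
  assumes "S \<in> P" "S y = Some x"
  obtains R where "(SOME p. p \<in> germ X P x S y) = (x, R, y)"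
proof -
  obtain x' R y' where e: "(SOME p. p \<in> germ X P x S y) = (x', R, y')" using prod_cases3 by blast
  have "(SOME p. p \<in> germ X P x S y) \<in> germ X P x S y" using someI[of "\<lambda>p. p \<in> germ X P x S y"] germ_self[OF assms] .
  then have m: "S y = Some x" "R y' = Some x'" "y = y'" "agree_near X y S R" unfolding e mem_germ by blast+
  then have "y' = y" "x' = x" using agree_near_eq[OF m(4)] by simp_all
  then show ?thesis using e that by blast
qed

lemma germ_src: "S \<in> P \<Longrightarrow> S y = Some x \<Longrightarrow> germ_src (germ X P x S y) = y"
  and germ_rng: "S \<in> P \<Longrightarrow> S y = Some x \<Longrightarrow> germ_rng (germ X P x S y) = x"
  by (rule SOME_germ[of S y x]; simp add: germ_src_def germ_rng_def)+

lemma germ_mult: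
  assumes "S \<in> P" "S y = Some x" "R \<in> P" "R z = Some y"
  shows "gmult (germ_groupoid X P) (germ X P x S y) (germ X P y R z) = germ X P x (S \<circ>\<^sub>m R) z"
proof -
  have c: "(S \<circ>\<^sub>m R) z = Some x" using assms by (simp add: map_comp_def)
  have *: "germ X P x' (S' \<circ>\<^sub>m R') z' = germ X P x (S \<circ>\<^sub>m R) z"
    if "(x', S', y') \<in> germ X P x S y" "(y'', R', z') \<in> germ X P y R z" for x' S' y' y'' R' z'
  proof -
    have a: "S' \<in> P" "S' y = Some x'" "y' = y" "agree_near X y S S'"
      "R' \<in> P" "R' z = Some y''" "z' = z" "agree_near X z R R'" using that by (auto simp: mem_germ)
    have "agree_near X z (S \<circ>\<^sub>m R) (S' \<circ>\<^sub>m R')"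
      using agree_near_comp[OF P_biopen[OF assms(3)] assms(4) a(4,8)] .
    moreover have "(S' \<circ>\<^sub>m R') z = Some x'"
    proof -
      have "R' z = Some y" using agree_near_eq[OF a(8)] assms(4) by simp
      then show ?thesis using a(2) by (simp add: map_comp_def)
    qed
    ultimately show ?thesis
      unfolding a(7) using a c by (intro germ_eqI[symmetric] P_comp assms) auto
  qed
  have "(\<Union>(x', S', y')\<in>germ X P x S y. \<Union>(y'', R', z')\<in>germ X P y R z. germ X P x' (S' \<circ>\<^sub>m R') z') =
      germ X P x (S \<circ>\<^sub>m R) z"
    by (rule UN_const_eq[OF germ_self[OF assms(1,2)]], clarify,
        rule UN_const_eq[OF germ_self[OF assms(3,4)]], clarify, rule *)
  then show ?thesis by (simp add: germ_groupoid_def)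
qed

lemma germ_inv:
  assumes "S \<in> P" "S y = Some x"
  shows "ginv (germ_groupoid X P) (germ X P x S y) = germ X P y (pinv S) x"
proof -
  have *: "germ X P y' (pinv S') x' = germ X P y (pinv S) x"
    if "(x', S', y') \<in> germ X P x S y" for x' S' y'
  proof -
    have a: "S' \<in> P" "S' y = Some x'" "y' = y" "agree_near X y S S'" using that by (auto simp: mem_germ)
    then have x: "x' = x" using agree_near_eq[OF a(4)] assms by simp
    have "agree_near X x (pinv S) (pinv S')"
      using agree_near_pinv[OF P_homeo[OF assms(1)] P_homeo[OF a(1)] assms(2) a(4)] .
    then show ?thesis
      unfolding a(3) x using a x assms by (intro germ_eqI[symmetric] P_pinv) (auto simp: P_pinv_iff)
  qed
  have "(\<Union>(x', S', y')\<in>germ X P x S y. germ X P y' (pinv S') x') = germ X P y (pinv S) x"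
    by (rule UN_const_eq[OF germ_self[OF assms]], clarify, rule *)
  then show ?thesis by (simp add: germ_groupoid_def)
qed

lemma germ_arrowsE:
  assumes "a \<in> arrows (germ_groupoid X P)"
  obtains x S y where "a = germ X P x S y" "S \<in> P" "S y = Some x"
  using assms by (auto simp: germ_groupoid_def)

lemma germ_arrowsI: "S \<in> P \<Longrightarrow> S y = Some x \<Longrightarrow> germ X P x S y \<in> arrows (germ_groupoid X P)"
  by (auto simp: germ_groupoid_def)

definition gslice :: "('x \<rightharpoonup> 'x) \<Rightarrow> 'x set \<Rightarrow> ('x \<times> ('x \<rightharpoonup> 'x) \<times> 'x) set set" where
  "gslice S W = {germ X P (the (S y)) S y | y. y \<in> W}"

lemma germ_slices_iff: "B \<in> germ_slices X P \<longleftrightarrow> (\<exists>S W. B = gslice S W \<and> S \<in> P \<and> openin X W \<and> W \<subseteq> dom S)"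
  by (auto simp: germ_slices_def gslice_def)

lemma gsliceE:
  assumes "a \<in> gslice S W" "W \<subseteq> dom S"
  obtains x y where "a = germ X P x S y" "y \<in> W" "S y = Some x"
  using assms by (fastforce simp: gslice_def)

text \<open>Turns membership of a germ in a slice into local agreement of partial maps. Agreement
  near a point persists at neighbouring points, which gives the locality axioms for slices.\<close>

lemma mem_gslice:
  assumes "S \<in> P" "S y = Some x" "R \<in> P" "W \<subseteq> dom R"
  shows "germ X P x S y \<in> gslice R W \<longleftrightarrow> y \<in> W \<and> agree_near X y S R"
proof
  assume "germ X P x S y \<in> gslice R W"
  then obtain x' y' where "germ X P x S y = germ X P x' R y'" "y' \<in> W" "R y' = Some x'"
    using gsliceE[OF _ assms(4)] by metis
  then show "y \<in> W \<and> agree_near X y S R" using germ_eq_iff assms by metis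
next
  assume y: "y \<in> W \<and> agree_near X y S R"
  then have "R y = Some x" using agree_near_eq assms(2) by metis
  then have "germ X P x S y = germ X P (the (R y)) R y" using y assms by (intro germ_eqI) auto
  then show "germ X P x S y \<in> gslice R W" using y by (auto simp: gslice_def)
qed

sublocale slice_groupoid X "germ_groupoid X P" germ_src germ_rng "\<lambda>x. germ X P x (pid X) x" "germ_slices X P"
proof
  let ?G = "germ_groupoid X P"
  show "Hausdorff_space X" by (rule hausdorff)
  show "locally_compact_space X" by (rule locally_compact)
  show "gtop ?G = topology_generated_by (germ_slices X P)"
    by (simp add: germ_groupoid_def germ_slices_def)
  show "\<Union>(germ_slices X P) = arrows ?G"
  proof (intro subset_antisym subsetI)
    fix a assume "a \<in> \<Union>(germ_slices X P)"
    then obtain S W where "a \<in> gslice S W" "S \<in> P" "W \<subseteq> dom S" by (auto simp: germ_slices_iff)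
    then show "a \<in> arrows ?G" using gsliceE germ_arrowsI by metis
  next
    fix a assume "a \<in> arrows ?G"
    then obtain x S y where a: "a = germ X P x S y" "S \<in> P" "S y = Some x" by (rule germ_arrowsE)
    then have "a \<in> gslice S (dom S)" using agree_near_refl[OF P_biopen] by (auto simp: mem_gslice)
    moreover have "gslice S (dom S) \<in> germ_slices X P"
      unfolding germ_slices_iff using a(2) biopen_dom[OF P_biopen[OF a(2)]] by blast
    ultimately show "a \<in> \<Union>(germ_slices X P)" by blast
  qed
  show unit: "germ X P x (pid X) x \<in> arrows ?G" "germ_src (germ X P x (pid X) x) = x" if "x \<in> topspace X" for x
    using that by (auto simp: pid_Some_iff P_pid germ_arrowsI germ_src)
  fix a b d
  assume "a \<in> arrows ?G"
  then obtain x S y where a: "a = germ X P x S y" "S \<in> P" "S y = Some x" by (rule germ_arrowsE)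
  show "ginv ?G a \<in> arrows ?G" "germ_src (ginv ?G a) = germ_rng a"
    using a by (auto simp: germ_inv germ_arrowsI P_pinv P_pinv_iff germ_src germ_rng)
  have "pinv (pinv S) = S"
  proof
    fix v show "pinv (pinv S) v = S v"
      using a P_pinv P_pinv_iff by (metis option.exhaust)
  qed
  then show "ginv ?G (ginv ?G a) = a" using a by (simp add: germ_inv P_pinv P_pinv_iff)
  show "germ_src a \<in> topspace X" using a biopenD(1)[OF P_biopen] by (auto simp: germ_src)
  have y: "y \<in> topspace X" "x \<in> topspace X" using a biopenD(1,2)[OF P_biopen] by blast+
  have "gmult ?G (ginv ?G a) a = germ X P y (pinv S \<circ>\<^sub>m S) y"
    using a by (simp add: germ_inv germ_mult P_pinv P_pinv_iff)
  also have "\<dots> = germ X P y (pid X) y"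
  proof (rule germ_eqI)
    show "pinv S \<circ>\<^sub>m S \<in> P" "pid X \<in> P" using a by (auto intro: P_comp P_pinv P_pid)
    show "(pinv S \<circ>\<^sub>m S) y = Some y" "pid X y = Some y"
      using a y by (auto simp: map_comp_def P_pinv_iff pid_Some_iff)
    have "(pinv S \<circ>\<^sub>m S) w = Some w" "pid X w = Some w" if "w \<in> dom S" for w
      using that a biopenD(1)[OF P_biopen[OF a(2)]] by (auto simp: map_comp_def P_pinv_iff pid_Some_iff split: option.splits)
    then show "agree_near X y (pinv S \<circ>\<^sub>m S) (pid X)"
      unfolding agree_near_def using a biopen_dom[OF P_biopen[OF a(2)]]
      by (intro exI[of _ "dom S"]) auto
  qed
  finally show "gmult ?G (ginv ?G a) a = germ X P (germ_src a) (pid X) (germ_src a)"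
    using a by (simp add: germ_src)
  have "gmult ?G (germ X P x (pid X) x) a = germ X P x (pid X \<circ>\<^sub>m S) y"
    unfolding a(1) using a y by (intro germ_mult P_pid) (auto simp: pid_Some_iff)
  then show "gmult ?G (germ X P (germ_rng a) (pid X) (germ_rng a)) a = a"
    using a by (simp add: germ_rng pid_comp P_biopen)
  assume "b \<in> arrows ?G" and ab: "germ_src a = germ_rng b"
  then obtain R z where b: "b = germ X P y R z" "R \<in> P" "R z = Some y"
    using a by (auto elim!: germ_arrowsE simp: germ_src germ_rng)
  have m: "gmult ?G a b = germ X P x (S \<circ>\<^sub>m R) z" unfolding a(1) b(1) using a b by (intro germ_mult)
  have SR: "S \<circ>\<^sub>m R \<in> P" "(S \<circ>\<^sub>m R) z = Some x" using a b by (auto simp: P_comp map_comp_Some_iff)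
  show "gmult ?G a b \<in> arrows ?G" "germ_src (gmult ?G a b) = germ_src b" "germ_rng (gmult ?G a b) = germ_rng a"
    unfolding m using germ_arrowsI[OF SR] germ_src[OF SR] germ_rng[OF SR] a b
    by (simp_all add: germ_src germ_rng)
  assume "d \<in> arrows ?G" and bd: "germ_src b = germ_rng d"
  then obtain Q w where d: "d = germ X P z Q w" "Q \<in> P" "Q w = Some z"
    using b by (auto elim!: germ_arrowsE simp: germ_src germ_rng)
  have RQ: "R \<circ>\<^sub>m Q \<in> P" "(R \<circ>\<^sub>m Q) w = Some y" using b d by (auto simp: P_comp map_comp_Some_iff)
  show "gmult ?G (gmult ?G a b) d = gmult ?G a (gmult ?G b d)"
    unfolding m using a b d SR RQ by (simp add: germ_mult map_comp_assoc')
next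
  fix B assume "B \<in> germ_slices X P"
  then obtain S W where B: "B = gslice S W" "S \<in> P" "openin X W" "W \<subseteq> dom S" by (auto simp: germ_slices_iff)
  note E = gsliceE[OF _ B(4)]
  have inj: "inj_on S (dom S)" using P_homeo[OF B(2)] by (simp add: partial_homeo_iff)
  have m: "germ X P x S y \<in> B \<longleftrightarrow> y \<in> W" if "S y = Some x" for x y
    using that B agree_near_refl[OF P_biopen] by (auto simp: mem_gslice)
  show "inj_on germ_src B"
  proof (rule inj_onI)
    fix a b assume ab: "a \<in> B" "b \<in> B" "germ_src a = germ_src b"
    obtain x y where "a = germ X P x S y" "S y = Some x" using ab(1) E unfolding B(1) by metis
    moreover obtain x' y' where "b = germ X P x' S y'" "S y' = Some x'" using ab(2) E unfolding B(1) by metis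
    ultimately show "a = b" using ab(3) B(2) by (auto simp: germ_src)
  qed
  show "inj_on germ_rng B"
  proof (rule inj_onI)
    fix a b assume ab: "a \<in> B" "b \<in> B" "germ_rng a = germ_rng b"
    obtain x y where a: "a = germ X P x S y" "S y = Some x" using ab(1) E unfolding B(1) by metis
    obtain x' y' where b: "b = germ X P x' S y'" "S y' = Some x'" using ab(2) E unfolding B(1) by metis
    have "x = x'" using a b ab(3) B(2) by (simp add: germ_rng)
    then have "y = y'" using a b inj_onD[OF inj, of y y'] by auto
    then show "a = b" using a b by simp
  qed
  {
  fix U assume U: "openin X U"
  have "germ_src ` {a \<in> B. germ_rng a \<in> U} = W \<inter> {y. \<exists>x\<in>U. S y = Some x}"
  proof (intro subset_antisym subsetI)
    fix y assume "y \<in> germ_src ` {a \<in> B. germ_rng a \<in> U}"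
    then obtain a where a: "a \<in> B" "germ_rng a \<in> U" "y = germ_src a" by blast
    obtain x' y' where "a = germ X P x' S y'" "y' \<in> W" "S y' = Some x'" using a(1) E unfolding B(1) by metis
    then show "y \<in> W \<inter> {y. \<exists>x\<in>U. S y = Some x}" using a B(2) by (auto simp: germ_src germ_rng)
  next
    fix y assume "y \<in> W \<inter> {y. \<exists>x\<in>U. S y = Some x}"
    then obtain x where "y \<in> W" "x \<in> U" "S y = Some x" by blast
    then show "y \<in> germ_src ` {a \<in> B. germ_rng a \<in> U}"
      using B(2) by (intro image_eqI[of _ _ "germ X P x S y"]) (auto simp: m germ_src germ_rng)
  qed
  then show "openin X (germ_src ` {a \<in> B. germ_rng a \<in> U})"
    using biopenD(4)[OF P_biopen[OF B(2)] U] B(3) by auto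
  have "germ_rng ` {a \<in> B. germ_src a \<in> U} = {x. \<exists>y\<in>W \<inter> U. S y = Some x}"
  proof (intro subset_antisym subsetI)
    fix x assume "x \<in> germ_rng ` {a \<in> B. germ_src a \<in> U}"
    then obtain a where a: "a \<in> B" "germ_src a \<in> U" "x = germ_rng a" by blast
    obtain x' y' where "a = germ X P x' S y'" "y' \<in> W" "S y' = Some x'" using a(1) E unfolding B(1) by metis
    then show "x \<in> {x. \<exists>y\<in>W \<inter> U. S y = Some x}" using a B(2) by (auto simp: germ_src germ_rng)
  next
    fix x assume "x \<in> {x. \<exists>y\<in>W \<inter> U. S y = Some x}"
    then obtain y where "y \<in> W" "y \<in> U" "S y = Some x" by blast
    then show "x \<in> germ_rng ` {a \<in> B. germ_src a \<in> U}"
      using B(2) by (intro image_eqI[of _ _ "germ X P x S y"]) (auto simp: m germ_src germ_rng)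
  qed
  then show "openin X (germ_rng ` {a \<in> B. germ_src a \<in> U})"
    using biopenD(3)[OF P_biopen[OF B(2)], of "W \<inter> U"] U B(3) by auto
  have "{a \<in> B. germ_src a \<in> U} = gslice S (W \<inter> U)"
    using B(2,4) by (auto simp: B(1) gslice_def) (metis germ_src domD option.sel subsetD)+
  then show "{a \<in> B. germ_src a \<in> U} \<in> germ_slices X P"
    unfolding germ_slices_iff using B U by (intro exI[of _ S] exI[of _ "W \<inter> U"]) auto
  }
  \<comment> \<open>Inverting the slice of \<open>S\<close> over \<open>W\<close> gives the slice of
    \<open>pinv S\<close> over the image of \<open>W\<close>.\<close>
  let ?V = "{x. \<exists>y\<in>W. S y = Some x}"
  have "ginv (germ_groupoid X P) ` B = gslice (pinv S) ?V"
  proof (intro subset_antisym subsetI)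
    fix b assume "b \<in> ginv (germ_groupoid X P) ` B"
    then obtain a where a: "a \<in> B" "b = ginv (germ_groupoid X P) a" by blast
    obtain x y where xy: "a = germ X P x S y" "y \<in> W" "S y = Some x" using a(1) E unfolding B(1) by metis
    then have "pinv S x = Some y" using B(2) by (simp add: P_pinv_iff)
    then have "b = germ X P (the (pinv S x)) (pinv S) x" using a xy B(2) by (simp add: germ_inv)
    then show "b \<in> gslice (pinv S) ?V" using xy by (auto simp: gslice_def)
  next
    fix b assume "b \<in> gslice (pinv S) ?V"
    then obtain x y where xy: "b = germ X P (the (pinv S x)) (pinv S) x" "y \<in> W" "S y = Some x"
      by (auto simp: gslice_def)
    then have "pinv S x = Some y" using B(2) by (simp add: P_pinv_iff)
    then have "b = ginv (germ_groupoid X P) (germ X P x S y)" using xy B(2) by (simp add: germ_inv)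
    then show "b \<in> ginv (germ_groupoid X P) ` B" using m xy by blast
  qed
  moreover have "?V \<subseteq> dom (pinv S)" using B(2) by (auto simp: P_pinv_iff)
  moreover have "openin X ?V" using biopenD(3)[OF P_biopen[OF B(2)] B(3)] .
  ultimately show "ginv (germ_groupoid X P) ` B \<in> germ_slices X P"
    using P_pinv[OF B(2)] unfolding germ_slices_iff by blast
  fix B' a assume "B' \<in> germ_slices X P" and a: "a \<in> B" "a \<in> B'"
  then obtain S' W' where B': "B' = gslice S' W'" "S' \<in> P" "openin X W'" "W' \<subseteq> dom S'" by (auto simp: germ_slices_iff)
  obtain x y where xy: "a = germ X P x S y" "y \<in> W" "S y = Some x" using a(1) E unfolding B(1) by metis
  have y: "y \<in> W'" "agree_near X y S S'" using a(2) xy B B' by (auto simp: mem_gslice)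
  then obtain N where N: "openin X N" "y \<in> N" "N \<subseteq> dom S \<inter> dom S'" "\<And>w. w \<in> N \<Longrightarrow> S w = S' w"
    unfolding agree_near_def by blast
  \<comment> \<open>Agreement on \<open>N\<close> is agreement near each of its points, so a
    condition on the source suffices and the range is left unrestricted.\<close>
  have "b \<in> B'" if b: "b \<in> B" "germ_src b \<in> N \<inter> W'" for b
  proof -
    obtain x' y' where xy': "b = germ X P x' S y'" "y' \<in> W" "S y' = Some x'" using b(1) E unfolding B(1) by metis
    then have "y' \<in> N" "y' \<in> W'" using b(2) B(2) by (auto simp: germ_src)
    then have "agree_near X y' S S'" unfolding agree_near_def using N by blast
    then show ?thesis using xy' \<open>y' \<in> W'\<close> B B' by (simp add: mem_gslice)
  qed
  moreover have "x \<in> topspace X" using xy biopenD(2)[OF P_biopen[OF B(2)]] by blast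
  ultimately show "\<exists>U V. openin X U \<and> openin X V \<and> germ_rng a \<in> U \<and> germ_src a \<in> V \<and>
      (\<forall>b\<in>B. germ_rng b \<in> U \<longrightarrow> germ_src b \<in> V \<longrightarrow> b \<in> B')"
    using N B' y xy B(2)
    by (intro exI[of _ "topspace X"] exI[of _ "N \<inter> W'"]) (auto simp: germ_src germ_rng)
next
  fix B1 B2 B3 a b
  assume "B1 \<in> germ_slices X P" "B2 \<in> germ_slices X P" "B3 \<in> germ_slices X P"
    and ab: "a \<in> B1" "b \<in> B2" "germ_src a = germ_rng b" "gmult (germ_groupoid X P) a b \<in> B3"
  then obtain S1 W1 S2 W2 S3 W3 where B1: "B1 = gslice S1 W1" "S1 \<in> P" "openin X W1" "W1 \<subseteq> dom S1"
    and B2: "B2 = gslice S2 W2" "S2 \<in> P" "openin X W2" "W2 \<subseteq> dom S2"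
    and B3: "B3 = gslice S3 W3" "S3 \<in> P" "openin X W3" "W3 \<subseteq> dom S3" unfolding germ_slices_iff by blast
  note E1 = gsliceE[OF _ B1(4)] and E2 = gsliceE[OF _ B2(4)]
  have prod: "\<exists>x y z. S1 y = Some x \<and> S2 z = Some y \<and> germ_src b = z \<and> germ_src a = y \<and> germ_rng a = x \<and>
      gmult (germ_groupoid X P) a b = germ X P x (S1 \<circ>\<^sub>m S2) z \<and> (S1 \<circ>\<^sub>m S2) z = Some x"
    if ab: "a \<in> B1" "b \<in> B2" "germ_src a = germ_rng b" for a b
  proof -
    obtain x y where a: "a = germ X P x S1 y" "S1 y = Some x" using ab(1) E1 unfolding B1(1) by metis
    obtain y' z where b: "b = germ X P y' S2 z" "S2 z = Some y'" using ab(2) E2 unfolding B2(1) by metis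
    have "y' = y" using ab(3) a b B1(2) B2(2) by (simp add: germ_src germ_rng)
    then show ?thesis using a b B1(2) B2(2)
      by (intro exI[of _ x] exI[of _ y] exI[of _ z]) (auto simp: germ_src germ_rng germ_mult map_comp_def)
  qed
  have P12: "S1 \<circ>\<^sub>m S2 \<in> P" using B1 B2 P_comp by blast
  obtain x y z where xyz: "S1 y = Some x" "S2 z = Some y" "germ_src b = z" "germ_src a = y" "germ_rng a = x"
    "gmult (germ_groupoid X P) a b = germ X P x (S1 \<circ>\<^sub>m S2) z" "(S1 \<circ>\<^sub>m S2) z = Some x"
    using prod[OF ab(1-3)] by blast
  have z: "z \<in> W3" "agree_near X z (S1 \<circ>\<^sub>m S2) S3"
    using ab(4) unfolding B3(1) xyz(6) mem_gslice[OF P12 xyz(7) B3(2,4)] by auto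
  then obtain N where N: "openin X N" "z \<in> N" "N \<subseteq> dom (S1 \<circ>\<^sub>m S2) \<inter> dom S3" "\<And>w. w \<in> N \<Longrightarrow> (S1 \<circ>\<^sub>m S2) w = S3 w"
    unfolding agree_near_def by blast
  have "gmult (germ_groupoid X P) a' b' \<in> B3"
    if h: "a' \<in> B1" "b' \<in> B2" "germ_src a' = germ_rng b'" "germ_src b' \<in> N \<inter> W3" for a' b'
  proof -
    obtain x' z' where *: "germ_src b' = z'" "gmult (germ_groupoid X P) a' b' = germ X P x' (S1 \<circ>\<^sub>m S2) z'"
      "(S1 \<circ>\<^sub>m S2) z' = Some x'" using prod[OF h(1-3)] by blast
    have "agree_near X z' (S1 \<circ>\<^sub>m S2) S3" unfolding agree_near_def using N h(4) * by blast
    then show ?thesis using h(4) * unfolding B3(1) *(2) mem_gslice[OF P12 *(3) B3(2,4)] by simp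
  qed
  moreover have "x \<in> topspace X" "y \<in> topspace X" using xyz(1) biopenD(1,2)[OF P_biopen[OF B1(2)]] by blast+
  ultimately show "\<exists>U V V'. openin X U \<and> openin X V \<and> openin X V' \<and> germ_rng a \<in> U \<and> germ_src a \<in> V \<and> germ_src b \<in> V' \<and>
      (\<forall>a'\<in>B1. \<forall>b'\<in>B2. germ_src a' = germ_rng b' \<longrightarrow> germ_rng a' \<in> U \<longrightarrow> germ_src a' \<in> V \<longrightarrow> germ_src b' \<in> V' \<longrightarrow>
        gmult (germ_groupoid X P) a' b' \<in> B3)"
    using N(1,2) B3(3) z xyz
    by (intro exI[of _ "topspace X"] exI[of _ "N \<inter> W3"] conjI) auto
qed

end

section \<open>The canonical homomorphism\<close>

text \<open>The family must be nonempty, since an empty intersection would also contain maps that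
  are not partial homeomorphisms; for the generated pseudogroup, the full pseudogroup of all partial
  homeomorphisms provides a member.\<close>

lemma full_pseudogroup_Inter:
  assumes "\<F> \<noteq> {}" "\<And>P. P \<in> \<F> \<Longrightarrow> full_pseudogroup X P" shows "full_pseudogroup X (\<Inter>\<F>)"
  using assms unfolding full_pseudogroup_def pseudogroup_def by blast

lemma full_pseudogroup_partial_homeos: "full_pseudogroup X {S. partial_homeo X S}"
  by (auto simp: full_pseudogroup_def pseudogroup_def partial_homeo_pid partial_homeo_comp partial_homeo_pinv)

context mgds_dc
begin

definition PG :: "('x \<rightharpoonup> 'x) set" where
  "PG = mgds_pseudogroup X r T"

lemma full_PG: "full_pseudogroup X PG"
  unfolding PG_def mgds_pseudogroup_def
proof (rule full_pseudogroup_Inter)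
  have "{T j |` U |j U. j < r \<and> inj_open X (T j) U} \<subseteq> {S. partial_homeo X S}"
    using lh by (auto simp: lhomeo_def intro: partial_homeo_restrict)
  then show "{P. full_pseudogroup X P \<and> {T j |` U |j U. j < r \<and> inj_open X (T j) U} \<subseteq> P} \<noteq> {}"
    using full_pseudogroup_partial_homeos by blast
qed auto

sublocale P: lc_pseudogroup X PG
  using full_PG hausdorff locally_compact by unfold_locales (auto simp: full_pseudogroup_def)

lemma PG_full:
  assumes "partial_homeo X S" "\<And>y. y \<in> dom S \<Longrightarrow> \<exists>R\<in>PG. agree_near X y S R"
  shows "S \<in> PG"
  using full_PG assms unfolding full_pseudogroup_def by blast

lemma generator_in_PG: "j < r \<Longrightarrow> inj_open X (T j) U \<Longrightarrow> T j |` U \<in> PG"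
  unfolding PG_def mgds_pseudogroup_def by blast

text \<open>A power of \<open>T\<close> is usually not injective, hence not in \<open>PG\<close>.
  The weaker property of having its germs in \<open>PG\<close> survives composition, and fullness
  turns it into membership for injective restrictions.\<close>

definition locally_PG :: "('x \<rightharpoonup> 'x) \<Rightarrow> bool" where
  "locally_PG f \<longleftrightarrow> biopen X f \<and> (\<forall>y\<in>dom f. \<exists>R\<in>PG. agree_near X y f R)"

lemma locally_PG_member: "S \<in> PG \<Longrightarrow> locally_PG S"
  unfolding locally_PG_def
  by (intro conjI ballI bexI[of _ S] agree_near_refl P.P_biopen)

lemma locally_PG_generator:
  assumes "j < r" shows "locally_PG (T j)"
  unfolding locally_PG_def
proof (intro conjI ballI)
  show "biopen X (T j)" using lh[OF assms] by (simp add: lhomeo_def)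
  fix y assume "y \<in> dom (T j)"
  then obtain U where U: "inj_open X (T j) U" "y \<in> U" using lh[OF assms] unfolding lhomeo_def by blast
  then have "agree_near X y (T j) (T j |` U)"
    unfolding agree_near_def inj_open_def by (intro exI[of _ U]) auto
  then show "\<exists>R\<in>PG. agree_near X y (T j) R" using generator_in_PG[OF assms U(1)] by blast
qed

lemma locally_PG_comp:
  assumes "locally_PG f" "locally_PG g" shows "locally_PG (f \<circ>\<^sub>m g)"
  unfolding locally_PG_def
proof (intro conjI ballI)
  have b: "biopen X f" "biopen X g" using assms by (auto simp: locally_PG_def)
  then show "biopen X (f \<circ>\<^sub>m g)" by (rule biopen_comp)
  fix z assume "z \<in> dom (f \<circ>\<^sub>m g)"
  then obtain y x where y: "g z = Some y" "f y = Some x" by (auto simp: map_comp_Some_iff)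
  obtain S where S: "S \<in> PG" "agree_near X y f S" using y assms(1) unfolding locally_PG_def by blast
  obtain R where R: "R \<in> PG" "agree_near X z g R" using y assms(2) unfolding locally_PG_def by blast
  show "\<exists>R\<in>PG. agree_near X z (f \<circ>\<^sub>m g) R"
    using agree_near_comp[OF b(2) y(1) S(2) R(2)] P.P_comp[OF S(1) R(1)] by blast
qed

lemma locally_PG_mpow: "locally_PG (Tm n)"
proof -
  have pp: "locally_PG (ppow X (T j) k)" if "j < r" for j k
    using that by (induction k) (simp_all add: locally_PG_member P.P_pid locally_PG_comp locally_PG_generator)
  have pwl: "locally_PG (pw js n)" if "set js \<subseteq> {..<r}" for js
    using that by (induction js) (auto simp: locally_PG_member P.P_pid intro!: locally_PG_comp pp)
  show ?thesis unfolding mpow_def by (rule pwl) auto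
qed

lemma mpow_restrict_in_PG:
  assumes "inj_open X (Tm n) V" shows "Tm n |` V \<in> PG"
proof (rule PG_full)
  show "partial_homeo X (Tm n |` V)" using biopen_mpow assms by (rule partial_homeo_restrict)
  fix y assume "y \<in> dom (Tm n |` V)"
  then have y: "y \<in> V" "y \<in> dom (Tm n)" by auto
  obtain R where R: "R \<in> PG" "agree_near X y (Tm n) R"
    using locally_PG_mpow[of n] y unfolding locally_PG_def by blast
  have "agree_near X y (Tm n |` V) (Tm n)"
    unfolding agree_near_def using assms y by (intro exI[of _ V]) (auto simp: inj_open_def)
  from agree_near_trans[OF this R(2)] R(1) show "\<exists>R\<in>PG. agree_near X y (Tm n |` V) R" by (rule bexI)
qed

text \<open>The slice read as a map from sources to ranges: its graph is the slice, by
  \<open>slice_map_iff\<close>.\<close>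

definition slice_map :: "'x set \<Rightarrow> (nat \<Rightarrow> nat) \<Rightarrow> (nat \<Rightarrow> nat) \<Rightarrow> 'x set \<Rightarrow> 'x \<rightharpoonup> 'x" where
  "slice_map U m n V = pinv (Tm m |` U) \<circ>\<^sub>m (Tm n |` V)"

lemma slice_map_in_PG:
  "inj_open X (Tm m) U \<Longrightarrow> inj_open X (Tm n) V \<Longrightarrow> slice_map U m n V \<in> PG"
  unfolding slice_map_def by (intro P.P_comp P.P_pinv mpow_restrict_in_PG)

lemma slice_map_iff:
  assumes "inj_open X (Tm m) U" "inj_open X (Tm n) V"
  shows "slice_map U m n V y = Some x \<longleftrightarrow> (x, mdiff m n, y) \<in> sdp_basic X r T U m n V"
proof -
  have "slice_map U m n V y = Some x \<longleftrightarrow> (\<exists>w. (Tm n |` V) y = Some w \<and> (Tm m |` U) x = Some w)"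
    unfolding slice_map_def map_comp_Some_iff P.P_pinv_iff[OF mpow_restrict_in_PG[OF assms(1)]] ..
  also have "\<dots> \<longleftrightarrow> x \<in> U \<and> y \<in> V \<and> Tm m x = Tm n y"
  proof -
    have "\<exists>w. Tm n y = Some w" if "y \<in> V" using assms(2) that by (auto simp: inj_open_def)
    then show ?thesis unfolding restrict_Some_iff by auto
  qed
  finally show ?thesis by (simp add: sdp_basic_iff)
qed

text \<open>Behind the well-definedness of \<pi>: two slices through one arrow coincide near it by
  \<open>sdp_slices_local\<close>, hence so do the maps whose graphs they are.\<close>

lemma slice_maps_agree:
  assumes MI: "m \<in> MI" "n \<in> MI" "m' \<in> MI" "n' \<in> MI"
    and U: "inj_open X (Tm m) U" "inj_open X (Tm n) V" and U': "inj_open X (Tm m') U'" "inj_open X (Tm n') V'"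
    and mem: "(x, z, y) \<in> sdp_basic X r T U m n V" "(x, z, y) \<in> sdp_basic X r T U' m' n' V'"
  shows "agree_near X y (slice_map U m n V) (slice_map U' m' n' V')"
proof -
  let ?S = "slice_map U m n V" and ?S' = "slice_map U' m' n' V'"
  have z: "z = mdiff m n" "z = mdiff m' n'" using mem by (auto simp: sdp_basic_iff)
  obtain A B where AB: "openin X A" "openin X B" "x \<in> A" "y \<in> B"
    "\<And>b. b \<in> sdp_basic X r T U m n V \<Longrightarrow> fst b \<in> A \<Longrightarrow> snd (snd b) \<in> B \<Longrightarrow> b \<in> sdp_basic X r T U' m' n' V'"
    using sdp_slices_local[OF sdp_slicesI[OF MI(1,2) U] sdp_slicesI[OF MI(3,4) U'] mem] by auto
  \<comment> \<open>Restricts both the source and its image under \<open>?S\<close>, as the local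
    statement on slices requires.\<close>
  let ?N = "B \<inter> {y. \<exists>x\<in>A. ?S y = Some x}"
  have S: "biopen X ?S" using slice_map_in_PG[OF U] P.P_biopen by blast
  have "openin X ?N" using AB(2) biopenD(4)[OF S AB(1)] by blast
  moreover have "?S y = Some x" using mem(1) z slice_map_iff[OF U] by simp
  then have "y \<in> ?N" using AB by blast
  moreover have eq: "\<exists>x. ?S w = Some x \<and> ?S' w = Some x" if w: "w \<in> ?N" for w
  proof -
    obtain v where v: "v \<in> A" "?S w = Some v" using w by blast
    then have "(v, mdiff m n, w) \<in> sdp_basic X r T U' m' n' V'"
      using AB(5)[of "(v, mdiff m n, w)"] w slice_map_iff[OF U] by simp
    then have "?S' w = Some v" using z slice_map_iff[OF U'] by simp
    then show ?thesis using v by blast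
  qed
  moreover have "?N \<subseteq> dom ?S \<inter> dom ?S'" "\<forall>w\<in>?N. ?S w = ?S' w" using eq by force+
  ultimately show ?thesis unfolding agree_near_def by blast
qed

text \<open>The union in \<open>canonical_hom\<close> runs over germs that all coincide by
  \<open>slice_maps_agree\<close>, so any one slice through the arrow computes it.\<close>

lemma canonical_hom_eq:
  assumes MI: "m \<in> MI" "n \<in> MI" and U: "inj_open X (Tm m) U" "inj_open X (Tm n) V"
    and mem: "(x, z, y) \<in> sdp_basic X r T U m n V"
  shows "canonical_hom X r T (x, z, y) = germ X PG x (slice_map U m n V) y"
proof -
  define \<G> where "\<G> = {germ X PG x (slice_map U m n V) y | m n U V.
     m \<in> MI \<and> n \<in> MI \<and> z = mdiff m n \<and> inj_open X (Tm m) U \<and> inj_open X (Tm n) V \<and> x \<in> U \<and> y \<in> V \<and> Tm m x = Tm n y}"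
  have z: "z = mdiff m n" using mem by (simp add: sdp_basic_iff)
  have "germ X PG x (slice_map U' m' n' V') y = germ X PG x (slice_map U m n V) y"
    if h: "m' \<in> MI" "n' \<in> MI" "inj_open X (Tm m') U'" "inj_open X (Tm n') V'"
      "(x, z, y) \<in> sdp_basic X r T U' m' n' V'" for U' m' n' V'
  proof (rule P.germ_eqI)
    have "z = mdiff m' n'" using h by (simp add: sdp_basic_iff)
    then show "slice_map U' m' n' V' y = Some x" "slice_map U m n V y = Some x"
      using h mem z slice_map_iff[OF U] slice_map_iff[OF h(3,4)] by auto
  qed (use h assms in \<open>auto intro: slice_map_in_PG slice_maps_agree\<close>)
  then have "A = germ X PG x (slice_map U m n V) y" if "A \<in> \<G>" for A
    using that unfolding \<G>_def sdp_basic_iff by blast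
  moreover have "germ X PG x (slice_map U m n V) y \<in> \<G>"
    unfolding \<G>_def using MI U mem[unfolded sdp_basic_iff] by blast
  ultimately have "\<Union>\<G> = germ X PG x (slice_map U m n V) y" by blast
  then show ?thesis by (simp add: canonical_hom_def \<G>_def slice_map_def PG_def)
qed

text \<open>Supplies \<open>pi_BB\<close>: as the slice is the graph of \<open>slice_map\<close>,
  its arrows yield all germs of that map.\<close>

lemma image_canonical_hom:
  assumes MI: "m \<in> MI" "n \<in> MI" and U: "inj_open X (Tm m) U" "inj_open X (Tm n) V"
  shows "canonical_hom X r T ` sdp_basic X r T U m n V = P.gslice (slice_map U m n V) (dom (slice_map U m n V))"
proof (intro subset_antisym subsetI)
  fix b assume "b \<in> canonical_hom X r T ` sdp_basic X r T U m n V"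
  then obtain x z y where b: "b = canonical_hom X r T (x, z, y)" "(x, z, y) \<in> sdp_basic X r T U m n V" by auto
  then have "z = mdiff m n" by (simp add: sdp_basic_iff)
  then have S: "slice_map U m n V y = Some x" using b slice_map_iff[OF U] by simp
  then show "b \<in> P.gslice (slice_map U m n V) (dom (slice_map U m n V))"
    unfolding P.gslice_def using b canonical_hom_eq[OF MI U b(2)] by force
next
  fix b assume "b \<in> P.gslice (slice_map U m n V) (dom (slice_map U m n V))"
  then obtain x y where b: "b = germ X PG x (slice_map U m n V) y" "slice_map U m n V y = Some x"
    by (auto simp: P.gslice_def)
  then have "(x, mdiff m n, y) \<in> sdp_basic X r T U m n V" using slice_map_iff[OF U] by simp
  then show "b \<in> canonical_hom X r T ` sdp_basic X r T U m n V"
    using canonical_hom_eq[OF MI U] b by force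
qed

text \<open>Read on graphs, \<open>sdp_slices_mult\<close> says that near \<open>w\<close> the graph
  of the composite of two slice maps lies in the third slice. This is multiplicativity of \<pi> on
  the level of representatives.\<close>

lemma canonical_hom_mult:
  assumes W: "m1 \<in> MI" "n1 \<in> MI" "inj_open X (Tm m1) U1" "inj_open X (Tm n1) V1"
    "m2 \<in> MI" "n2 \<in> MI" "inj_open X (Tm m2) U2" "inj_open X (Tm n2) V2"
    "m3 \<in> MI" "n3 \<in> MI" "inj_open X (Tm m3) U3" "inj_open X (Tm n3) V3"
    and a: "(x, z, y) \<in> sdp_basic X r T U1 m1 n1 V1" and b: "(y, z', w) \<in> sdp_basic X r T U2 m2 n2 V2"
    and ab: "(x, \<lambda>j. z j + z' j, w) \<in> sdp_basic X r T U3 m3 n3 V3"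
  shows "agree_near X w (slice_map U1 m1 n1 V1 \<circ>\<^sub>m slice_map U2 m2 n2 V2) (slice_map U3 m3 n3 V3)"
proof -
  let ?S1 = "slice_map U1 m1 n1 V1" and ?S2 = "slice_map U2 m2 n2 V2" and ?S3 = "slice_map U3 m3 n3 V3"
  have z: "z = mdiff m1 n1" "z' = mdiff m2 n2" "(\<lambda>j. z j + z' j) = mdiff m3 n3"
    using a b ab by (auto simp: sdp_basic_iff)
  note i1 = slice_map_iff[OF W(3,4)] and i2 = slice_map_iff[OF W(7,8)] and i3 = slice_map_iff[OF W(11,12)]
  have gm: "gmult (sdp_groupoid X r T) (x', u, y') (y', v, w') = (x', \<lambda>j. u j + v j, w')" for x' u y' v w'
    by (simp add: sdp_groupoid_def)
  have ab': "gmult (sdp_groupoid X r T) (x, z, y) (y, z', w) \<in> sdp_basic X r T U3 m3 n3 V3"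
    unfolding gm by (rule ab)
  obtain A B C where ABC: "openin X A" "openin X B" "openin X C" "x \<in> A" "y \<in> B" "w \<in> C"
    and loc: "\<And>a b. a \<in> sdp_basic X r T U1 m1 n1 V1 \<Longrightarrow> b \<in> sdp_basic X r T U2 m2 n2 V2 \<Longrightarrow>
      snd (snd a) = fst b \<Longrightarrow> fst a \<in> A \<Longrightarrow> snd (snd a) \<in> B \<Longrightarrow> snd (snd b) \<in> C \<Longrightarrow>
      gmult (sdp_groupoid X r T) a b \<in> sdp_basic X r T U3 m3 n3 V3"
    using sdp_slices_mult[OF sdp_slicesI[OF W(1-4)] sdp_slicesI[OF W(5-8)] sdp_slicesI[OF W(9-12)] a b _ ab']
    unfolding fst_conv snd_conv by blast
  have S1: "biopen X ?S1" and S2: "biopen X ?S2"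
    using P.P_biopen slice_map_in_PG W by blast+
  let ?M = "B \<inter> {y. \<exists>x\<in>A. ?S1 y = Some x}"
  let ?N = "C \<inter> {w. \<exists>y\<in>?M. ?S2 w = Some y}"
  have M: "openin X ?M" using ABC biopenD(4)[OF S1] by blast
  have "openin X ?N" using ABC(3) biopenD(4)[OF S2 M] by blast
  moreover have "?S1 y = Some x" "?S2 w = Some y" using i1 i2 a b z by auto
  then have "w \<in> ?N" using ABC by blast
  moreover have eq: "\<exists>x. (?S1 \<circ>\<^sub>m ?S2) w' = Some x \<and> ?S3 w' = Some x" if w': "w' \<in> ?N" for w'
  proof -
    obtain y' x' where *: "y' \<in> B" "x' \<in> A" "?S1 y' = Some x'" "?S2 w' = Some y'" "w' \<in> C" using w' by blast
    have "gmult (sdp_groupoid X r T) (x', mdiff m1 n1, y') (y', mdiff m2 n2, w') \<in> sdp_basic X r T U3 m3 n3 V3"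
      using * i1 i2 by (intro loc) auto
    then have "?S3 w' = Some x'" using z i3 by (simp add: gm)
    then show ?thesis using * by (auto simp: map_comp_Some_iff)
  qed
  moreover have "?N \<subseteq> dom (?S1 \<circ>\<^sub>m ?S2) \<inter> dom ?S3" "\<forall>w'\<in>?N. (?S1 \<circ>\<^sub>m ?S2) w' = ?S3 w'" using eq by force+
  ultimately show ?thesis unfolding agree_near_def by blast
qed

lemma sdp_arrow_cases:
  assumes "a \<in> arrows (sdp_groupoid X r T)"
  obtains x z y U m n V where "a = (x, z, y)" "m \<in> MI" "n \<in> MI" "inj_open X (Tm m) U" "inj_open X (Tm n) V"
    "(x, z, y) \<in> sdp_basic X r T U m n V" "slice_map U m n V y = Some x" "slice_map U m n V \<in> PG"
    "canonical_hom X r T a = germ X PG x (slice_map U m n V) y"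
proof -
  obtain W where W: "W \<in> sdp_slices X r T" "a \<in> W" using assms G.Union_BB by blast
  obtain U m n V where 1: "W = sdp_basic X r T U m n V" "m \<in> MI" "n \<in> MI"
    "inj_open X (Tm m) U" "inj_open X (Tm n) V" using W(1) by (rule sdp_slicesE)
  obtain x z y where a: "a = (x, z, y)" by (cases a) auto
  have mem: "(x, z, y) \<in> sdp_basic X r T U m n V" using W 1 a by simp
  moreover have "z = mdiff m n" using mem by (simp add: sdp_basic_iff)
  then have "slice_map U m n V y = Some x" using mem slice_map_iff[OF 1(4,5)] by simp
  ultimately show ?thesis
    using that[OF a 1(2-5)] slice_map_in_PG[OF 1(4,5)] canonical_hom_eq[OF 1(2-5)] a by blast
qed

text \<open>The cocycle is the degree z; \<open>separating\<close> is immediate because an arrow is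
  the triple of its end points and its degree.\<close>

sublocale M: slice_morphism X "sdp_groupoid X r T" "\<lambda>a. snd (snd a)" fst "\<lambda>x. (x, \<lambda>_. 0, x)" "sdp_slices X r T"
  "germ_groupoid X PG" germ_src germ_rng "\<lambda>x. germ X PG x (pid X) x" "germ_slices X PG"
  "canonical_hom X r T" "\<lambda>a. fst (snd a)" r
proof
  let ?G = "sdp_groupoid X r T" and ?\<pi> = "canonical_hom X r T"
  have gm: "gmult ?G a b = (fst a, (\<lambda>j. fst (snd a) j + fst (snd b) j), snd (snd b))"
    and gi: "ginv ?G a = (snd (snd a), (\<lambda>j. - fst (snd a) j), fst a)" for a b
    by (cases a; cases b; simp add: sdp_groupoid_def)+
  fix a b assume "a \<in> arrows ?G"
  then obtain x z y U1 m1 n1 V1 where a: "a = (x, z, y)" "m1 \<in> MI" "n1 \<in> MI" "inj_open X (Tm m1) U1"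
    "inj_open X (Tm n1) V1" "(x, z, y) \<in> sdp_basic X r T U1 m1 n1 V1" "slice_map U1 m1 n1 V1 y = Some x"
    "slice_map U1 m1 n1 V1 \<in> PG" "?\<pi> a = germ X PG x (slice_map U1 m1 n1 V1) y"
    by (rule sdp_arrow_cases)
  show "?\<pi> a \<in> arrows (germ_groupoid X PG)" "germ_src (?\<pi> a) = snd (snd a)" "germ_rng (?\<pi> a) = fst a"
    unfolding a(9) using a(1,7,8) by (simp_all add: P.germ_arrowsI P.germ_src P.germ_rng)
  have z: "z = mdiff m1 n1" using a(6) by (simp add: sdp_basic_iff)
  show "fst (snd a) j = 0" if "r \<le> j" for j
    using a that by (simp add: z mdiff_def multi_indices_def)
  have "(y, \<lambda>j. - z j, x) \<in> sdp_basic X r T V1 n1 m1 U1"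
    using a(6) by (auto simp: sdp_basic_iff mdiff_def)
  then have "?\<pi> (ginv ?G a) = germ X PG y (slice_map V1 n1 m1 U1) x"
    using canonical_hom_eq[OF a(3,2,5,4)] a(1) by (simp add: gi)
  \<comment> \<open>Exchanging the two sides of the equation transposes the graph, hence inverts the
    map.\<close>
  also have "slice_map V1 n1 m1 U1 = pinv (slice_map U1 m1 n1 V1)"
  proof
    fix v
    have "slice_map V1 n1 m1 U1 v = Some w \<longleftrightarrow> pinv (slice_map U1 m1 n1 V1) v = Some w" for w
      using slice_map_iff[OF a(5,4)] slice_map_iff[OF a(4,5)] P.P_pinv_iff[OF a(8)]
      by (auto simp: sdp_basic_iff)
    then show "slice_map V1 n1 m1 U1 v = pinv (slice_map U1 m1 n1 V1) v" by (metis option.exhaust)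
  qed
  also have "germ X PG y (pinv (slice_map U1 m1 n1 V1)) x = ginv (germ_groupoid X PG) (?\<pi> a)"
    unfolding a(9) by (rule P.germ_inv[OF a(8,7), symmetric])
  finally show "?\<pi> (ginv ?G a) = ginv (germ_groupoid X PG) (?\<pi> a)" .
  assume "b \<in> arrows ?G"
  then obtain y' z' w U2 m2 n2 V2 where b: "b = (y', z', w)" "m2 \<in> MI" "n2 \<in> MI" "inj_open X (Tm m2) U2"
    "inj_open X (Tm n2) V2" "(y', z', w) \<in> sdp_basic X r T U2 m2 n2 V2" "slice_map U2 m2 n2 V2 w = Some y'"
    "slice_map U2 m2 n2 V2 \<in> PG" "?\<pi> b = germ X PG y' (slice_map U2 m2 n2 V2) w"
    by (rule sdp_arrow_cases)
  show "a = b" if "snd (snd a) = snd (snd b)" "fst a = fst b" "fst (snd a) = fst (snd b)"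
    using that by (simp add: a(1) b(1))
  show "fst (snd (gmult ?G a b)) j = fst (snd a) j + fst (snd b) j" for j by (simp add: gm)
  assume ab: "snd (snd a) = fst b"
  then have y: "y' = y" by (simp add: a(1) b(1))
  have "gmult ?G a b \<in> arrows ?G" using \<open>a \<in> arrows ?G\<close> \<open>b \<in> arrows ?G\<close> ab by (rule G.mult_closed)
  then obtain x3 z3 y3 U3 m3 n3 V3 where c: "gmult ?G a b = (x3, z3, y3)" "m3 \<in> MI" "n3 \<in> MI" "inj_open X (Tm m3) U3"
    "inj_open X (Tm n3) V3" "(x3, z3, y3) \<in> sdp_basic X r T U3 m3 n3 V3" "slice_map U3 m3 n3 V3 y3 = Some x3"
    "slice_map U3 m3 n3 V3 \<in> PG" "?\<pi> (gmult ?G a b) = germ X PG x3 (slice_map U3 m3 n3 V3) y3"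
    by (rule sdp_arrow_cases)
  have c': "x3 = x" "z3 = (\<lambda>j. z j + z' j)" "y3 = w" using c(1) by (simp_all add: gm a(1) b(1))
  have "agree_near X w (slice_map U1 m1 n1 V1 \<circ>\<^sub>m slice_map U2 m2 n2 V2) (slice_map U3 m3 n3 V3)"
    using canonical_hom_mult[OF a(2-5) b(2-5) c(2-5) a(6) b(6)[unfolded y] c(6)[unfolded c']] .
  moreover have "(slice_map U1 m1 n1 V1 \<circ>\<^sub>m slice_map U2 m2 n2 V2) w = Some x"
    using a(7) b(7) y by (simp add: map_comp_Some_iff)
  ultimately have "germ X PG x (slice_map U1 m1 n1 V1 \<circ>\<^sub>m slice_map U2 m2 n2 V2) w = germ X PG x (slice_map U3 m3 n3 V3) w"
    using a(8) b(8) c(7,8) c' by (intro P.germ_eqI P.P_comp) auto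
  then show "?\<pi> (gmult ?G a b) = gmult (germ_groupoid X PG) (?\<pi> a) (?\<pi> b)"
    unfolding c(9) a(9) b(9) c' y using a(7,8) b(7,8) y by (simp add: P.germ_mult)
next
  fix W assume "W \<in> sdp_slices X r T"
  then obtain U m n V where W: "W = sdp_basic X r T U m n V" "m \<in> MI" "n \<in> MI"
    "inj_open X (Tm m) U" "inj_open X (Tm n) V" by (rule sdp_slicesE)
  show "\<exists>z. \<forall>a\<in>W. fst (snd a) = z" unfolding W(1) sdp_basic_def by auto
  show "canonical_hom X r T ` W \<in> germ_slices X PG"
    unfolding W(1) image_canonical_hom[OF W(2-5)] P.germ_slices_iff
    using slice_map_in_PG[OF W(4,5)] biopen_dom[OF P.P_biopen] by blast
qed

end

theorem corollary1p13:
  fixes X :: "'x topology" and r :: nat and T :: "nat \<Rightarrow> 'x \<rightharpoonup> 'x"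
  assumes "Hausdorff_space X" and "second_countable X" and "locally_compact_space X"
    and "mgds X r T" and "domain_condition X r T"
  shows "\<exists>\<Phi>. star_hom (reduced_Cstar (sdp_groupoid X r T))
                     (reduced_Cstar (mgds_germ_groupoid X r T)) \<Phi> \<and>
    (\<forall>f\<in>Cc (sdp_groupoid X r T).
       fibre_sum (sdp_groupoid X r T) (mgds_germ_groupoid X r T) (canonical_hom X r T) f
         \<in> Cc (mgds_germ_groupoid X r T) \<and>
       \<Phi> (Cc_embed (sdp_groupoid X r T) f) =
         Cc_embed (mgds_germ_groupoid X r T)
           (fibre_sum (sdp_groupoid X r T) (mgds_germ_groupoid X r T) (canonical_hom X r T) f))"
proof -
  interpret mgds_dc X r T using assms by unfold_locales
  show ?thesis using M.push_extends by (simp add: mgds_germ_groupoid_def PG_def)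
qed

end
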